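(* Let $\mathbb{H}\in\{\mathbb{T}_{\pm},\Sigma\}$, where $\mathbb{T}_{\pm}$ denotes the real (signed) tropical hyperfield and $\Sigma=\{\ominus0,\mathbb{O},0\}$ the sign hyperfield, and let $\mathcal{C},\mathcal{D},\mathcal{V}\subseteq\mathbb{T}_{\pm}^k$ be the sets of circuits, cocircuits and vectors of an $\mathbb{H}$-matroid $\mathcal{M}$. (a) For $\mathbb{H}=\mathbb{T}_{\pm}$, $$\mathcal{V}=\mathrm{conv}_{TC}(\mathcal{C})\cup\{\mathbb{O}\}=\bigcap_{d\in\mathcal{D}}\mathcal{H}((\mathbb{O},d))=\mathcal{D}^{\perp}.$$ (b) For $\mathbb{H}=\Sigma$, $$\mathrm{span}_{TC}(\mathcal{V})=\mathrm{span}_{TC}(\mathcal{C})=\bigcap_{d\in\mathcal{D}}\mathcal{H}((\mathbb{O},d)),$$ $$\mathrm{conv}_{TC}(\mathcal{V})=\mathrm{conv}_{TC}(\mathcal{C}\cup\{\mathbb{O}\})=\bigcap_{d\in\mathcal{D}}\mathcal{H}((\mathbb{O},d))\cap[\ominus0,0]^k,$$ $$\mathcal{V}=\{\ominus0,\mathbb{O},0\}^k\cap\mathrm{conv}_{TC}(\mathcal{C}\cup\{\mathbb{O}\})=\{\ominus0,\mathbb{O},0\}^k\cap\bigcap_{d\in\mathcal{D}}\mathcal{H}((\mathbb{O},d)).$$ (c) If $\mathcal{M}$ is realizable by a linear space $L$ over $\mathbb{R}$ or over the field $\mathbb{K}$ of real Puiseux series, then the image of $L$ is the TC-convex hull of the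 image of the circuits of $L$ and the orthogonal to the images of the cocircuits of $L$ under the signed valuation.
   Context: Signed tropical numbers. Let $\mathbb{O}=-\infty$ be the tropical zero (also used for the all-$\mathbb{O}$ vector). $\mathbb{T}_{>\mathbb{O}}=\mathbb{R}$ (positive numbers), $\mathbb{T}_{<\mathbb{O}}=\{\ominus r: r\in\mathbb{R}\}$ (negative numbers), $\mathbb{T}_{\ge\mathbb{O}}=\mathbb{R}\cup\{\mathbb{O}\}$, $\mathbb{T}_{\pm}=\mathbb{T}_{>\mathbb{O}}\cup\mathbb{T}_{<\mathbb{O}}\cup\{\mathbb{O}\}$, balanced numbers $\mathbb{T}_{\bullet}=\{\bullet r: r\in\mathbb{R}\}\cup\{\mathbb{O}\}$, symmetrized semiring $\mathbb{S}=\mathbb{T}_{\pm}\cup\mathbb{T}_{\bullet}$. The norm is $|r|=|\ominus r|=|\bullet r|=r$ and $|\mathbb{O}|=\mathbb{O}$; the sign $\mathrm{tsgn}$ takes values in $\{\oplus,\ominus,\bullet,\mathbb{O}\}$. Addition on $\mathbb{S}$: $x\oplus y$ equals $x$ if $|x|>|y|$, $y$ if $|y|>|x|$, $x$ if $|x|=|y|$ and $\mathrm{tsgn}(x)=\mathrm{tsgn}(y)$, and $\bullet|x|$ if $|x|=|y|$ and the signs differ. Multiplication: $x\odot y$ has norm $|x|+|y|$ and sign the product of signs (with $\oplus,\ominus,\bullet$ multiplying like $1,-1,0$); $\mathbb{O}$ is absorbing. The multiplicative unit is the real number $0$. Order on $\mathbb{T}_{\pm}$: $x>y$ iff $x\oplus(\ominus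 y)\in\mathbb{T}_{>\mathbb{O}}$ (a total order); $[\ominus0,0]=\{x\in\mathbb{T}_{\pm}:\ominus0\le x\le0\}$. For $s\in\mathbb{S}$, $\mathcal{U}(s)=\{x\in\mathbb{T}_{\pm}:\ominus|s|\le x\le|s|\}$ if $s\in\mathbb{T}_{\bullet}$, $\mathcal{U}(s)=\{s\}$ otherwise; for vectors $\mathcal{U}(s)=\prod_i\mathcal{U}(s_i)$. Left sum: $x\lhd y=x$ if $|x|=|y|$, $x\lhd y=x\oplus y$ otherwise; componentwise on vectors. The support of a vector is the set of its non-$\mathbb{O}$ coordinates. Hyperplanes, halfspaces, orthogonality. For $a=(a_0,\dots,a_k)\in\mathbb{T}_{\pm}^{k+1}$ with $(a_1,\dots,a_k)\neq\mathbb{O}$ write $a(x)=a_0\oplus a_1\odot x_1\oplus\dots\oplus a_k\odot x_k$; $\mathcal{H}(a)=\{x\in\mathbb{T}_{\pm}^k:a(x)\in\mathbb{T}_{\bullet}\}$, $\overline{\mathcal{H}}^+(a)=\{x\in\mathbb{T}_{\pm}^k:a(x)\in\mathbb{T}_{>\mathbb{O}}\cup\mathbb{T}_{\bullet}\}$. Vectors $u,v\in\mathbb{T}_{\pm}^k$ are orthogonal, $u\perp v$, if $\bigoplus_iu_i\odot v_i\in\mathbb{T}_{\bullet}$; $U^{\perp}=\{v\in\mathbb{T}_{\pm}^k:u\perp v\ \forall u\in U\}$. An empty intersection is $\mathbb{T}_{\pm}^k$. TC-convexity. For $x,y\in\mathbb{T}_{\pm}^k$, $\mathrm{conv}_{TC}(x,y)$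 is the intersection of all $\overline{\mathcal{H}}^+(a)$ containing $x$ and $y$; $S$ is TC-convex if $\mathrm{conv}_{TC}(x,y)\subseteq S$ for all $x,y\in S$; $\mathrm{conv}_{TC}(M)$ (the TC-convex hull of $M$) is the intersection of all TC-convex sets containing $M$. $\mathrm{cone}_{TC}(M)$ is the smallest TC-convex cone (set closed under $\lambda\odot\cdot$ for all $\lambda\in\mathbb{T}_{>\mathbb{O}}$) containing $M$ and $\mathbb{O}$; $\mathrm{span}_{TC}(M)=\mathrm{cone}_{TC}(M\cup\ominus M)$. Matroids. Let $\mathbb{H}\in\{\Sigma,\mathbb{T}_{\pm}\}$ ($\Sigma$-matroids are oriented matroids, $\mathbb{T}_{\pm}$-matroids are oriented valuated matroids). A subset $\mathcal{V}\subseteq\mathbb{H}^k$ is the set of vectors of an $\mathbb{H}$-matroid iff: (V0) $\mathbb{O}\in\mathcal{V}$; (V1) $s\odot v\in\mathcal{V}$ for $s\in\mathbb{H},v\in\mathcal{V}$; (V2) $x\lhd y\in\mathcal{V}$ for $x,y\in\mathcal{V}$; (V3) if $x,y\in\mathcal{V}$ and $x_i=\ominus y_i\ne\mathbb{O}$, then there is $z\in\mathcal{V}$ with $z\in\mathcal{U}(x\oplus y)\cap\mathbb{H}^k$ and $z_i=\mathbb{O}$. Circuits are the vectors of inclusion-minimal support among the non-$\mathbb{O}$ vectors; covectors are the elements of $\mathbb{H}^k$ orthogonal to all circuits; cocircuits are the non-$\mathbb{O}$ covectors of minimal support. Linear spaces and realizability. $\mathbb{K}$ is the field of generalized real Puiseux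 series: formal series $\gamma=\sum_ic_it^{\alpha_i}$, $\alpha_i\in\mathbb{R}$, nonzero $c_i\in\mathbb{R}$, $\alpha_0>\alpha_1>\cdots$, with $(\alpha_i)$ finite (possibly empty, giving $0$) or unbounded, ordered by the sign of $c_0$. The signed valuation $\mathrm{sval}:\mathbb{K}\to\mathbb{T}_{\pm}$ sends $\gamma$ to $\alpha_0$, $\mathbb{O}$, $\ominus\alpha_0$ according to $\gamma>0$, $\gamma=0$, $\gamma<0$. The sign map sends an element of $\mathbb{R}$ or $\mathbb{K}$ to $0$, $\mathbb{O}$, $\ominus0$ in $\Sigma$ according to whether it is positive, zero, negative (on $\mathbb{R}$, viewed as constant series, it agrees with $\mathrm{sval}$). All maps are applied componentwise. For a field $F$, the vectors of a linear subspace $L\subseteq F^k$ are its elements, its circuits are its nonzero elements of inclusion-minimal support, and its cocircuits are the nonzero elements of minimal support of the dual space $\{w\in F^k:\sum_iw_iv_i=0\ \forall v\in L\}$. An $\mathbb{H}$-matroid is realizable over $F\in\{\mathbb{R},\mathbb{K}\}$, by the linear space $L\subseteq F^k$, if its set of vectors is the image of $L$ under the corresponding map (signed valuation for $\mathbb{T}_{\pm}$, sign map for $\Sigma$).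
   Formalization: In (c), for T± the TC-convex hull is joined with {O} (fails for L=0 otherwise); for Σ, where the image is finite, it equals Σ^k ∩ conv(image of circuits ∪ {O}) and Σ^k ∩ the orthogonal of the cocircuit images; k ≥ 1 is assumed. *)

theory Defs
  imports "HOL-Analysis.Analysis"
begin

section \<open>The symmetrized tropical semiring\<close>

datatype ssign = SPos | SNeg | SBal

text \<open>
  \<^term>\<open>TZero\<close> is the tropical zero (minus infinity); \<^term>\<open>TNum s r\<close> is the element of norm \<open>r\<close>
  and sign \<open>s\<close>.
\<close>
datatype symtrop = TZero | TNum ssign real

fun sgn_mult :: "ssign \<Rightarrow> ssign \<Rightarrow> ssign" where
  "sgn_mult SPos t = t"
| "sgn_mult s SPos = s"
| "sgn_mult SNeg SNeg = SPos"
| "sgn_mult s t = SBal"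

text \<open>
  The operations \<open>+\<close> and \<open>*\<close> are the tropical ones, so \<open>0\<close> is the tropical zero and \<open>1\<close> is the real
  number zero.  The class instances make \<^term>\<open>sum\<close>, vector addition and \<open>*s\<close> available.
\<close>
instantiation symtrop :: comm_semiring_1
begin

definition zero_symtrop :: symtrop where "0 = TZero"

definition one_symtrop :: symtrop where "1 = TNum SPos 0"

fun plus_symtrop :: "symtrop \<Rightarrow> symtrop \<Rightarrow> symtrop" where
  "TZero + y = y"
| "x + TZero = x"
| "TNum s a + TNum t b =
    (if a > b then TNum s a else if b > a then TNum t b
     else if s = t then TNum s a else TNum SBal a)"

fun times_symtrop :: "symtrop \<Rightarrow> symtrop \<Rightarrow> symtrop" where
  "TZero * y = TZero"
| "x * TZero = TZero"
| "TNum s a * TNum t b = TNum (sgn_mult s t) (a + b)"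

instance
proof
  fix a b c :: symtrop
  have sm_comm: "sgn_mult s t = sgn_mult t s" for s t
    by (cases s; cases t) auto
  have sm_assoc: "sgn_mult (sgn_mult s t) u = sgn_mult s (sgn_mult t u)" for s t u
    by (cases s; cases t; cases u) auto
  show "a + b + c = a + (b + c)"
    by (cases a; cases b; cases c) auto
  show "a + b = b + a"
    by (cases a; cases b) auto
  show "0 + a = a"
    by (simp add: zero_symtrop_def)
  show "a * b * c = a * (b * c)"
    by (cases a; cases b; cases c) (auto simp: sm_assoc)
  show "a * b = b * a"
    by (cases a; cases b) (auto simp: sm_comm)
  show "1 * a = a"
    by (cases a) (auto simp: one_symtrop_def)
  show "0 * a = 0" "a * 0 = 0"
    by (cases a; simp add: zero_symtrop_def)+
  show "(0::symtrop) \<noteq> 1"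
    by (simp add: zero_symtrop_def one_symtrop_def)
  have "(TNum s p + TNum t q) * TNum u r = TNum s p * TNum u r + TNum t q * TNum u r" for s t u p q r
    by (cases s; cases t; cases u) auto
  moreover have "x * TZero = TZero" for x
    by (cases x) auto
  ultimately show "(a + b) * c = a * c + b * c"
    by (cases a; cases b; cases c) (simp_all del: plus_symtrop.simps(3))
qed

end

text \<open>The unary minus is \<open>\<ominus>\<close>; it is not an additive inverse.\<close>
instantiation symtrop :: uminus
begin

fun uminus_symtrop :: "symtrop \<Rightarrow> symtrop" where
  "- TZero = TZero"
| "- TNum SPos r = TNum SNeg r"
| "- TNum SNeg r = TNum SPos r"
| "- TNum SBal r = TNum SBal r"

instance ..

end

text \<open>The norm, with values in the nonnegative tropical numbers.\<close>
instantiation symtrop :: abs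
begin

fun abs_symtrop :: "symtrop \<Rightarrow> symtrop" where
  "\<bar>TZero\<bar> = TZero"
| "\<bar>TNum s r\<bar> = TNum SPos r"

instance ..

end

definition tpos :: "symtrop set" where
  "tpos = range (TNum SPos)"

definition tneg :: "symtrop set" where
  "tneg = range (TNum SNeg)"

definition tbal :: "symtrop set" where
  "tbal = range (TNum SBal) \<union> {0}"

definition tpm :: "symtrop set" where
  "tpm = tpos \<union> tneg \<union> {0}"

definition sign_hyperfield :: "symtrop set" where
  "sign_hyperfield = {- 1, 0, 1}"

text \<open>The order is only meant to be used on \<^term>\<open>tpm\<close>, where it is total.\<close>
instantiation symtrop :: order
begin

definition less_symtrop :: "symtrop \<Rightarrow> symtrop \<Rightarrow> bool" where
  "y < x \<longleftrightarrow> x + (- y) \<in> tpos" for x y :: symtrop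

definition less_eq_symtrop :: "symtrop \<Rightarrow> symtrop \<Rightarrow> bool" where
  "y \<le> x \<longleftrightarrow> y < x \<or> y = x" for x y :: symtrop

instance
proof
  fix x y z :: symtrop
  have pos: "x \<in> tpos \<longleftrightarrow> (\<exists>r. x = TNum SPos r)" for x
    by (auto simp: tpos_def)
  have irr: "\<not> x < x" for x :: symtrop
    unfolding less_symtrop_def pos
    by (cases x rule: uminus_symtrop.cases) auto
  have tr: "x < y \<Longrightarrow> y < z \<Longrightarrow> x < z" for x y z :: symtrop
    unfolding less_symtrop_def pos
    by (cases x rule: uminus_symtrop.cases; cases y rule: uminus_symtrop.cases;
        cases z rule: uminus_symtrop.cases) (auto split: if_splits)
  show "x < y \<longleftrightarrow> x \<le> y \<and> \<not> y \<le> x"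
    unfolding less_eq_symtrop_def using irr tr by metis
  show "x \<le> x" by (simp add: less_eq_symtrop_def)
  show "x \<le> y \<Longrightarrow> y \<le> z \<Longrightarrow> x \<le> z"
    unfolding less_eq_symtrop_def using tr by metis
  show "x \<le> y \<Longrightarrow> y \<le> x \<Longrightarrow> x = y"
    unfolding less_eq_symtrop_def using irr tr by metis
qed

end

lemma tpm_linear: "x \<in> tpm \<Longrightarrow> y \<in> tpm \<Longrightarrow> x \<le> y \<or> y \<le> x"
  unfolding tpm_def less_eq_symtrop_def less_symtrop_def tpos_def tneg_def zero_symtrop_def
  by (auto split: if_splits)

definition unbalance :: "symtrop \<Rightarrow> symtrop set" where
  "unbalance s = (if s \<in> tbal then {x \<in> tpm. - \<bar>s\<bar> \<le> x \<and> x \<le> \<bar>s\<bar>} else {s})"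

definition left_sum :: "symtrop \<Rightarrow> symtrop \<Rightarrow> symtrop" where
  "left_sum x y = (if \<bar>x\<bar> = \<bar>y\<bar> then x else x + y)"


section \<open>Vectors, halfspaces and TC-convexity\<close>

definition vecs :: "'a set \<Rightarrow> ('a ^ 'n) set" where
  "vecs A = {x. \<forall>i. x $ i \<in> A}"

definition unbalance_vec :: "symtrop ^ 'n \<Rightarrow> (symtrop ^ 'n) set" where
  "unbalance_vec s = {x. \<forall>i. x $ i \<in> unbalance (s $ i)}"

definition left_sum_vec :: "symtrop ^ 'n \<Rightarrow> symtrop ^ 'n \<Rightarrow> symtrop ^ 'n" where
  "left_sum_vec x y = (\<chi> i. left_sum (x $ i) (y $ i))"

definition affine_form :: "symtrop \<Rightarrow> symtrop ^ 'n \<Rightarrow> symtrop ^ 'n \<Rightarrow> symtrop" where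
  "affine_form a0 a x = a0 + (\<Sum>i\<in>UNIV. a $ i * x $ i)"

definition hyperplane :: "symtrop \<Rightarrow> symtrop ^ 'n \<Rightarrow> (symtrop ^ 'n) set" where
  "hyperplane a0 a = {x \<in> vecs tpm. affine_form a0 a x \<in> tbal}"

definition closed_halfspace :: "symtrop \<Rightarrow> symtrop ^ 'n \<Rightarrow> (symtrop ^ 'n) set" where
  "closed_halfspace a0 a = {x \<in> vecs tpm. affine_form a0 a x \<in> tpos \<union> tbal}"

definition orth :: "symtrop ^ 'n \<Rightarrow> symtrop ^ 'n \<Rightarrow> bool" where
  "orth u v \<longleftrightarrow> (\<Sum>i\<in>UNIV. u $ i * v $ i) \<in> tbal"

definition perp :: "(symtrop ^ 'n) set \<Rightarrow> (symtrop ^ 'n) set" where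
  "perp U = {v \<in> vecs tpm. \<forall>u\<in>U. orth u v}"

definition tc_segment :: "symtrop ^ 'n \<Rightarrow> symtrop ^ 'n \<Rightarrow> (symtrop ^ 'n) set" where
  "tc_segment x y = \<Inter>{closed_halfspace a0 a | a0 a.
     a0 \<in> tpm \<and> a \<in> vecs tpm \<and> a \<noteq> 0 \<and> x \<in> closed_halfspace a0 a \<and> y \<in> closed_halfspace a0 a}
     \<inter> vecs tpm"

definition tc_convex :: "(symtrop ^ 'n) set \<Rightarrow> bool" where
  "tc_convex S \<longleftrightarrow> S \<subseteq> vecs tpm \<and> (\<forall>x\<in>S. \<forall>y\<in>S. tc_segment x y \<subseteq> S)"

definition trop_cone :: "(symtrop ^ 'n) set \<Rightarrow> bool" where
  "trop_cone S \<longleftrightarrow> (\<forall>l\<in>tpos. \<forall>x\<in>S. l *s x \<in> S)"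

definition conv_tc :: "(symtrop ^ 'n) set \<Rightarrow> (symtrop ^ 'n) set" where
  "conv_tc M = tc_convex hull M"

definition cone_tc :: "(symtrop ^ 'n) set \<Rightarrow> (symtrop ^ 'n) set" where
  "cone_tc M = (\<lambda>S. tc_convex S \<and> trop_cone S) hull (M \<union> {0})"

definition span_tc :: "(symtrop ^ 'n) set \<Rightarrow> (symtrop ^ 'n) set" where
  "span_tc M = cone_tc (M \<union> uminus ` M)"


section \<open>Matroids over the real tropical and the sign hyperfield\<close>

definition supp :: "'a::zero ^ 'n \<Rightarrow> 'n set" where
  "supp x = {i. x $ i \<noteq> 0}"

definition min_supp :: "('a::zero ^ 'n) set \<Rightarrow> ('a ^ 'n) set" where
  "min_supp A = {x \<in> A. x \<noteq> 0 \<and> \<not> (\<exists>y\<in>A. y \<noteq> 0 \<and> supp y \<subset> supp x)}"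

definition matroid_vectors :: "symtrop set \<Rightarrow> (symtrop ^ 'n) set \<Rightarrow> bool" where
  "matroid_vectors H V \<longleftrightarrow>
     V \<subseteq> vecs H \<and>
     0 \<in> V \<and>
     (\<forall>s\<in>H. \<forall>v\<in>V. s *s v \<in> V) \<and>
     (\<forall>x\<in>V. \<forall>y\<in>V. left_sum_vec x y \<in> V) \<and>
     (\<forall>x\<in>V. \<forall>y\<in>V. \<forall>i. x $ i = - (y $ i) \<and> x $ i \<noteq> 0 \<longrightarrow>
        (\<exists>z\<in>V. z \<in> unbalance_vec (x + y) \<inter> vecs H \<and> z $ i = 0))"

definition circuits :: "(symtrop ^ 'n) set \<Rightarrow> (symtrop ^ 'n) set" where
  "circuits V = min_supp V"

definition covectors :: "symtrop set \<Rightarrow> (symtrop ^ 'n) set \<Rightarrow> (symtrop ^ 'n) set" where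
  "covectors H V = {w \<in> vecs H. \<forall>c\<in>circuits V. orth w c}"

definition cocircuits :: "symtrop set \<Rightarrow> (symtrop ^ 'n) set \<Rightarrow> (symtrop ^ 'n) set" where
  "cocircuits H V = min_supp (covectors H V)"


section \<open>The field of generalized real Puiseux series\<close>

text \<open>
  A series is given by its coefficient function \<open>\<alpha> \<mapsto> c\<^sub>\<alpha>\<close>.  The exponents with nonzero coefficient
  form a strictly decreasing sequence which is finite or unbounded below iff only
  finitely many of them lie above any given bound.
\<close>
typedef puiseux = "{f :: real \<Rightarrow> real. \<forall>r. finite {a. r \<le> a \<and> f a \<noteq> 0}}"
  morphisms pu_coeff Abs_puiseux
  by (rule exI[of _ "\<lambda>_. 0"]) simp

lemma finite_coeff: "finite {a. r \<le> a \<and> pu_coeff x a \<noteq> 0}"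
  using pu_coeff by blast

lemma coeff_Abs: "(\<And>r. finite {a. r \<le> a \<and> f a \<noteq> 0}) \<Longrightarrow> pu_coeff (Abs_puiseux f) = f"
  by (rule Abs_puiseux_inverse) simp

lemma puiseux_eqI: "(\<And>a. pu_coeff x a = pu_coeff y a) \<Longrightarrow> x = y"
  by (simp add: pu_coeff_inject[symmetric] fun_eq_iff)

definition supp_le :: "puiseux \<Rightarrow> real \<Rightarrow> bool" where
  "supp_le x b \<longleftrightarrow> (\<forall>a. pu_coeff x a \<noteq> 0 \<longrightarrow> a \<le> b)"

lemma supp_le_mono: "supp_le x b \<Longrightarrow> b \<le> c \<Longrightarrow> supp_le x c"
  by (force simp: supp_le_def)

lemma ex_supp_le: "\<exists>b. supp_le x b"
proof -
  let ?F = "{a. 0 \<le> a \<and> pu_coeff x a \<noteq> 0}"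
  have "bdd_above ?F" using finite_coeff by simp
  then obtain M where M: "\<And>a. a \<in> ?F \<Longrightarrow> a \<le> M"
    by (auto simp: bdd_above_def)
  have "a \<le> max 0 M" if "pu_coeff x a \<noteq> 0" for a
    using M[of a] that by (cases "0 \<le> a") auto
  then show ?thesis by (auto simp: supp_le_def)
qed

lemma finite_conv: "finite {a. pu_coeff x a \<noteq> 0 \<and> pu_coeff y (c - a) \<noteq> 0}"
proof -
  obtain b where b: "supp_le y b" using ex_supp_le by blast
  have "{a. pu_coeff x a \<noteq> 0 \<and> pu_coeff y (c - a) \<noteq> 0} \<subseteq> {a. c - b \<le> a \<and> pu_coeff x a \<noteq> 0}"
    using b by (force simp: supp_le_def)
  then show ?thesis using finite_coeff finite_subset by blast
qed

instantiation puiseux :: comm_ring_1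
begin

definition zero_puiseux :: puiseux where
  "0 = Abs_puiseux (\<lambda>_. 0)"

definition one_puiseux :: puiseux where
  "1 = Abs_puiseux (\<lambda>a. if a = 0 then 1 else 0)"

definition plus_puiseux :: "puiseux \<Rightarrow> puiseux \<Rightarrow> puiseux" where
  "x + y = Abs_puiseux (\<lambda>a. pu_coeff x a + pu_coeff y a)"

definition uminus_puiseux :: "puiseux \<Rightarrow> puiseux" where
  "- x = Abs_puiseux (\<lambda>a. - pu_coeff x a)"

definition minus_puiseux :: "puiseux \<Rightarrow> puiseux \<Rightarrow> puiseux" where
  "x - y = x + (- y)" for x y :: puiseux

definition times_puiseux :: "puiseux \<Rightarrow> puiseux \<Rightarrow> puiseux" where
  "x * y = Abs_puiseux
     (\<lambda>c. \<Sum>a\<in>{a. pu_coeff x a \<noteq> 0 \<and> pu_coeff y (c - a) \<noteq> 0}. pu_coeff x a * pu_coeff y (c - a))"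

lemma coeff_0 [simp]: "pu_coeff 0 a = 0"
  by (simp add: zero_puiseux_def coeff_Abs)

lemma coeff_1: "pu_coeff 1 a = (if a = 0 then 1 else 0)"
proof -
  have "finite {a::real. r \<le> a \<and> (if a = 0 then 1 else 0) \<noteq> (0::real)}" for r
    by (rule finite_subset[of _ "{0}"]) auto
  then show ?thesis by (simp add: one_puiseux_def coeff_Abs)
qed

lemma coeff_plus [simp]: "pu_coeff (x + y) a = pu_coeff x a + pu_coeff y a"
proof -
  have "finite {a. r \<le> a \<and> pu_coeff x a + pu_coeff y a \<noteq> 0}" for r
    by (rule finite_subset[of _ "{a. r \<le> a \<and> pu_coeff x a \<noteq> 0} \<union> {a. r \<le> a \<and> pu_coeff y a \<noteq> 0}"])
      (auto simp: finite_coeff)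
  then show ?thesis by (simp add: plus_puiseux_def coeff_Abs)
qed

lemma coeff_uminus [simp]: "pu_coeff (- x) a = - pu_coeff x a"
  by (simp add: uminus_puiseux_def coeff_Abs finite_coeff)

lemma coeff_minus [simp]: "pu_coeff (x - y) a = pu_coeff x a - pu_coeff y a"
  by (simp add: minus_puiseux_def)

lemma coeff_times: "pu_coeff (x * y) c =
  (\<Sum>a\<in>{a. pu_coeff x a \<noteq> 0 \<and> pu_coeff y (c - a) \<noteq> 0}. pu_coeff x a * pu_coeff y (c - a))"
proof -
  let ?f = "\<lambda>c. \<Sum>a\<in>{a. pu_coeff x a \<noteq> 0 \<and> pu_coeff y (c - a) \<noteq> 0}. pu_coeff x a * pu_coeff y (c - a)"
  obtain bx where bx: "supp_le x bx" using ex_supp_le by blast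
  obtain b where b: "supp_le y b" using ex_supp_le by blast
  have "finite {c. r \<le> c \<and> ?f c \<noteq> 0}" for r
  proof -
    let ?X = "{a. r - b \<le> a \<and> pu_coeff x a \<noteq> 0}" and ?Y = "{a. r - bx \<le> a \<and> pu_coeff y a \<noteq> 0}"
    have "{c. r \<le> c \<and> ?f c \<noteq> 0} \<subseteq> (\<lambda>(p, q). p + q) ` (?X \<times> ?Y)"
    proof
      fix c assume "c \<in> {c. r \<le> c \<and> ?f c \<noteq> 0}"
      then have rc: "r \<le> c" and "?f c \<noteq> 0" by auto
      then have "{a. pu_coeff x a \<noteq> 0 \<and> pu_coeff y (c - a) \<noteq> 0} \<noteq> {}"
        by (metis (mono_tags, lifting) sum.empty)
      then obtain a where a: "pu_coeff x a \<noteq> 0" "pu_coeff y (c - a) \<noteq> 0" by blast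
      then have "a \<le> bx" "c - a \<le> b" using bx b by (auto simp: supp_le_def)
      then have "(a, c - a) \<in> ?X \<times> ?Y" using a rc by auto
      then show "c \<in> (\<lambda>(p, q). p + q) ` (?X \<times> ?Y)" by force
    qed
    then show ?thesis by (rule finite_subset) (simp add: finite_coeff)
  qed
  then show ?thesis by (simp add: times_puiseux_def coeff_Abs)
qed

lemma coeff_times_eq:
  assumes "finite A" "\<And>a. pu_coeff x a \<noteq> 0 \<Longrightarrow> pu_coeff y (c - a) \<noteq> 0 \<Longrightarrow> a \<in> A"
  shows "pu_coeff (x * y) c = (\<Sum>a\<in>A. pu_coeff x a * pu_coeff y (c - a))"
  unfolding coeff_times
  by (rule sum.mono_neutral_left) (use assms in auto)

lemma puiseux_times_commute: "x * y = y * x" for x y :: puiseux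
proof (rule puiseux_eqI)
  fix c
  show "pu_coeff (x * y) c = pu_coeff (y * x) c"
    unfolding coeff_times
    by (rule sum.reindex_bij_witness[of _ "\<lambda>a. c - a" "\<lambda>a. c - a"]) auto
qed

lemma supp_le_times:
  assumes "supp_le x b" "supp_le y c"
  shows "supp_le (x * y) (b + c)"
  unfolding supp_le_def
proof (intro allI impI)
  fix d assume "pu_coeff (x * y) d \<noteq> 0"
  then have "{a. pu_coeff x a \<noteq> 0 \<and> pu_coeff y (d - a) \<noteq> 0} \<noteq> {}"
    unfolding coeff_times by (metis (mono_tags, lifting) sum.empty)
  then obtain a where "pu_coeff x a \<noteq> 0" "pu_coeff y (d - a) \<noteq> 0" by blast
  then have "a \<le> b" "d - a \<le> c" using assms by (auto simp: supp_le_def)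
  then show "d \<le> b + c" by simp
qed

instance
proof
  fix x y z :: puiseux
  show "x * y * z = x * (y * z)"
  proof (rule puiseux_eqI)
    fix d
    obtain bx by' bz where b: "supp_le x bx" "supp_le y by'" "supp_le z bz"
      using ex_supp_le by metis
    let ?X = "{a. d - by' - bz \<le> a \<and> pu_coeff x a \<noteq> 0}"
    let ?Z = "{a. d - bx - by' \<le> a \<and> pu_coeff z a \<noteq> 0}"
    have bxy: "supp_le (x * y) (bx + by')" and byz: "supp_le (y * z) (by' + bz)"
      using b supp_le_times by auto
    have "pu_coeff (x * y * z) d = pu_coeff (z * (x * y)) d"
      by (simp add: puiseux_times_commute)
    also have "\<dots> = (\<Sum>c\<in>?Z. pu_coeff z c * pu_coeff (x * y) (d - c))"
      by (rule coeff_times_eq) (use bxy in \<open>force simp: finite_coeff supp_le_def\<close>)+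
    also have "\<dots> = (\<Sum>c\<in>?Z. pu_coeff z c * (\<Sum>a\<in>?X. pu_coeff x a * pu_coeff y (d - c - a)))"
    proof (rule sum.cong[OF refl])
      fix c assume c: "c \<in> ?Z"
      then have "c \<le> bz" using b by (auto simp: supp_le_def)
      then have "pu_coeff (x * y) (d - c) = (\<Sum>a\<in>?X. pu_coeff x a * pu_coeff y (d - c - a))"
        by (intro coeff_times_eq) (use b in \<open>force simp: finite_coeff supp_le_def\<close>)+
      then show "pu_coeff z c * pu_coeff (x * y) (d - c) =
        pu_coeff z c * (\<Sum>a\<in>?X. pu_coeff x a * pu_coeff y (d - c - a))" by simp
    qed
    also have "\<dots> = (\<Sum>c\<in>?Z. \<Sum>a\<in>?X. pu_coeff x a * (pu_coeff z c * pu_coeff y (d - a - c)))"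
      by (simp add: sum_distrib_left mult.left_commute diff_diff_eq add.commute)
    also have "\<dots> = (\<Sum>a\<in>?X. \<Sum>c\<in>?Z. pu_coeff x a * (pu_coeff z c * pu_coeff y (d - a - c)))"
      by (rule sum.swap)
    also have "\<dots> = (\<Sum>a\<in>?X. pu_coeff x a * pu_coeff (y * z) (d - a))"
    proof (rule sum.cong[OF refl])
      fix a assume a: "a \<in> ?X"
      then have "a \<le> bx" using b by (auto simp: supp_le_def)
      then have "pu_coeff (z * y) (d - a) = (\<Sum>c\<in>?Z. pu_coeff z c * pu_coeff y (d - a - c))"
        by (intro coeff_times_eq) (use b in \<open>force simp: finite_coeff supp_le_def\<close>)+
      then show "(\<Sum>c\<in>?Z. pu_coeff x a * (pu_coeff z c * pu_coeff y (d - a - c))) =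
        pu_coeff x a * pu_coeff (y * z) (d - a)"
        by (simp add: sum_distrib_left puiseux_times_commute[of y z])
    qed
    also have "\<dots> = pu_coeff (x * (y * z)) d"
      by (rule coeff_times_eq[symmetric]) (use byz in \<open>force simp: finite_coeff supp_le_def\<close>)+
    finally show "pu_coeff (x * y * z) d = pu_coeff (x * (y * z)) d" .
  qed
  show "x * y = y * x" by (rule puiseux_times_commute)
  show "1 * x = x"
  proof (rule puiseux_eqI)
    fix a
    have "pu_coeff (1 * x) a = (\<Sum>b\<in>{0}. pu_coeff 1 b * pu_coeff x (a - b))"
      by (rule coeff_times_eq) (auto simp: coeff_1 split: if_splits)
    then show "pu_coeff (1 * x) a = pu_coeff x a" by (simp add: coeff_1)
  qed
  show "(x + y) * z = x * z + y * z"
  proof (rule puiseux_eqI)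
    fix c
    let ?A = "{a. pu_coeff x a \<noteq> 0 \<and> pu_coeff z (c - a) \<noteq> 0} \<union>
              {a. pu_coeff y a \<noteq> 0 \<and> pu_coeff z (c - a) \<noteq> 0}"
    have fin: "finite ?A" by (simp add: finite_conv)
    have "pu_coeff ((x + y) * z) c = (\<Sum>a\<in>?A. pu_coeff (x + y) a * pu_coeff z (c - a))"
      "pu_coeff (x * z) c = (\<Sum>a\<in>?A. pu_coeff x a * pu_coeff z (c - a))"
      "pu_coeff (y * z) c = (\<Sum>a\<in>?A. pu_coeff y a * pu_coeff z (c - a))"
      by (rule coeff_times_eq[OF fin]; auto)+
    then show "pu_coeff ((x + y) * z) c = pu_coeff (x * z + y * z) c"
      by (simp add: distrib_right sum.distrib)
  qed
  have "pu_coeff 0 0 \<noteq> pu_coeff 1 0" by (simp add: coeff_1)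
  then show "(0::puiseux) \<noteq> 1" by metis
  show "x - y = x + - y" by (simp add: minus_puiseux_def)
qed (auto intro: puiseux_eqI)

end

lemma puiseux_nonzero: "x \<noteq> 0 \<longleftrightarrow> (\<exists>a. pu_coeff x a \<noteq> 0)"
  by (metis coeff_0 puiseux_eqI)

text \<open>The leading exponent \<open>\<alpha>\<^sub>0\<close>; only meaningful for nonzero series.\<close>
definition lead_exp :: "puiseux \<Rightarrow> real" where
  "lead_exp x = (GREATEST a. pu_coeff x a \<noteq> 0)"

lemma lead_exp:
  assumes "x \<noteq> 0"
  shows "pu_coeff x (lead_exp x) \<noteq> 0" "supp_le x (lead_exp x)"
proof -
  obtain a where a: "pu_coeff x a \<noteq> 0" using assms puiseux_nonzero by blast
  let ?F = "{b. a \<le> b \<and> pu_coeff x b \<noteq> 0}"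
  have fin: "finite ?F" and ne: "?F \<noteq> {}" using a finite_coeff by auto
  have M: "Max ?F \<in> ?F" using fin ne by (rule Max_in)
  have "b \<le> Max ?F" if "pu_coeff x b \<noteq> 0" for b
  proof (cases "a \<le> b")
    case True then show ?thesis using fin that by simp
  next
    case False
    have "a \<le> Max ?F" using M by blast
    with False show ?thesis by linarith
  qed
  then have "lead_exp x = Max ?F"
    unfolding lead_exp_def using M by (intro Greatest_equality) auto
  then show "pu_coeff x (lead_exp x) \<noteq> 0" "supp_le x (lead_exp x)"
    using M \<open>\<And>b. pu_coeff x b \<noteq> 0 \<Longrightarrow> b \<le> Max ?F\<close> by (auto simp: supp_le_def)
qed

lemma lead_exp_eq: "pu_coeff x a \<noteq> 0 \<Longrightarrow> supp_le x a \<Longrightarrow> lead_exp x = a"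
  unfolding lead_exp_def by (rule Greatest_equality) (auto simp: supp_le_def)

lemma coeff_times_top:
  assumes "supp_le x b" "supp_le y c"
  shows "pu_coeff (x * y) (b + c) = pu_coeff x b * pu_coeff y c"
proof -
  have "pu_coeff (x * y) (b + c) = (\<Sum>a\<in>{b}. pu_coeff x a * pu_coeff y (b + c - a))"
    by (rule coeff_times_eq) (use assms in \<open>force simp: supp_le_def\<close>)+
  then show ?thesis by simp
qed

definition monomial :: "real \<Rightarrow> real \<Rightarrow> puiseux" where
  "monomial c a = Abs_puiseux (\<lambda>b. if b = a then c else 0)"

lemma coeff_monomial: "pu_coeff (monomial c a) b = (if b = a then c else 0)"
proof -
  have "finite {b. r \<le> b \<and> (if b = a then c else 0) \<noteq> 0}" for r
    by (rule finite_subset[of _ "{a}"]) auto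
  then show ?thesis by (simp add: monomial_def coeff_Abs)
qed

lemma supp_le_monomial: "supp_le (monomial c a) a"
  by (simp add: supp_le_def coeff_monomial)

lemma supp_le_power: "supp_le u b \<Longrightarrow> supp_le (u ^ n) (of_nat n * b)"
proof (induction n)
  case 0
  then show ?case by (simp add: supp_le_def coeff_1)
next
  case (Suc n)
  then have "supp_le (u * u ^ n) (b + of_nat n * b)" by (intro supp_le_times) auto
  then show ?case by (simp add: algebra_simps)
qed

lemma geometric_inverse:
  assumes u: "supp_le u (- e)" and e: "e > 0"
  shows "\<exists>v. (1 - u) * v = (1 :: puiseux)"
proof -
  define N where "N b = nat \<lceil>- b / e\<rceil>" for b
  have big: "pu_coeff (u ^ n) b = 0" if "n > N c" "c \<le> b" for n b c
  proof (rule ccontr)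
    assume "pu_coeff (u ^ n) b \<noteq> 0"
    then have "b \<le> - (of_nat n * e)"
      using supp_le_power[OF u, of n] by (auto simp: supp_le_def)
    moreover have "- c / e < of_nat n" using that unfolding N_def by linarith
    then have "- c < of_nat n * e" using e by (simp add: field_simps)
    ultimately show False using that by linarith
  qed
  define f where "f b = pu_coeff (\<Sum>n\<le>N b. u ^ n) b" for b
  have coeff_sum: "pu_coeff (\<Sum>n\<in>A. g n) b = (\<Sum>n\<in>A. pu_coeff (g n) b)"
    for A :: "nat set" and g b
    by (induction A rule: infinite_finite_induct) auto
  have f_eq: "f b = pu_coeff (\<Sum>n\<le>N c. u ^ n) b" if "c \<le> b" for b c
  proof -
    have "N b \<le> N c" unfolding N_def using that e
      by (intro nat_mono ceiling_mono divide_right_mono) auto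
    then show ?thesis unfolding f_def coeff_sum
      by (intro sum.mono_neutral_left) (use big[of b _ b] in auto)
  qed
  have "finite {b. r \<le> b \<and> f b \<noteq> 0}" for r
    by (rule finite_subset[OF _ finite_coeff[of r "\<Sum>n\<le>N r. u ^ n"]]) (use f_eq[of r] in auto)
  then have cv: "pu_coeff (Abs_puiseux f) = f" by (rule coeff_Abs)
  define v where "v = Abs_puiseux f"
  have "pu_coeff ((1 - u) * v) b = pu_coeff 1 b" for b
  proof -
    define w where "w = (\<Sum>n\<le>N b. u ^ n)"
    have s: "supp_le (1 - u) 0"
      using u e by (force simp: supp_le_def coeff_1)
    have vw: "pu_coeff (v - w) a = 0" if "b \<le> a" for a
      using f_eq[OF that] by (simp add: v_def w_def cv)
    have "pu_coeff ((1 - u) * (v - w)) b = (\<Sum>a\<in>{}. pu_coeff (1 - u) a * pu_coeff (v - w) (b - a))"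
    proof (rule coeff_times_eq)
      fix a assume "pu_coeff (1 - u) a \<noteq> 0" "pu_coeff (v - w) (b - a) \<noteq> 0"
      then have "a \<le> 0" "\<not> b \<le> b - a" using s vw unfolding supp_le_def by blast+
      then show "a \<in> {}" by simp
    qed simp
    moreover have "(1 - u) * w = 1 - u ^ Suc (N b)"
      unfolding w_def by (rule sum_gp_basic)
    moreover have "pu_coeff (u ^ Suc (N b)) b = 0"
      by (rule big[of b]) auto
    moreover have "(1 - u) * v = (1 - u) * (v - w) + (1 - u) * w"
      by (simp add: algebra_simps)
    ultimately show ?thesis by (simp del: power_Suc)
  qed
  then have "(1 - u) * v = 1" by (rule puiseux_eqI)
  then show ?thesis ..
qed

lemma puiseux_inverse_exists:
  assumes "x \<noteq> 0"
  shows "\<exists>y. x * y = (1 :: puiseux)"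
proof -
  define m where "m = monomial (1 / pu_coeff x (lead_exp x)) (- lead_exp x)"
  define u where "u = 1 - x * m"
  have sm: "supp_le m (- lead_exp x)"
    unfolding m_def by (rule supp_le_monomial)
  have "supp_le (x * m) 0"
    using supp_le_times[OF lead_exp(2)[OF assms] sm] by simp
  then have u0: "supp_le u 0"
    by (force simp: u_def supp_le_def coeff_1)
  have "pu_coeff (x * m) 0 = 1"
    using coeff_times_top[OF lead_exp(2)[OF assms] sm] lead_exp(1)[OF assms]
    by (simp add: m_def coeff_monomial)
  then have c0: "pu_coeff u 0 = 0" by (simp add: u_def coeff_1)
  have "\<exists>e>0. supp_le u (- e)"
  proof (cases "u = 0")
    case True
    then show ?thesis by (intro exI[of _ 1]) (simp add: supp_le_def)
  next
    case False
    then have "lead_exp u \<le> 0" "lead_exp u \<noteq> 0"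
      using lead_exp[OF False] u0 c0 by (auto simp: supp_le_def)
    then show ?thesis using lead_exp[OF False] by (intro exI[of _ "- lead_exp u"]) auto
  qed
  then obtain v where "(1 - u) * v = 1" using geometric_inverse by blast
  then have "x * (m * v) = 1" by (simp add: u_def mult.assoc)
  then show ?thesis ..
qed

lemma lead_coeff_times:
  assumes "x \<noteq> 0" "y \<noteq> 0"
  shows "x * y \<noteq> 0" "lead_exp (x * y) = lead_exp x + lead_exp y"
    "pu_coeff (x * y) (lead_exp (x * y)) = pu_coeff x (lead_exp x) * pu_coeff y (lead_exp y)"
proof -
  have top: "pu_coeff (x * y) (lead_exp x + lead_exp y) = pu_coeff x (lead_exp x) * pu_coeff y (lead_exp y)"
    by (rule coeff_times_top) (use assms lead_exp in auto)
  then have nz: "pu_coeff (x * y) (lead_exp x + lead_exp y) \<noteq> 0" using assms lead_exp by auto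
  then show "x * y \<noteq> 0" using puiseux_nonzero by blast
  show "lead_exp (x * y) = lead_exp x + lead_exp y"
    by (rule lead_exp_eq[OF nz supp_le_times]) (use assms lead_exp in auto)
  then show "pu_coeff (x * y) (lead_exp (x * y)) = pu_coeff x (lead_exp x) * pu_coeff y (lead_exp y)"
    using top by simp
qed

definition puiseux_pos :: "puiseux \<Rightarrow> bool" where
  "puiseux_pos x \<longleftrightarrow> pu_coeff x (lead_exp x) > 0"

lemma puiseux_pos_0: "\<not> puiseux_pos 0"
  by (simp add: puiseux_pos_def)

lemma puiseux_pos_uminus: "puiseux_pos (- x) \<longleftrightarrow> pu_coeff x (lead_exp x) < 0"
  by (simp add: puiseux_pos_def lead_exp_def)

lemma puiseux_pos_cases: "x = 0 \<or> puiseux_pos x \<or> puiseux_pos (- x)"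
  unfolding puiseux_pos_uminus unfolding puiseux_pos_def using lead_exp(1)[of x] by linarith

lemma puiseux_pos_not_uminus: "puiseux_pos x \<Longrightarrow> \<not> puiseux_pos (- x)"
  by (simp add: puiseux_pos_uminus, simp add: puiseux_pos_def)

lemma puiseux_pos_times: "puiseux_pos x \<Longrightarrow> puiseux_pos y \<Longrightarrow> puiseux_pos (x * y)"
  using lead_coeff_times(3)[of x y] puiseux_pos_0 by (cases "x = 0"; cases "y = 0") (auto simp: puiseux_pos_def)

lemma puiseux_pos_plus:
  assumes "puiseux_pos x" "puiseux_pos y"
  shows "puiseux_pos (x + y)"
proof -
  have ne: "x \<noteq> 0" "y \<noteq> 0" using assms puiseux_pos_0 by auto
  define m where "m = max (lead_exp x) (lead_exp y)"
  have le: "supp_le x m" "supp_le y m"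
    using lead_exp(2)[OF ne(1)] lead_exp(2)[OF ne(2)] by (auto simp: m_def intro: supp_le_mono)
  have zero: "pu_coeff z m = 0" if "supp_le z b" "b < m" for z b
    using that by (force simp: supp_le_def)
  have "pu_coeff x m = 0 \<or> m = lead_exp x" "pu_coeff y m = 0 \<or> m = lead_exp y"
    "m = lead_exp x \<or> m = lead_exp y"
    using zero[OF lead_exp(2)[OF ne(1)]] zero[OF lead_exp(2)[OF ne(2)]]
    by (auto simp: m_def max_def not_le split: if_splits)
  then have "pu_coeff x m \<ge> 0" "pu_coeff y m \<ge> 0" "pu_coeff x m > 0 \<or> pu_coeff y m > 0"
    using assms unfolding puiseux_pos_def by fastforce+
  then have pos: "pu_coeff (x + y) m > 0" by auto
  moreover have "supp_le (x + y) m" using le by (force simp: supp_le_def)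
  ultimately have "lead_exp (x + y) = m" by (intro lead_exp_eq) auto
  then show ?thesis using pos by (simp add: puiseux_pos_def)
qed

instantiation puiseux :: linordered_field
begin

definition inverse_puiseux :: "puiseux \<Rightarrow> puiseux" where
  "inverse x = (if x = 0 then 0 else (SOME y. x * y = 1))" for x :: puiseux

definition divide_puiseux :: "puiseux \<Rightarrow> puiseux \<Rightarrow> puiseux" where
  "x div y = x * inverse y" for x y :: puiseux

definition less_puiseux :: "puiseux \<Rightarrow> puiseux \<Rightarrow> bool" where
  "x < y \<longleftrightarrow> puiseux_pos (y - x)"

definition less_eq_puiseux :: "puiseux \<Rightarrow> puiseux \<Rightarrow> bool" where
  "x \<le> y \<longleftrightarrow> x < y \<or> x = y" for x y :: puiseux

definition abs_puiseux :: "puiseux \<Rightarrow> puiseux" where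
  "\<bar>x\<bar> = (if x < 0 then - x else x)" for x :: puiseux

definition sgn_puiseux :: "puiseux \<Rightarrow> puiseux" where
  "sgn x = (if x = 0 then 0 else if 0 < x then 1 else - 1)" for x :: puiseux

instance
proof
  fix x y z :: puiseux
  show "x \<noteq> 0 \<Longrightarrow> inverse x * x = 1"
    using someI_ex[OF puiseux_inverse_exists[of x]] by (simp add: inverse_puiseux_def mult.commute)
  show "x div y = x * inverse y" by (rule divide_puiseux_def)
  show "inverse (0::puiseux) = 0" by (simp add: inverse_puiseux_def)
  have irr: "\<not> x < x" for x :: puiseux by (simp add: less_puiseux_def puiseux_pos_0)
  have tr: "x < y \<Longrightarrow> y < z \<Longrightarrow> x < z" for x y z :: puiseux
    using puiseux_pos_plus[of "y - x" "z - y"] by (simp add: less_puiseux_def)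
  show "x < y \<longleftrightarrow> x \<le> y \<and> \<not> y \<le> x"
    unfolding less_eq_puiseux_def using irr tr by metis
  show "x \<le> x" by (simp add: less_eq_puiseux_def)
  show "x \<le> y \<Longrightarrow> y \<le> z \<Longrightarrow> x \<le> z"
    unfolding less_eq_puiseux_def using tr by metis
  show "x \<le> y \<Longrightarrow> y \<le> x \<Longrightarrow> x = y"
    unfolding less_eq_puiseux_def using irr tr by metis
  show "x \<le> y \<or> y \<le> x"
    using puiseux_pos_cases[of "y - x"] by (auto simp: less_eq_puiseux_def less_puiseux_def)
  show "x \<le> y \<Longrightarrow> z + x \<le> z + y"
    by (auto simp: less_eq_puiseux_def less_puiseux_def)
  show "x < y \<Longrightarrow> 0 < z \<Longrightarrow> z * x < z * y"
    using puiseux_pos_times[of z "y - x"] by (simp add: less_puiseux_def algebra_simps)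
  show "\<bar>x\<bar> = (if x < 0 then - x else x)" by (rule abs_puiseux_def)
  show "sgn x = (if x = 0 then 0 else if 0 < x then 1 else - 1)" by (rule sgn_puiseux_def)
qed

end

text \<open>
  On nonzero elements this is the leading exponent with the sign of the leading coefficient,
  since the order on series is given by that sign.
\<close>
definition sval :: "puiseux \<Rightarrow> symtrop" where
  "sval x = (if x > 0 then TNum SPos (lead_exp x) else if x = 0 then 0 else TNum SNeg (lead_exp x))"

definition sval_real :: "real \<Rightarrow> symtrop" where
  "sval_real c = sval (monomial c 0)"

definition sign_map :: "'a::linordered_field \<Rightarrow> symtrop" where
  "sign_map x = (if x > 0 then 1 else if x = 0 then 0 else - 1)"


section \<open>Realizability\<close>

definition image_vec :: "('a \<Rightarrow> 'b) \<Rightarrow> ('a ^ 'n) set \<Rightarrow> ('b ^ 'n) set" where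
  "image_vec f L = (\<lambda>x. \<chi> i. f (x $ i)) ` L"

definition lin_circuits :: "('a::field ^ 'n) set \<Rightarrow> ('a ^ 'n) set" where
  "lin_circuits L = min_supp L"

definition dual_space :: "('a::field ^ 'n) set \<Rightarrow> ('a ^ 'n) set" where
  "dual_space L = {w. \<forall>v\<in>L. (\<Sum>i\<in>UNIV. w $ i * v $ i) = 0}"

definition lin_cocircuits :: "('a::field ^ 'n) set \<Rightarrow> ('a ^ 'n) set" where
  "lin_cocircuits L = min_supp (dual_space L)"

definition realizes :: "('a::field \<Rightarrow> symtrop) \<Rightarrow> ('a ^ 'n) set \<Rightarrow> (symtrop ^ 'n) set \<Rightarrow> bool" where
  "realizes f L V \<longleftrightarrow> vec.subspace L \<and> V = image_vec f L"

text \<open>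
  The conclusions on the image of a realizing space, for the two hyperfields.  The set
  \<open>conv_tc (image_vec f (lin_circuits L))\<close> need not contain the zero vector, which has to be added.
  For the sign hyperfield the image lies in the finite set \<^term>\<open>vecs sign_hyperfield\<close>, whereas
  hulls and orthogonal sets live in \<^term>\<open>vecs tpm\<close>: the image consists of the sign vectors in these
  sets, and its hull is the hull of the circuits with zero.
\<close>
definition tropical_image_description :: "('a::field \<Rightarrow> symtrop) \<Rightarrow> ('a ^ 'n) set \<Rightarrow> bool" where
  "tropical_image_description f L \<longleftrightarrow>
     image_vec f L = conv_tc (image_vec f (lin_circuits L)) \<union> {0} \<and>
     image_vec f L = perp (image_vec f (lin_cocircuits L))"

definition sign_image_description :: "('a::field \<Rightarrow> symtrop) \<Rightarrow> ('a ^ 'n) set \<Rightarrow> bool" where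
  "sign_image_description f L \<longleftrightarrow>
     image_vec f L = vecs sign_hyperfield \<inter> conv_tc (image_vec f (lin_circuits L) \<union> {0}) \<and>
     image_vec f L = vecs sign_hyperfield \<inter> perp (image_vec f (lin_cocircuits L)) \<and>
     conv_tc (image_vec f L) = conv_tc (image_vec f (lin_circuits L) \<union> {0}) \<and>
     conv_tc (image_vec f L) =
       perp (image_vec f (lin_cocircuits L)) \<inter> vecs {x \<in> tpm. - 1 \<le> x \<and> x \<le> 1}"

end

theory Submission
  imports Defs
begin

text \<open>
  Write \<open>x \<sqsubseteq> y\<close> if in every coordinate \<open>x\<close> agrees with \<open>y\<close> or has smaller norm.  Left sums lie on
  TC-segments, and every vector of a matroid is a left sum of circuits \<open>c \<sqsubseteq> v\<close> (eliminate repeatedly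
  between \<open>v\<close> and a suitably scaled circuit until no coordinate of opposite sign and equal norm is
  left).  Hence vectors lie in the hull of the circuits, and a set defined by orthogonality contains
  all vectors as soon as it contains the circuits.

  The remaining inclusion is duality.  For a coordinate \<open>e\<close> and a partition of the other coordinates
  with suitable constraints \<open>A\<^sub>f\<close> and \<open>B\<^sub>f\<close> there is a vector with entry \<open>1\<close> at \<open>e\<close> that satisfies
  all \<open>A\<^sub>f\<close> or an orthogonal vector with entry \<open>1\<close> at \<open>e\<close> that satisfies all \<open>B\<^sub>f\<close>: trade the
  constraint at \<open>f\<close> for \<open>0\<close> on one side and no condition on the other; if both results violate the
  constraints at \<open>f\<close>, their product at \<open>f\<close> prevents them from being orthogonal.  Without constraints
  the orthogonal vector is read off from the fundamental circuits of a basis.  This alternative yields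
  both the elimination axiom for the orthogonal vectors and the bidual theorem.

  Over the sign hyperfield, a real point orthogonal to the cocircuits is the left sum of scalings of
  its sign patterns cut off at the norms of its coordinates.
\<close>

section \<open>Signed tropical numbers\<close>

text \<open>Norms take values in \<open>ereal\<close> because there the order is linear and
  multiplication becomes ordinary addition, with \<open>-\<infinity>\<close> for the tropical
  zero.\<close>

definition nrm :: "symtrop \<Rightarrow> ereal" where
  "nrm x = (case x of TZero \<Rightarrow> -\<infinity> | TNum s r \<Rightarrow> ereal r)"

lemma nrm_simps [simp]: "nrm TZero = -\<infinity>" "nrm (TNum s r) = ereal r" "nrm 0 = -\<infinity>" "nrm 1 = 0"
  by (auto simp: nrm_def zero_symtrop_def one_symtrop_def zero_ereal_def)

lemma tpm_cases [consumes 1, case_names zero pos neg]: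
  assumes "x \<in> tpm"
  obtains "x = TZero" | r where "x = TNum SPos r" | r where "x = TNum SNeg r"
  using assms by (auto simp: tpm_def tpos_def tneg_def zero_symtrop_def)

lemma mem_simps [simp]:
  "TZero \<in> tpm" "0 \<in> tpm" "1 \<in> tpm" "TNum s r \<in> tpm \<longleftrightarrow> s \<noteq> SBal"
  "TNum s r \<in> tpos \<longleftrightarrow> s = SPos" "TZero \<notin> tpos"
  "TNum s r \<in> tneg \<longleftrightarrow> s = SNeg" "TZero \<notin> tneg"
  "TNum s r \<in> tbal \<longleftrightarrow> s = SBal" "TZero \<in> tbal"
  by (cases s; auto simp: tpm_def tpos_def tneg_def tbal_def zero_symtrop_def one_symtrop_def)+

lemma nrm_eq_MInf [simp]: "nrm x = -\<infinity> \<longleftrightarrow> x = 0"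
  by (cases x) (auto simp: zero_symtrop_def)

lemma nrm_mult: "nrm (x * y) = nrm x + nrm y"
  by (cases x; cases y) auto

lemma nrm_uminus [simp]: "nrm (- x) = nrm x"
  by (cases x rule: uminus_symtrop.cases) auto

lemma uminus_uminus [simp]: "- (- x) = (x::symtrop)"
  by (cases x rule: uminus_symtrop.cases) auto

lemma uminus_zero_symtrop [simp]: "- 0 = (0::symtrop)"
  by (simp add: zero_symtrop_def)

lemma uminus_eq_zero_symtrop [simp]: "- x = 0 \<longleftrightarrow> x = (0::symtrop)"
  by (cases x rule: uminus_symtrop.cases) (auto simp: zero_symtrop_def)

lemma uminus_mult_left: "- (x * y) = - x * (y::symtrop)"
  by (cases x rule: uminus_symtrop.cases; cases y rule: uminus_symtrop.cases) auto

lemma uminus_mult_right: "- (x * y) = x * - (y::symtrop)"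
  by (metis mult.commute uminus_mult_left)

lemma uminus_plus_symtrop: "- (x + y) = - x + - (y::symtrop)"
  by (cases x rule: uminus_symtrop.cases; cases y rule: uminus_symtrop.cases) auto

lemma uminus_sum_symtrop: "- (\<Sum>i\<in>A. f i) = (\<Sum>i\<in>A. - f i :: symtrop)"
  by (induction A rule: infinite_finite_induct) (auto simp: uminus_plus_symtrop)

lemma mult_eq_zero_symtrop [simp]: "x * y = 0 \<longleftrightarrow> x = 0 \<or> y = (0::symtrop)"
  by (cases x; cases y) (auto simp: zero_symtrop_def)

lemma tpm_mult: "x \<in> tpm \<Longrightarrow> y \<in> tpm \<Longrightarrow> x * y \<in> tpm"
  by (cases x rule: tpm_cases; cases y rule: tpm_cases) auto

lemma tpm_uminus [simp]: "- x \<in> tpm \<longleftrightarrow> x \<in> tpm"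
  by (cases x rule: uminus_symtrop.cases) auto

lemma uminus_tpos_iff [simp]: "- x \<in> tpos \<longleftrightarrow> x \<in> tneg" "- x \<in> tneg \<longleftrightarrow> x \<in> tpos"
  by (cases x rule: uminus_symtrop.cases; simp)+

lemma tbal_iff: "x \<in> tbal \<longleftrightarrow> x \<in> tpos \<union> tbal \<and> - x \<in> tpos \<union> tbal"
  by (cases x rule: uminus_symtrop.cases) auto

lemma tbal_tpm_zero: "x \<in> tbal \<Longrightarrow> x \<in> tpm \<Longrightarrow> x = 0"
  by (cases x) (auto simp: zero_symtrop_def)

lemma uminus_neq_self: "x \<in> tpm \<Longrightarrow> x \<noteq> 0 \<Longrightarrow> - x \<noteq> x"
  by (cases x rule: tpm_cases) (auto simp: zero_symtrop_def)

lemma nrm_eq_cases: "x \<in> tpm \<Longrightarrow> y \<in> tpm \<Longrightarrow> nrm x = nrm y \<Longrightarrow> x = y \<or> x = - y"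
  by (cases x rule: tpm_cases; cases y rule: tpm_cases) auto

lemma tpm_inverse:
  assumes "x \<in> tpm" "x \<noteq> 0"
  obtains y where "y \<in> tpm" "x * y = 1" "y \<noteq> 0" "nrm y = - nrm x"
using assms(1)
proof (cases rule: tpm_cases)
  case (pos r)
  then show ?thesis by (intro that[of "TNum SPos (- r)"]) (auto simp: one_symtrop_def zero_symtrop_def)
next
  case (neg r)
  then show ?thesis by (intro that[of "TNum SNeg (- r)"]) (auto simp: one_symtrop_def zero_symtrop_def)
qed (use assms in \<open>simp add: zero_symtrop_def\<close>)

text \<open>If the norms differ, the tropical sum is the summand of larger norm; hence a left sum
  always selects one of its arguments, the left one in a tie.\<close>

lemma left_sum_eq: "left_sum x y = (if nrm y \<le> nrm x then x else y)"
  unfolding left_sum_def by (cases x; cases y) auto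

text \<open>A sum of signed numbers is balanced only for opposite signs at equal norm, which is the
  last branch, or for two zeros, which fall under \<open>x = y\<close>.\<close>

lemma unbalance_plus_iff:
  assumes "x \<in> tpm" "y \<in> tpm"
  shows "z \<in> unbalance (x + y) \<longleftrightarrow> z \<in> tpm \<and>
    (if nrm y < nrm x then z = x else if nrm x < nrm y then z = y
     else if x = y then z = x else nrm z \<le> nrm x)"
  using assms
  by (cases x rule: uminus_symtrop.cases; cases y rule: uminus_symtrop.cases; cases z rule: uminus_symtrop.cases)
    (auto simp: zero_symtrop_def unbalance_def less_eq_symtrop_def less_symtrop_def split: if_splits)

text \<open>If \<open>p + q\<close> is unbalanced, \<open>z\<close> equals it. If it is balanced,
  its norm is at least that of \<open>z\<close>: either it absorbs \<open>R\<close>, or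
  \<open>R\<close> dominates both and was balanced already. This pulls orthogonality back from the
  result of an elimination.\<close>

lemma unbalance_plus_tbal:
  assumes "p \<in> tpm" "q \<in> tpm" "z \<in> unbalance (p + q)" "z + R \<in> tbal"
  shows "p + q + R \<in> tbal"
proof (cases "p + q \<in> tbal")
  case False
  then show ?thesis using assms by (simp add: unbalance_def)
next
  case True
  then have "nrm z \<le> nrm (p + q)" "z \<in> tpm"
    using assms(1-3) unfolding unbalance_plus_iff[OF assms(1,2)]
    by (cases p rule: uminus_symtrop.cases; cases q rule: uminus_symtrop.cases;
        force simp: zero_symtrop_def split: if_splits)+
  then show ?thesis using True assms(4)
    by (cases "p + q"; cases z; cases R) (auto split: if_splits)
qed

section \<open>Sums and orthogonality\<close>

text \<open>Addition is idempotent, so a sum of signed terms depends only on their set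
  \<open>B\<close>. Here \<open>r\<close> is the largest norm in \<open>B\<close> and
  \<open>t\<close> the value of the sum.\<close>

definition dom_value :: "symtrop set \<Rightarrow> real \<Rightarrow> symtrop \<Rightarrow> bool" where
  "dom_value B r t \<longleftrightarrow> (\<forall>b\<in>B. nrm b \<le> ereal r) \<and>
      (t = TNum SPos r \<and> TNum SPos r \<in> B \<and> TNum SNeg r \<notin> B \<or>
       t = TNum SNeg r \<and> TNum SNeg r \<in> B \<and> TNum SPos r \<notin> B \<or>
       t = TNum SBal r \<and> TNum SPos r \<in> B \<and> TNum SNeg r \<in> B)"

lemma dom_value_insert_le:
  assumes "dom_value B r t" "a \<in> tpm" "nrm a \<le> ereal r"
  shows "dom_value (insert a B) r (a + t)"
  using assms unfolding dom_value_def
  by (cases a rule: uminus_symtrop.cases) (auto simp: le_less)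

lemma dom_value_insert_gt:
  assumes "dom_value B r t" "a \<in> tpm" "ereal r < nrm a"
  shows "\<exists>q. dom_value (insert a B) q (a + t)"
proof -
  obtain s q where a: "a = TNum s q" and q: "r < q" using assms(3) by (cases a) auto
  have lt: "nrm b < ereal q" if "b \<in> B" for b
    using assms(1) that q unfolding dom_value_def by (meson le_less_trans less_ereal.simps(1))
  then have "TNum SPos q \<notin> B" "TNum SNeg q \<notin> B" by fastforce+
  moreover have "a + t = a" using assms(1) a q unfolding dom_value_def by auto
  ultimately show ?thesis
    using lt a assms(2) unfolding dom_value_def
    by (intro exI[of _ q]) (cases s; auto intro: less_imp_le)
qed

lemma sum_tpm_cases:
  assumes "finite A" "\<And>j. j \<in> A \<Longrightarrow> f j \<in> tpm"
  shows "(sum f A = 0 \<and> (\<forall>j\<in>A. f j = 0)) \<or> (\<exists>r. dom_value (f ` A) r (sum f A))"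
  using assms
proof (induction A rule: finite_induct)
  case (insert a A)
  have fa: "f a \<in> tpm" using insert.prems by simp
  have eq: "sum f (insert a A) = f a + sum f A" using insert.hyps by simp
  from insert have "(sum f A = 0 \<and> (\<forall>j\<in>A. f j = 0)) \<or> (\<exists>r. dom_value (f ` A) r (sum f A))" by simp
  then show ?case
  proof (elim disjE exE)
    assume z: "sum f A = 0 \<and> (\<forall>j\<in>A. f j = 0)"
    show ?thesis
    proof (cases "f a = 0")
      case False
      then obtain s r where "f a = TNum s r" by (cases "f a") (auto simp: zero_symtrop_def)
      then have "dom_value (f ` insert a A) r (f a)"
        using z fa unfolding dom_value_def by (cases s) (auto simp: zero_symtrop_def)
      then show ?thesis unfolding eq using z by auto
    qed (use z eq in auto)
  next
    fix r assume "dom_value (f ` A) r (sum f A)"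
    then have "\<exists>q. dom_value (insert (f a) (f ` A)) q (f a + sum f A)"
      using dom_value_insert_le dom_value_insert_gt fa not_le by metis
    then show ?thesis unfolding eq by simp
  qed
qed simp

text \<open>Everything is decided at the top norm \<open>r\<close>: a positive term of norm
  \<open>r\<close> dominates all of \<open>B\<close>, and without one the negative term of norm
  \<open>r\<close> has no positive partner.\<close>

lemma dom_value_nonneg_iff:
  assumes "dom_value B r t"
  shows "t \<in> tpos \<union> tbal \<longleftrightarrow> (\<forall>b\<in>B. b \<in> tneg \<longrightarrow> (\<exists>p\<in>B. p \<in> tpos \<and> nrm b \<le> nrm p))" (is "_ = ?R")
proof (cases "TNum SPos r \<in> B")
  case True
  then have ?R using assms unfolding dom_value_def by (metis mem_simps(5) nrm_simps(2))
  then show ?thesis using assms True unfolding dom_value_def by auto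
next
  case False
  then have t: "t = TNum SNeg r" "TNum SNeg r \<in> B" using assms unfolding dom_value_def by auto
  have "\<not> (p \<in> tpos \<and> ereal r \<le> nrm p)" if "p \<in> B" for p
  proof
    assume a: "p \<in> tpos \<and> ereal r \<le> nrm p"
    with assms that have "nrm p = ereal r" unfolding dom_value_def by (simp add: antisym)
    with a have "p = TNum SPos r" by (cases p) auto
    with False that show False by simp
  qed
  then have "\<not> ?R" using t by (metis mem_simps(7) nrm_simps(2))
  then show ?thesis using t(1) by simp
qed

lemma sum_nonneg_iff:
  assumes "finite A" "\<And>j. j \<in> A \<Longrightarrow> f j \<in> tpm"
  shows "sum f A \<in> tpos \<union> tbal \<longleftrightarrow>
    (\<forall>j\<in>A. f j \<in> tneg \<longrightarrow> (\<exists>i\<in>A. f i \<in> tpos \<and> nrm (f j) \<le> nrm (f i)))"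
proof -
  have "(sum f A = 0 \<and> (\<forall>j\<in>A. f j = 0)) \<or> (\<exists>r. dom_value (f ` A) r (sum f A))"
    using sum_tpm_cases[of A f] assms by blast
  then show ?thesis
  proof (elim disjE exE)
    fix r assume "dom_value (f ` A) r (sum f A)"
    from dom_value_nonneg_iff[OF this] show ?thesis by simp
  qed (auto simp: zero_symtrop_def)
qed

lemma vecs_tpm_mult: "u \<in> vecs tpm \<Longrightarrow> v \<in> vecs tpm \<Longrightarrow> u $ i * v $ i \<in> tpm"
  by (auto simp: vecs_def tpm_mult)

text \<open>A value is balanced iff both it and its negative lie in
  \<open>tpos \<union> tbal\<close>, so the sign criterion for sums is applied to the products and
  to their negatives.\<close>

lemma orth_iff:
  assumes "u \<in> vecs tpm" "v \<in> vecs tpm"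
  shows "orth u v \<longleftrightarrow>
    (\<forall>j. u $ j * v $ j \<in> tneg \<longrightarrow> (\<exists>i. u $ i * v $ i \<in> tpos \<and> nrm (u $ j * v $ j) \<le> nrm (u $ i * v $ i))) \<and>
    (\<forall>j. u $ j * v $ j \<in> tpos \<longrightarrow> (\<exists>i. u $ i * v $ i \<in> tneg \<and> nrm (u $ j * v $ j) \<le> nrm (u $ i * v $ i)))"
  unfolding orth_def tbal_iff[of "sum _ _"] uminus_sum_symtrop
  by (simp only: sum_nonneg_iff[OF finite] vecs_tpm_mult[OF assms] tpm_uminus uminus_tpos_iff
      nrm_uminus UNIV_I ball_UNIV bex_UNIV)

lemma orth_commute: "orth u v \<longleftrightarrow> orth v u"
  by (simp add: orth_def mult.commute)

section \<open>TC-convexity\<close>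

lemma mult_left_sum: "a * left_sum x y = left_sum (a * x) (a * y)"
proof (cases a)
  case TZero
  then show ?thesis by (cases x; cases y) (simp_all add: left_sum_eq)
next
  case (TNum s r)
  then show ?thesis by (cases x; cases y) (simp_all add: left_sum_eq)
qed

lemma left_sum_self [simp]: "left_sum x x = x"
  by (simp add: left_sum_eq)

lemma left_sum_tpm: "x \<in> tpm \<Longrightarrow> y \<in> tpm \<Longrightarrow> left_sum x y \<in> tpm"
  by (simp add: left_sum_eq)

section \<open>Closed halfspaces, left sums and scaling\<close>

definition nonneg_terms :: "'b set \<Rightarrow> ('b \<Rightarrow> symtrop) \<Rightarrow> bool" where
  "nonneg_terms A f \<longleftrightarrow> (\<forall>j\<in>A. f j \<in> tneg \<longrightarrow> (\<exists>i\<in>A. f i \<in> tpos \<and> nrm (f j) \<le> nrm (f i)))"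

lemma tpm_sign_cases: "x \<in> tpm \<Longrightarrow> x \<noteq> 0 \<Longrightarrow> x \<in> tpos \<or> x \<in> tneg"
  by (auto simp: tpm_def)

lemma tpos_tneg_nonzero: "x \<in> tpos \<Longrightarrow> x \<noteq> 0" "x \<in> tneg \<Longrightarrow> x \<noteq> 0"
  by (auto simp: tpos_def tneg_def zero_symtrop_def)

lemma nonneg_terms_max:
  assumes "nonneg_terms A f" "\<And>i. i \<in> A \<Longrightarrow> f i \<in> tpm" "\<And>i. i \<in> A \<Longrightarrow> nrm (f i) \<le> M"
    "j \<in> A" "nrm (f j) = M" "M \<noteq> -\<infinity>"
  shows "\<exists>i\<in>A. f i \<in> tpos \<and> nrm (f i) = M"
  using assms tpm_sign_cases[of "f j"] unfolding nonneg_terms_def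
  by (metis nrm_eq_MInf order_antisym)

text \<open>Let \<open>M\<close> be the largest norm in both families. If \<open>f\<close> reaches
  \<open>M\<close>, it does so at a positive term, which the left sum keeps even in a tie; otherwise
  a positive term of \<open>g\<close> of norm \<open>M\<close> beats the smaller entry of
  \<open>f\<close> there.\<close>

lemma nonneg_terms_left_sum:
  assumes "finite A" "nonneg_terms A f" "nonneg_terms A g"
    and tpm: "\<And>i. i \<in> A \<Longrightarrow> f i \<in> tpm" "\<And>i. i \<in> A \<Longrightarrow> g i \<in> tpm"
  shows "nonneg_terms A (\<lambda>i. left_sum (f i) (g i))"
  unfolding nonneg_terms_def
proof (intro ballI impI)
  fix j assume j: "j \<in> A" "left_sum (f j) (g j) \<in> tneg"
  define S where "S = (\<lambda>i. nrm (f i)) ` A \<union> (\<lambda>i. nrm (g i)) ` A"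
  define M where "M = Max S"
  have S: "finite S" "S \<noteq> {}" using assms(1) j(1) by (auto simp: S_def)
  then have "M \<in> S" unfolding M_def by (rule Max_in)
  have le: "nrm (f i) \<le> M" "nrm (g i) \<le> M" if "i \<in> A" for i
    using S(1) that by (auto simp: M_def S_def)
  have nz: "M \<noteq> -\<infinity>"
    using le[OF j(1)] tpos_tneg_nonzero(2)[OF j(2)] by (auto simp: left_sum_eq split: if_splits)
  have jM: "nrm (left_sum (f j) (g j)) \<le> M" using le[OF j(1)] by (simp add: left_sum_eq)
  show "\<exists>i\<in>A. left_sum (f i) (g i) \<in> tpos \<and> nrm (left_sum (f j) (g j)) \<le> nrm (left_sum (f i) (g i))"
  proof (cases "\<exists>i\<in>A. nrm (f i) = M")
    case True
    then obtain i where "i \<in> A" "f i \<in> tpos" "nrm (f i) = M"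
      using nonneg_terms_max[OF assms(2) tpm(1) le(1) _ _ nz] by blast
    then show ?thesis using jM le by (intro bexI[of _ i]) (auto simp: left_sum_eq)
  next
    case False
    with \<open>M \<in> S\<close> have "\<exists>i\<in>A. nrm (g i) = M" by (auto simp: S_def)
    then obtain i where i: "i \<in> A" "g i \<in> tpos" "nrm (g i) = M"
      using nonneg_terms_max[OF assms(3) tpm(2) le(2) _ _ nz] by blast
    moreover have "nrm (f i) < M" using False le(1) i(1) by (metis less_le)
    ultimately show ?thesis using jM le by (intro bexI[of _ i]) (auto simp: left_sum_eq)
  qed
qed

text \<open>Indexing by \<open>'n option\<close> with the constant term at \<open>None\<close> turns
  the affine form into a plain sum over a finite type.\<close>

abbreviation aff_terms :: "symtrop \<Rightarrow> symtrop ^ 'n \<Rightarrow> symtrop ^ 'n \<Rightarrow> 'n option \<Rightarrow> symtrop" where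
  "aff_terms a0 a x \<equiv> case_option a0 (\<lambda>i. a $ i * x $ i)"

lemma aff_terms_tpm:
  "a0 \<in> tpm \<Longrightarrow> a \<in> vecs tpm \<Longrightarrow> x \<in> vecs tpm \<Longrightarrow> aff_terms a0 a x i \<in> tpm"
  by (auto simp: vecs_tpm_mult split: option.split)

lemma closed_halfspace_iff:
  assumes "a0 \<in> tpm" "a \<in> vecs tpm"
  shows "x \<in> closed_halfspace a0 a \<longleftrightarrow> x \<in> vecs tpm \<and> nonneg_terms UNIV (aff_terms a0 a x)"
proof -
  have "affine_form a0 a x = sum (aff_terms a0 a x) UNIV"
    by (simp add: affine_form_def UNIV_option_conv sum.reindex)
  then show ?thesis
    using sum_nonneg_iff[of UNIV "aff_terms a0 a x"] aff_terms_tpm[OF assms]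
    unfolding closed_halfspace_def nonneg_terms_def by auto
qed

lemma left_sum_closed_halfspace:
  assumes "a0 \<in> tpm" "a \<in> vecs tpm" "x \<in> closed_halfspace a0 a" "y \<in> closed_halfspace a0 a"
  shows "left_sum_vec x y \<in> closed_halfspace a0 a"
proof -
  have xy: "x \<in> vecs tpm" "y \<in> vecs tpm" using assms(3,4) by (auto simp: closed_halfspace_def)
  have "aff_terms a0 a (left_sum_vec x y) = (\<lambda>i. left_sum (aff_terms a0 a x i) (aff_terms a0 a y i))"
    by (auto simp: fun_eq_iff left_sum_vec_def mult_left_sum split: option.split)
  then show ?thesis
    using nonneg_terms_left_sum[of UNIV "aff_terms a0 a x" "aff_terms a0 a y"] assms xy aff_terms_tpm[OF assms(1,2)]
    by (simp add: closed_halfspace_iff) (auto simp: vecs_def left_sum_vec_def left_sum_tpm)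
qed

lemma mult_tpos_iff: "r \<in> tpos \<Longrightarrow> r * x \<in> tpos \<longleftrightarrow> x \<in> tpos" "r \<in> tpos \<Longrightarrow> r * x \<in> tneg \<longleftrightarrow> x \<in> tneg"
  "r \<in> tpos \<Longrightarrow> r * x \<in> tpm \<longleftrightarrow> x \<in> tpm"
  by (cases x; auto simp: tpos_def tneg_def tpm_def zero_symtrop_def)+

lemma nrm_mult_left_mono: "nrm x \<le> nrm y \<Longrightarrow> nrm (r * x) \<le> nrm (r * y)"
  by (cases x; cases y; cases r) auto

lemma nrm_mult_le: "nrm r \<le> 0 \<Longrightarrow> nrm (r * x) \<le> nrm x"
  by (cases x; cases r) (auto simp: zero_ereal_def)

text \<open>Containing the origin forces \<open>a0\<close> to be nonnegative, so only linear terms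
  can be negative. Scaling by \<open>r\<close> shrinks them; a dominating linear term is scaled
  alike and a dominating constant stays.\<close>

lemma scale_closed_halfspace:
  assumes a: "a0 \<in> tpm" "a \<in> vecs tpm" and x: "x \<in> closed_halfspace a0 a"
    and 0: "0 \<in> closed_halfspace a0 a" and r: "r \<in> tpos" "nrm r \<le> 0"
  shows "r *s x \<in> closed_halfspace a0 a"
proof -
  have v: "x \<in> vecs tpm" "r *s x \<in> vecs tpm"
    using x r by (auto simp: closed_halfspace_def vecs_def mult_tpos_iff)
  have a0: "a0 \<notin> tneg"
    using 0 by (auto simp: closed_halfspace_def affine_form_def tneg_def)
  let ?f = "aff_terms a0 a x" and ?g = "aff_terms a0 a (r *s x)"
  have g: "?g (Some i) = r * ?f (Some i)" for i by (simp add: ac_simps)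
  have "nonneg_terms UNIV ?f" using x a by (simp add: closed_halfspace_iff)
  have "nonneg_terms UNIV ?g"
    unfolding nonneg_terms_def
  proof (intro ballI impI)
    fix j assume j: "?g j \<in> tneg"
    with a0 obtain j' where j': "j = Some j'" by (cases j) auto
    then have "?f j \<in> tneg" using j r unfolding j' g by (simp add: mult_tpos_iff)
    then obtain i where i: "?f i \<in> tpos" "nrm (?f j) \<le> nrm (?f i)"
      using \<open>nonneg_terms UNIV ?f\<close> unfolding nonneg_terms_def by blast
    show "\<exists>i\<in>UNIV. ?g i \<in> tpos \<and> nrm (?g j) \<le> nrm (?g i)"
    proof (cases i)
      case None
      then show ?thesis using i nrm_mult_le[OF r(2)] unfolding j' g
        by (intro bexI[of _ None]) (auto intro: order_trans)
    next
      case (Some i')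
      then show ?thesis using i r(1) unfolding j' by (intro bexI[of _ "Some i'"])
        (auto simp only: g mult_tpos_iff nrm_mult_left_mono)
    qed
  qed
  then show ?thesis using a v by (simp add: closed_halfspace_iff)
qed

lemma tc_segment_iff:
  "z \<in> tc_segment x y \<longleftrightarrow> z \<in> vecs tpm \<and> (\<forall>a0\<in>tpm. \<forall>a\<in>vecs tpm. a \<noteq> 0 \<longrightarrow>
     x \<in> closed_halfspace a0 a \<longrightarrow> y \<in> closed_halfspace a0 a \<longrightarrow> z \<in> closed_halfspace a0 a)"
  unfolding tc_segment_def by blast

lemma left_sum_vec_tpm: "x \<in> vecs tpm \<Longrightarrow> y \<in> vecs tpm \<Longrightarrow> left_sum_vec x y \<in> vecs tpm"
  by (auto simp: vecs_def left_sum_vec_def left_sum_tpm)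

lemma tc_convex_left_sum:
  assumes "tc_convex S" "x \<in> S" "y \<in> S"
  shows "left_sum_vec x y \<in> S"
proof -
  have "x \<in> vecs tpm" "y \<in> vecs tpm" using assms by (auto simp: tc_convex_def)
  then have "left_sum_vec x y \<in> tc_segment x y"
    unfolding tc_segment_iff
    by (intro conjI ballI impI left_sum_vec_tpm left_sum_closed_halfspace) assumption+
  then show ?thesis using assms unfolding tc_convex_def by blast
qed

lemma tc_convex_scale:
  assumes "tc_convex S" "0 \<in> S" "x \<in> S" "r \<in> tpos" "nrm r \<le> 0"
  shows "r *s x \<in> S"
proof -
  have "x \<in> vecs tpm" using assms(1,3) by (auto simp: tc_convex_def)
  then have "r *s x \<in> vecs tpm" using assms(4) by (simp add: vecs_def mult_tpos_iff)
  then have "r *s x \<in> tc_segment 0 x"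
    unfolding tc_segment_iff
    by (intro conjI ballI impI scale_closed_halfspace assms(4,5)) assumption+
  then show ?thesis using assms(1-3) unfolding tc_convex_def by blast
qed

text \<open>Separation criterion: a halfspace that contains \<open>S\<close> but not
  \<open>z\<close> keeps \<open>z\<close> out of every segment between points of
  \<open>S\<close>.\<close>

lemma tc_convexI:
  assumes "S \<subseteq> vecs tpm"
    and "\<And>z. z \<in> vecs tpm \<Longrightarrow> z \<notin> S \<Longrightarrow> \<exists>a0\<in>tpm. \<exists>a\<in>vecs tpm. a \<noteq> 0 \<and> S \<subseteq> closed_halfspace a0 a \<and> z \<notin> closed_halfspace a0 a"
  shows "tc_convex S"
  unfolding tc_convex_def
proof (intro conjI ballI subsetI)
  fix x y z assume xy: "x \<in> S" "y \<in> S" and z: "z \<in> tc_segment x y"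
  show "z \<in> S"
  proof (rule ccontr)
    assume "z \<notin> S"
    with assms(2)[of z] z
    obtain a0 a where "a0 \<in> tpm" "a \<in> vecs tpm" "a \<noteq> 0" "S \<subseteq> closed_halfspace a0 a" "z \<notin> closed_halfspace a0 a"
      unfolding tc_segment_iff by blast
    then show False using z xy unfolding tc_segment_iff by blast
  qed
qed (use assms in auto)

lemma uminus_vecs_tpm [simp]: "- u \<in> vecs tpm \<longleftrightarrow> u \<in> vecs tpm"
  by (simp add: vecs_def)

lemma orth_halfspaces:
  assumes "x \<in> vecs tpm"
  shows "orth u x \<longleftrightarrow> x \<in> closed_halfspace 0 u \<and> x \<in> closed_halfspace 0 (- u)"
  using assms
  unfolding orth_def closed_halfspace_def affine_form_def
  by (subst tbal_iff) (simp add: uminus_sum_symtrop uminus_mult_left)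

lemma orth_zero [simp]: "orth 0 x" "orth x 0"
  by (simp_all add: orth_def tbal_def)

text \<open>Orthogonality to \<open>u\<close> is membership in the two opposite halfspaces of
  \<open>u\<close>; a point outside \<open>perp U\<close> violates one of them.\<close>

lemma tc_convex_perp:
  assumes "U \<subseteq> vecs tpm"
  shows "tc_convex (perp U)"
proof (rule tc_convexI)
  fix z assume z: "z \<in> vecs tpm" "z \<notin> perp U"
  then obtain u where u: "u \<in> U" "\<not> orth u z" by (auto simp: perp_def)
  have "u \<noteq> 0" using u(2) by auto
  then have "- u \<noteq> 0" by (auto simp: vec_eq_iff)
  have ut: "u \<in> vecs tpm" using u assms by auto
  have "perp U \<subseteq> closed_halfspace 0 u" "perp U \<subseteq> closed_halfspace 0 (- u)"
    using u(1) by (auto simp: perp_def orth_halfspaces)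
  then show "\<exists>a0\<in>tpm. \<exists>a\<in>vecs tpm. a \<noteq> 0 \<and> perp U \<subseteq> closed_halfspace a0 a \<and> z \<notin> closed_halfspace a0 a"
    using u(2) \<open>u \<noteq> 0\<close> \<open>- u \<noteq> 0\<close> ut unfolding orth_halfspaces[OF z(1)]
    using uminus_vecs_tpm mem_simps(2) by blast
qed (auto simp: perp_def)

abbreviation unit_box :: "(symtrop ^ 'n) set" where
  "unit_box \<equiv> vecs {x \<in> tpm. - 1 \<le> x \<and> x \<le> 1}"

lemma unit_interval_iff: "x \<in> tpm \<Longrightarrow> - 1 \<le> x \<and> x \<le> 1 \<longleftrightarrow> nrm x \<le> 0"
  by (cases x rule: tpm_cases)
    (auto simp: less_eq_symtrop_def less_symtrop_def one_symtrop_def zero_ereal_def)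

lemma unit_box_iff: "x \<in> unit_box \<longleftrightarrow> x \<in> vecs tpm \<and> (\<forall>i. nrm (x $ i) \<le> 0)"
  unfolding vecs_def using unit_interval_iff by auto

text \<open>The box is cut out by the halfspaces of the forms \<open>1 + s * x $ i\<close> with
  \<open>s\<close> equal to \<open>1\<close> or \<open>- 1\<close>; for a point outside, the sign is
  chosen to make the oversized term negative.\<close>

lemma tc_convex_unit_box: "tc_convex (unit_box :: (symtrop ^ 'n) set)"
proof (rule tc_convexI)
  fix z :: "symtrop ^ 'n" assume z: "z \<in> vecs tpm" "z \<notin> unit_box"
  then obtain i where i: "0 < nrm (z $ i)" by (auto simp: unit_box_iff not_le)
  have zi: "z $ i \<in> tpm" using z by (simp add: vecs_def)
  define e :: "symtrop \<Rightarrow> symtrop ^ 'n" where "e s = (\<chi> j. if j = i then s else 0)" for s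
  have aff: "affine_form 1 (e s) x = 1 + s * x $ i" for s x
    by (simp add: affine_form_def e_def if_distrib[of "\<lambda>t. t * _"] cong: if_cong)
  have e: "e s \<in> vecs tpm" "s \<noteq> 0 \<Longrightarrow> e s \<noteq> 0" if "s \<in> tpm" for s
    using that by (auto simp: e_def vecs_def vec_eq_iff)
  obtain s where s: "s \<in> tpm" "nrm s = 0" "s * z $ i \<in> tneg"
  proof (cases "z $ i \<in> tneg")
    case True
    then show ?thesis by (intro that[of 1]) auto
  next
    case False
    then have "z $ i \<in> tpos" using tpm_sign_cases[OF zi] i by force
    then show ?thesis by (intro that[of "- 1"]) (auto simp: uminus_mult_left[symmetric])
  qed
  have "unit_box \<subseteq> closed_halfspace 1 (e s)"
  proof
    fix x :: "symtrop ^ 'n" assume x: "x \<in> unit_box"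
    then have "x \<in> vecs tpm" "nrm (s * x $ i) \<le> 0" "s * x $ i \<in> tpm"
      using s unfolding unit_box_iff by (auto simp: nrm_mult vecs_def tpm_mult)
    then show "x \<in> closed_halfspace 1 (e s)"
      unfolding closed_halfspace_def mem_Collect_eq aff
      by (cases "s * x $ i" rule: uminus_symtrop.cases) (auto simp: one_symtrop_def zero_ereal_def)
  qed
  moreover have "z \<notin> closed_halfspace 1 (e s)"
  proof -
    have "nrm (s * z $ i) > 0" using s i by (simp add: nrm_mult)
    then show ?thesis using s(3) unfolding closed_halfspace_def mem_Collect_eq aff
      by (cases "s * z $ i" rule: uminus_symtrop.cases) (auto simp: one_symtrop_def zero_ereal_def)
  qed
  moreover have "s \<noteq> 0" using s(2) by auto
  ultimately show "\<exists>a0\<in>tpm. \<exists>a\<in>vecs tpm. a \<noteq> 0 \<and> unit_box \<subseteq> closed_halfspace a0 a \<and> z \<notin> closed_halfspace a0 a"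
    using e[OF s(1)] by (intro bexI[of _ 1] bexI[of _ "e s"]) auto
qed (auto simp: vecs_def)

lemma tc_convex_Int: "tc_convex S \<Longrightarrow> tc_convex T \<Longrightarrow> tc_convex (S \<inter> T)"
  unfolding tc_convex_def by blast

lemma conv_tc_least: "tc_convex S \<Longrightarrow> M \<subseteq> S \<Longrightarrow> conv_tc M \<subseteq> S"
  unfolding conv_tc_def by (rule hull_minimal)

lemma in_conv_tcI: "(\<And>S. tc_convex S \<Longrightarrow> M \<subseteq> S \<Longrightarrow> x \<in> S) \<Longrightarrow> x \<in> conv_tc M"
  unfolding conv_tc_def hull_def by blast

lemma orth_scale:
  assumes "orth u x"
  shows "orth u (l *s x)"
proof -
  have "(\<Sum>i\<in>UNIV. u $ i * (l *s x) $ i) = l * (\<Sum>i\<in>UNIV. u $ i * x $ i)"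
    by (simp add: sum_distrib_left ac_simps)
  moreover have "l * t \<in> tbal" if "t \<in> tbal" for t
  proof (cases l; cases t)
    fix s r s' r' assume "l = TNum s r" "t = TNum s' r'"
    then show ?thesis using that by (cases s) auto
  qed (use that in auto)
  ultimately show ?thesis using assms by (simp add: orth_def)
qed

lemma trop_cone_perp: "trop_cone (perp U)"
  by (auto simp only: trop_cone_def perp_def mem_Collect_eq orth_scale)
    (simp add: vecs_def mult_tpos_iff)

section \<open>Conformal composition\<close>

text \<open>Wherever the entries differ the norm must drop strictly, so that a left sum of vectors
  below \<open>y\<close> takes the entry of \<open>y\<close> wherever one of them has it.\<close>

definition conf :: "symtrop ^ 'n \<Rightarrow> symtrop ^ 'n \<Rightarrow> bool" where
  "conf x y \<longleftrightarrow> (\<forall>j. x $ j = y $ j \<or> nrm (x $ j) < nrm (y $ j))"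

lemma conf_refl [simp]: "conf x x"
  by (simp add: conf_def)

lemma conf_trans: "conf x y \<Longrightarrow> conf y z \<Longrightarrow> conf x z"
  unfolding conf_def by (metis less_trans)

lemma not_less_nrm_zero: "\<not> nrm x < nrm 0"
  by simp

lemma conf_supp: "conf x y \<Longrightarrow> supp x \<subseteq> supp y"
proof
  fix i assume c: "conf x y" and "i \<in> supp x"
  then have "x $ i \<noteq> 0" by (simp add: supp_def)
  then have "y $ i \<noteq> 0" using c unfolding conf_def by (metis not_less_nrm_zero)
  then show "i \<in> supp y" by (simp add: supp_def)
qed

lemma conf_nrm: "conf x y \<Longrightarrow> nrm (x $ j) \<le> nrm (y $ j)"
  unfolding conf_def by (metis less_imp_le order_refl)

lemma conf_left_sum: "conf y x \<Longrightarrow> conf z x \<Longrightarrow> conf (left_sum_vec y z) x"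
  unfolding conf_def left_sum_vec_def by (simp add: left_sum_eq)

lemma conf_left_sum_eq:
  assumes "conf y x" "conf z x" "y $ i = x $ i \<or> z $ i = x $ i"
  shows "left_sum_vec y z $ i = x $ i"
  using assms conf_nrm[OF assms(1), of i] conf_nrm[OF assms(2), of i]
  unfolding conf_def left_sum_vec_def by (auto simp: left_sum_eq)

text \<open>For each coordinate of the support pick a part that agrees with \<open>x\<close> there.
  Left sums of such parts keep all agreements gained so far, and outside the support conformality
  forces zero. The induction starts from a single coordinate because \<open>S\<close> need not
  contain \<open>0\<close>.\<close>

lemma conf_composition:
  fixes x :: "symtrop ^ 'n"
  assumes closed: "\<And>y z. y \<in> S \<Longrightarrow> z \<in> S \<Longrightarrow> left_sum_vec y z \<in> S"
    and "x \<noteq> 0" and parts: "\<And>i. i \<in> supp x \<Longrightarrow> \<exists>y\<in>S. conf y x \<and> y $ i = x $ i"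
  shows "x \<in> S"
proof -
  have "\<exists>y\<in>S. conf y x \<and> (\<forall>i\<in>I. y $ i = x $ i)" if "finite I" "I \<noteq> {}" "I \<subseteq> supp x" for I
    using that
  proof (induction I rule: finite_ne_induct)
    case (singleton i)
    then show ?case using parts by simp
  next
    case (insert i I)
    then obtain y z where "y \<in> S" "conf y x" "\<forall>i\<in>I. y $ i = x $ i" "z \<in> S" "conf z x" "z $ i = x $ i"
      using parts by (metis insert_subset)
    then show ?case
      by (intro bexI[of _ "left_sum_vec y z"]) (auto simp: conf_left_sum conf_left_sum_eq closed)
  qed
  moreover have "supp x \<noteq> {}" using \<open>x \<noteq> 0\<close> by (auto simp: supp_def vec_eq_iff)
  ultimately obtain y where y: "y \<in> S" "conf y x" "\<forall>i\<in>supp x. y $ i = x $ i"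
    using finite[of "supp x"] by blast
  have "y $ i = x $ i" for i
    using y(2,3) conf_supp[OF y(2)] by (cases "i \<in> supp x") (auto simp: supp_def)
  then have "y = x" by (simp add: vec_eq_iff)
  then show ?thesis using y(1) by simp
qed

section \<open>Matroids over the tropical and the sign hyperfield\<close>

locale hyperfield =
  fixes H :: "symtrop set"
  assumes hyperfield: "H = tpm \<or> H = sign_hyperfield"
begin

lemma H_tpm: "x \<in> H \<Longrightarrow> x \<in> tpm"
  using hyperfield by (auto simp: sign_hyperfield_def)

lemma vecs_H_tpm: "x \<in> vecs H \<Longrightarrow> x \<in> vecs tpm"
  using H_tpm by (auto simp: vecs_def)

lemma H_0 [simp]: "0 \<in> H" and H_1 [simp]: "1 \<in> H"
  using hyperfield by (auto simp: sign_hyperfield_def)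

lemma H_uminus [simp]: "- x \<in> H \<longleftrightarrow> x \<in> H"
  using hyperfield uminus_uminus[of x] by (auto simp: sign_hyperfield_def) (metis uminus_uminus uminus_zero_symtrop)+

lemma H_mult: "x \<in> H \<Longrightarrow> y \<in> H \<Longrightarrow> x * y \<in> H"
  using hyperfield by (auto simp: sign_hyperfield_def tpm_mult uminus_mult_left[symmetric] uminus_mult_right[symmetric])

lemma H_inverse:
  assumes "x \<in> H" "x \<noteq> 0"
  obtains y where "y \<in> H" "x * y = 1" "y \<noteq> 0" "nrm y = - nrm x"
proof (cases "H = tpm")
  case True
  then show ?thesis using tpm_inverse[of x] assms that by metis
next
  case False
  then have "x = 1 \<or> x = - 1" using hyperfield assms by (auto simp: sign_hyperfield_def)
  then show ?thesis using assms
    by (intro that[of x]) (auto simp: uminus_mult_left[symmetric] uminus_mult_right[symmetric])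
qed

lemma H_nrm: "H \<noteq> tpm \<Longrightarrow> x \<in> H \<Longrightarrow> x \<noteq> 0 \<Longrightarrow> nrm x = 0"
  using hyperfield by (auto simp: sign_hyperfield_def)

lemma nrm_real: "x \<noteq> 0 \<Longrightarrow> nrm x = ereal (real_of_ereal (nrm x))"
  by (cases x) (auto simp: zero_symtrop_def)

text \<open>Over \<open>tpm\<close>, shift \<open>w\<close> by the smallest norm gap to
  \<open>v\<close> on its support; over the signs all nonzero entries have the same norm and
  \<open>1\<close> works.\<close>

lemma scale_to_fit:
  fixes w v :: "symtrop ^ 'n"
  assumes "w \<in> vecs H" "v \<in> vecs H" "w \<noteq> 0" "supp w \<subseteq> supp v"
  shows "\<exists>s\<in>H. s \<noteq> 0 \<and> (\<forall>j. nrm (s * w $ j) \<le> nrm (v $ j)) \<and> (\<exists>j. w $ j \<noteq> 0 \<and> nrm (s * w $ j) = nrm (v $ j))"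
proof -
  have ne: "supp w \<noteq> {}" using assms(3) by (auto simp: supp_def vec_eq_iff)
  have v: "v $ j \<noteq> 0" if "w $ j \<noteq> 0" for j using assms(4) that by (auto simp: supp_def)
  show ?thesis
  proof (cases "H = tpm")
    case True
    let ?r = "\<lambda>j. real_of_ereal (nrm (v $ j)) - real_of_ereal (nrm (w $ j))"
    define m where "m = Min (?r ` supp w)"
    have "m \<in> ?r ` supp w" unfolding m_def using ne by (intro Min_in) auto
    then obtain j where j: "w $ j \<noteq> 0" "m = ?r j" by (auto simp: supp_def)
    have m: "m \<le> ?r i" if "w $ i \<noteq> 0" for i
      using that unfolding m_def by (intro Min_le) (auto simp: supp_def)
    have n: "nrm (TNum SPos m * w $ i) = ereal (m + real_of_ereal (nrm (w $ i)))" if "w $ i \<noteq> 0" for i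
      using nrm_real[OF that] by (simp add: nrm_mult) (metis plus_ereal.simps(1))
    have "nrm (TNum SPos m * w $ i) \<le> nrm (v $ i)" for i
    proof (cases "w $ i = 0")
      case False
      then show ?thesis using n[OF False] m[OF False] nrm_real[OF v[OF False]]
        by (metis add.commute add_le_cancel_right diff_add_cancel ereal_less_eq(3))
    qed simp
    moreover have "nrm (TNum SPos m * w $ j) = nrm (v $ j)"
      using n[OF j(1)] j(2) nrm_real[OF v[OF j(1)]] by simp
    ultimately show ?thesis using True j(1)
      by (intro bexI[of _ "TNum SPos m"]) (auto simp: zero_symtrop_def)
  next
    case False
    have "nrm (w $ j) = nrm (v $ j)" if "w $ j \<noteq> 0" for j
      using H_nrm[OF False] v[OF that] that assms(1,2) by (simp add: vecs_def)
    moreover have "nrm (w $ j) \<le> nrm (v $ j)" for j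
      using calculation[of j] by (cases "w $ j = 0") auto
    ultimately show ?thesis using ne by (intro bexI[of _ 1]) (auto simp: supp_def)
  qed
qed

end

locale trop_matroid = hyperfield H for H :: "symtrop set" +
  fixes V :: "(symtrop ^ 'n) set"
  assumes vectors: "matroid_vectors H V"
begin

lemma V_sub: "v \<in> V \<Longrightarrow> v \<in> vecs H"
  using vectors by (auto simp: matroid_vectors_def)

lemma V_coord: "v \<in> V \<Longrightarrow> v $ i \<in> H" "v \<in> V \<Longrightarrow> v $ i \<in> tpm"
  using V_sub[of v] H_tpm by (auto simp: vecs_def)

lemma V_zero: "0 \<in> V"
  and V_scale: "s \<in> H \<Longrightarrow> v \<in> V \<Longrightarrow> s *s v \<in> V"
  and V_left_sum: "x \<in> V \<Longrightarrow> y \<in> V \<Longrightarrow> left_sum_vec x y \<in> V"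
  using vectors by (auto simp: matroid_vectors_def)

lemma V_uminus: "v \<in> V \<Longrightarrow> - v \<in> V"
proof -
  assume "v \<in> V"
  then have "(- 1) *s v \<in> V" by (intro V_scale) auto
  moreover have "(- 1) *s v = - v" by (simp add: vec_eq_iff uminus_mult_left[symmetric])
  ultimately show ?thesis by simp
qed

lemma V_elim:
  assumes "x \<in> V" "y \<in> V" "x $ i = - y $ i" "x $ i \<noteq> 0"
  obtains z where "z \<in> V" "z $ i = 0" "\<And>k. z $ k \<in> unbalance (x $ k + y $ k)"
  using vectors assms unfolding matroid_vectors_def unbalance_vec_def by (simp, blast)

lemma V_normalize:
  assumes "v \<in> V" "v $ e \<noteq> 0"
  obtains s where "s \<in> H" "s \<noteq> 0" "s *s v \<in> V" "(s *s v) $ e = 1"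
  using H_inverse[OF V_coord(1)[OF assms(1)] assms(2)] V_scale[OF _ assms(1)]
  by (metis mult.commute vector_smult_component)

text \<open>Eliminate between \<open>v\<close> and \<open>w\<close> at a conflict, a coordinate
  where they cancel. The result is bounded by \<open>v\<close>, agrees with \<open>v\<close> off the
  conflicts and has fewer conflicts; repeat with it in place of \<open>w\<close>. Without conflicts,
  bounded by \<open>v\<close> means conformal to \<open>v\<close>.\<close>

lemma elim_conformal:
  assumes "v \<in> V" "w \<in> V" "\<And>j. nrm (w $ j) \<le> nrm (v $ j)" "{k. w $ k = - v $ k \<and> v $ k \<noteq> 0} \<noteq> {}"
  shows "\<exists>z\<in>V. conf z v \<and> (\<forall>k. \<not> (w $ k = - v $ k \<and> v $ k \<noteq> 0) \<longrightarrow> z $ k = v $ k) \<and> (\<exists>j. z $ j = 0 \<and> v $ j \<noteq> 0)"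
  using assms(2-)
proof (induction "card {k. w $ k = - v $ k \<and> v $ k \<noteq> 0}" arbitrary: w rule: less_induct)
  case less
  let ?S = "\<lambda>w. {k. w $ k = - v $ k \<and> v $ k \<noteq> 0}"
  obtain j where j: "w $ j = - v $ j" "v $ j \<noteq> 0" using less.prems(3) by auto
  then obtain z where z: "z \<in> V" "z $ j = 0" "\<And>k. z $ k \<in> unbalance (v $ k + w $ k)"
    using V_elim[OF assms(1) less.prems(1), of j] by auto
  have z': "z $ k \<in> tpm \<and> (if nrm (w $ k) < nrm (v $ k) then z $ k = v $ k else if nrm (v $ k) < nrm (w $ k) then z $ k = w $ k
     else if v $ k = w $ k then z $ k = v $ k else nrm (z $ k) \<le> nrm (v $ k))" for k
    using z(3)[of k] unfolding unbalance_plus_iff[OF V_coord(2)[OF assms(1)] V_coord(2)[OF less.prems(1)]] .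
  have le: "nrm (z $ k) \<le> nrm (v $ k)" for k
    using z'[of k] less.prems(2)[of k] by (auto split: if_splits)
  have off: "z $ k = v $ k" if "k \<notin> ?S w" for k
  proof (cases "nrm (w $ k) = nrm (v $ k)")
    case True
    then have "w $ k = v $ k"
      using that nrm_eq_cases[OF V_coord(2)[OF less.prems(1)] V_coord(2)[OF assms(1)] True] by auto
    then show ?thesis using z'[of k] by auto
  next
    case False
    then show ?thesis using z'[of k] less.prems(2)[of k] by (auto simp: less_le)
  qed
  \<comment> \<open>Agreements survive, and \<open>j\<close> is no longer a conflict since
    \<open>z\<close> vanishes there.\<close>
  have "?S z \<subseteq> ?S w" using off uminus_neq_self V_coord(2)[OF assms(1)] by force
  moreover have "j \<in> ?S w" "j \<notin> ?S z" using j z(2) by (auto dest: sym)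
  ultimately have lt: "card (?S z) < card (?S w)" by (intro psubset_card_mono) auto
  show ?case
  proof (cases "?S z = {}")
    case True
    have "conf z v"
      unfolding conf_def
    proof
      fix k
      show "z $ k = v $ k \<or> nrm (z $ k) < nrm (v $ k)"
        using True le[of k] nrm_eq_cases[OF V_coord(2)[OF z(1)] V_coord(2)[OF assms(1)], of k k]
        by (cases "v $ k = 0") (auto simp: less_le)
    qed
    then show ?thesis using z(1,2) off j by (intro bexI[of _ z]) auto
  next
    case False
    from less.hyps[OF lt z(1) le False] obtain z2 where z2: "z2 \<in> V" "conf z2 v"
      "\<And>k. k \<notin> ?S z \<Longrightarrow> z2 $ k = v $ k" "\<exists>j. z2 $ j = 0 \<and> v $ j \<noteq> 0" by auto
    then show ?thesis using \<open>?S z \<subseteq> ?S w\<close> by (intro bexI[of _ z2]) blast+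
  qed
qed

lemma supp_scale: "s \<noteq> 0 \<Longrightarrow> supp (s *s v) = supp (v :: symtrop ^ 'm)"
  by (simp add: supp_def)

text \<open>Induction on the support. A vector of smaller support is scaled to touch
  \<open>v\<close> at some \<open>t\<close>, with a sign that does not cancel \<open>v\<close> at
  \<open>i\<close>. Either it is itself a conformal part agreeing at \<open>i\<close>, or removing
  the conflicts with \<open>v\<close> gives one of smaller support.\<close>

lemma conformal_circuit:
  assumes "v \<in> V" "v $ i \<noteq> 0"
  shows "\<exists>c\<in>circuits V. conf c v \<and> c $ i = v $ i"
  using assms
proof (induction "card (supp v)" arbitrary: v rule: less_induct)
  case less
  note v = less.prems
  show ?case
  proof (cases "v \<in> circuits V")
    case False
    have "v \<noteq> 0" using v(2) by auto
    then obtain w where w: "w \<in> V" "w \<noteq> 0" "supp w \<subset> supp v"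
      using False v(1) by (auto simp: circuits_def min_supp_def)
    from scale_to_fit[OF V_sub[OF w(1)] V_sub[OF v(1)] w(2)] w(3)
    obtain s t where s: "s \<in> H" "s \<noteq> 0" "\<And>j. nrm (s * w $ j) \<le> nrm (v $ j)"
      "w $ t \<noteq> 0" "nrm (s * w $ t) = nrm (v $ t)" by auto
    define x where "x = s *s w"
    have x: "x \<in> V" "supp x = supp w" "\<And>j. nrm (x $ j) \<le> nrm (v $ j)" "nrm (x $ t) = nrm (v $ t)" "v $ t \<noteq> 0"
      using s w V_scale by (auto simp: x_def supp_scale)
    have mx: "- x \<in> V" "supp (- x) = supp w" "\<And>j. nrm ((- x) $ j) \<le> nrm (v $ j)"
      using x V_uminus by (auto simp: supp_def)
    have eqs: "x $ k = v $ k \<or> x $ k = - v $ k" if "nrm (x $ k) = nrm (v $ k)" for k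
      using nrm_eq_cases[OF V_coord(2)[OF x(1)] V_coord(2)[OF v(1)] that] by simp
    have neq: "- v $ k \<noteq> v $ k" if "v $ k \<noteq> 0" for k
      using uminus_neq_self[OF V_coord(2)[OF v(1)] that] .
    \<comment> \<open>One of \<open>x\<close> and \<open>- x\<close> works: if the norms at
      \<open>i\<close> agree, the one equal to \<open>v\<close> there; otherwise the one that
      cancels \<open>v\<close> at \<open>t\<close>, so that a conflict exists.\<close>
    obtain y where y: "y \<in> V" "supp y = supp w" "\<And>j. nrm (y $ j) \<le> nrm (v $ j)"
      "y $ i \<noteq> - v $ i" "y $ i = v $ i \<or> y $ t = - v $ t"
    proof (cases "nrm (x $ i) = nrm (v $ i)")
      case True
      then show ?thesis using that[OF x(1-3)] that[OF mx] eqs[OF True] neq[OF v(2)] by auto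
    next
      case False
      then have "x $ i \<noteq> - v $ i" "- x $ i \<noteq> - v $ i" by (metis nrm_uminus)+
      then show ?thesis using that[OF x(1-3)] that[OF mx] eqs[OF x(4)] by auto
    qed
    have "\<exists>z\<in>V. conf z v \<and> z $ i = v $ i \<and> supp z \<subset> supp v"
    proof (cases "{k. y $ k = - v $ k \<and> v $ k \<noteq> 0} = {}")
      case True
      have "conf y v"
        unfolding conf_def
      proof
        fix k
        show "y $ k = v $ k \<or> nrm (y $ k) < nrm (v $ k)"
          using True y(3)[of k] nrm_eq_cases[OF V_coord(2)[OF y(1)] V_coord(2)[OF v(1)], of k k]
          by (cases "v $ k = 0") (auto simp: less_le)
      qed
      then show ?thesis using y True x(5) w(3) by (intro bexI[of _ y]) auto
    next
      case False
      from elim_conformal[OF v(1) y(1,3) False] y(4) obtain z j where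
        "z \<in> V" "conf z v" "z $ i = v $ i" "z $ j = 0" "v $ j \<noteq> 0" by blast
      moreover from this have "supp z \<subset> supp v" using conf_supp by (force simp: supp_def)
      ultimately show ?thesis by blast
    qed
    then obtain z where z: "z \<in> V" "conf z v" "z $ i = v $ i" "supp z \<subset> supp v" by blast
    have "card (supp z) < card (supp v)" by (intro psubset_card_mono z(4)) simp
    from less.hyps[OF this z(1)] z v(2) show ?thesis using conf_trans by metis
  qed (use conf_refl in blast)
qed

lemma vector_in_closed:
  assumes "\<And>y z. y \<in> S \<Longrightarrow> z \<in> S \<Longrightarrow> left_sum_vec y z \<in> S" "circuits V \<subseteq> S" "v \<in> V" "v \<noteq> 0"
  shows "v \<in> S"
  using conf_composition[OF assms(1,4)] conformal_circuit[OF assms(3)] assms(2)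
  by (metis (mono_tags, lifting) mem_Collect_eq subsetD supp_def)

lemma circuits_sub: "circuits V \<subseteq> V"
  by (auto simp: circuits_def min_supp_def)

text \<open>Scale \<open>c\<close> to touch \<open>d\<close> with opposite sign at \<open>t\<close>.
  Conformal elimination yields a vector of strictly smaller support, hence \<open>0\<close>, so
  every nonzero entry of \<open>d\<close> was cancelled by the multiple of \<open>c\<close>.\<close>

lemma circuits_same_supp:
  assumes "c \<in> circuits V" "d \<in> circuits V" "supp c = supp d"
  shows "\<exists>s\<in>H. s \<noteq> 0 \<and> d = s *s c"
proof -
  have cd: "c \<in> V" "d \<in> V" "c \<noteq> 0" "d \<noteq> 0"
    and min: "\<And>y. y \<in> V \<Longrightarrow> supp y \<subset> supp d \<Longrightarrow> y = 0"
    using assms by (auto simp: circuits_def min_supp_def)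
  from scale_to_fit[OF V_sub[OF cd(1)] V_sub[OF cd(2)] cd(3)] assms(3)
  obtain s t where s: "s \<in> H" "s \<noteq> 0" "\<And>j. nrm (s * c $ j) \<le> nrm (d $ j)"
    "c $ t \<noteq> 0" "nrm (s * c $ t) = nrm (d $ t)" by auto
  have t: "d $ t \<noteq> 0" using s(4) assms(3) by (auto simp: supp_def)
  define x where "x = (if s * c $ t = d $ t then - s else s)"
  have xt: "x * c $ t = - d $ t"
    using nrm_eq_cases[OF _ _ s(5)] H_mult[OF s(1) V_coord(1)[OF cd(1)]] V_coord(2)[OF cd(2)] H_tpm
    by (auto simp: x_def uminus_mult_left[symmetric])
  have xH: "x \<in> H" "x \<noteq> 0" using s by (auto simp: x_def)
  then have xc: "x *s c \<in> V" "nrm ((x *s c) $ j) \<le> nrm (d $ j)" for j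
    using V_scale cd s(3) by (auto simp: x_def uminus_mult_left[symmetric])
  have "{k. (x *s c) $ k = - d $ k \<and> d $ k \<noteq> 0} \<noteq> {}" using xt t by auto
  from elim_conformal[OF cd(2) xc this] obtain z j where z: "z \<in> V" "conf z d"
    "\<And>k. \<not> ((x *s c) $ k = - d $ k \<and> d $ k \<noteq> 0) \<Longrightarrow> z $ k = d $ k" "z $ j = 0" "d $ j \<noteq> 0" by blast
  have "supp z \<subset> supp d" using z(2,4,5) conf_supp by (force simp: supp_def)
  then have "z = 0" using min z(1) by blast
  then have "x * c $ k = - d $ k" for k using z(3)[of k] by (cases "d $ k = 0") (use assms(3) in \<open>auto simp: supp_def\<close>)
  then have "- d = x *s c" by (simp add: vec_eq_iff)
  then have "d = (- x) *s c" by (simp add: vec_eq_iff uminus_mult_left[symmetric]) (metis uminus_uminus)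
  then show ?thesis using xH by (intro bexI[of _ "- x"]) auto
qed

end

section \<open>Painting lemmas and duality\<close>

text \<open>Normalised to a product \<open>1\<close>, of norm \<open>0\<close>, at the distinguished
  coordinate \<open>e\<close>. Two admissible entries give a product that cannot cancel this
  \<open>1\<close>; two inadmissible ones give a product that no admissible term can cancel.\<close>

definition painting_pair :: "symtrop set \<Rightarrow> symtrop set \<Rightarrow> bool" where
  "painting_pair A B \<longleftrightarrow> 0 \<in> A \<and> 0 \<in> B \<and>
    (\<forall>a\<in>tpm. \<forall>b\<in>tpm. (a \<in> A \<and> b \<in> B \<longrightarrow> nrm (b * a) \<le> 0 \<and> b * a \<noteq> - 1) \<and>
      (a \<notin> A \<and> b \<notin> B \<longrightarrow> 0 \<le> nrm (b * a) \<and> b * a \<noteq> - 1))"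

section \<open>Orthogonal vectors and the painting alternative\<close>

context trop_matroid
begin

text \<open>Orthogonality is asked against all vectors, not only the circuits;
  \<open>covectors_eq\<close> shows that both give the same set.\<close>

definition dual_vectors :: "(symtrop ^ 'n) set" where
  "dual_vectors = {w \<in> vecs H. \<forall>v\<in>V. orth w v}"

lemma dual_sub: "w \<in> dual_vectors \<Longrightarrow> w \<in> vecs H" "w \<in> dual_vectors \<Longrightarrow> w $ i \<in> H" "w \<in> dual_vectors \<Longrightarrow> w $ i \<in> tpm" "w \<in> dual_vectors \<Longrightarrow> w \<in> vecs tpm"
  using H_tpm vecs_H_tpm by (auto simp: dual_vectors_def vecs_def)

lemma dual_orth: "w \<in> dual_vectors \<Longrightarrow> v \<in> V \<Longrightarrow> orth w v"
  by (simp add: dual_vectors_def)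

lemma V_vecs_tpm: "v \<in> V \<Longrightarrow> v \<in> vecs tpm"
  using V_sub vecs_H_tpm by blast

text \<open>A positive term at \<open>f\<close> needs a negative partner of at least its norm; all
  other terms have norm at most \<open>0\<close>, so the partner would be \<open>- 1\<close>. A
  negative term at \<open>f\<close> would likewise have norm exactly \<open>0\<close> and be
  \<open>- 1\<close> itself.\<close>

lemma orth_dominant:
  assumes "u \<in> vecs tpm" "v \<in> vecs tpm" "orth u v"
    and other: "\<And>i. i \<noteq> f \<Longrightarrow> nrm (u $ i * v $ i) \<le> 0 \<and> u $ i * v $ i \<noteq> - 1"
    and f: "0 \<le> nrm (u $ f * v $ f)" "u $ f * v $ f \<noteq> - 1"
  shows False
proof -
  have one: "x = 1" if "x \<in> tpos" "nrm x = 0" for x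
    using that by (cases x) (auto simp: one_symtrop_def zero_ereal_def)
  have mone: "x = - 1" if "x \<in> tneg" "nrm x = 0" for x
    using that by (cases x) (auto simp: one_symtrop_def zero_ereal_def)
  note o = orth_iff[OF assms(1,2), THEN iffD1, OF assms(3)]
  have "u $ f * v $ f \<in> tpm" using vecs_tpm_mult assms by blast
  moreover have "u $ f * v $ f \<noteq> 0" using f(1) by auto
  ultimately consider "u $ f * v $ f \<in> tpos" | "u $ f * v $ f \<in> tneg" using tpm_sign_cases by blast
  then show False
  proof cases
    case 1
    then obtain i where i: "u $ i * v $ i \<in> tneg" "nrm (u $ f * v $ f) \<le> nrm (u $ i * v $ i)"
      using o by blast
    have "i \<noteq> f" using 1 i(1) by (auto simp: tpos_def tneg_def)
    then show False using other[of i] mone[OF i(1)] i(2) f(1) by (meson antisym order_trans)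
  next
    case 2
    then obtain i where i: "u $ i * v $ i \<in> tpos" "nrm (u $ f * v $ f) \<le> nrm (u $ i * v $ i)"
      using o by blast
    have "i \<noteq> f" using 2 i(1) by (auto simp: tpos_def tneg_def)
    then show False using other[of i] mone[OF 2] i(2) f by (meson antisym order_trans)
  qed
qed

text \<open>If no such vector exists, extend \<open>{e}\<close> to a basis of the contraction to
  \<open>insert e Z\<close>. Orthogonality to the fundamental circuits forces the entries of
  \<open>w\<close>, and elimination with these circuits reduces orthogonality to any
  \<open>v\<close> to the case where \<open>v\<close> vanishes on \<open>Z - B\<close>.\<close>

lemma painting_base:
  assumes "e \<notin> Z"
  shows "(\<exists>v\<in>V. v $ e = 1 \<and> (\<forall>j\<in>Z. v $ j = 0)) \<or> (\<exists>w\<in>dual_vectors. w $ e = 1 \<and> (\<forall>j. j \<noteq> e \<longrightarrow> j \<notin> Z \<longrightarrow> w $ j = 0))"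
proof (subst disj_imp, rule impI)
  assume no_v: "\<not> (\<exists>v\<in>V. v $ e = 1 \<and> (\<forall>j\<in>Z. v $ j = 0))"
  \<comment> \<open>independence after contracting all elements outside \<open>insert e Z\<close>\<close>
  define indep where "indep B \<longleftrightarrow> e \<in> B \<and> B \<subseteq> insert e Z \<and>
    \<not> (\<exists>v\<in>V. (\<exists>j\<in>B. v $ j \<noteq> 0) \<and> (\<forall>j\<in>insert e Z - B. v $ j = 0))" for B
  have "indep {e}"
    unfolding indep_def
  proof (intro conjI notI)
    assume "\<exists>v\<in>V. (\<exists>j\<in>{e}. v $ j \<noteq> 0) \<and> (\<forall>j\<in>insert e Z - {e}. v $ j = 0)"
    then obtain v where v: "v \<in> V" "v $ e \<noteq> 0" "\<forall>j\<in>Z. v $ j = 0" using assms by auto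
    obtain s where "s *s v \<in> V" "(s *s v) $ e = 1" using V_normalize[OF v(1,2)] by blast
    then show False using no_v v(3) by auto
  qed auto
  moreover have "finite {B. indep B}" by simp
  ultimately obtain B where B: "indep B" and max: "\<And>B'. indep B' \<Longrightarrow> B \<subseteq> B' \<Longrightarrow> B' = B"
    using finite_has_maximal2[of "{B. indep B}" "{e}"] by auto
  have eB: "e \<in> B" "B \<subseteq> insert e Z" using B by (auto simp: indep_def)
  have B0: "v $ j = 0" if "v \<in> V" "\<And>j. j \<in> Z - B \<Longrightarrow> v $ j = 0" "j \<in> B" for v j
    using B that unfolding indep_def by auto
  have "\<exists>c\<in>V. c $ f = 1 \<and> (\<forall>j\<in>Z - B - {f}. c $ j = 0)" if f: "f \<in> Z - B" for f
  proof -
    have "\<not> indep (insert f B)" using max f by blast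
    then obtain v where v: "v \<in> V" "\<exists>j\<in>insert f B. v $ j \<noteq> 0" "\<forall>j\<in>Z - B - {f}. v $ j = 0"
      using eB f unfolding indep_def by auto
    \<comment> \<open>If the entry at \<open>f\<close> were zero, \<open>v\<close> would vanish on
      \<open>Z - B\<close> but not on \<open>B\<close>, against the independence of
      \<open>B\<close>.\<close>
    have "v $ f \<noteq> 0" using B0[OF v(1)] v(2,3) by (metis DiffI insertE singletonD)
    then obtain s where "s *s v \<in> V" "(s *s v) $ f = 1" using V_normalize[OF v(1)] by blast
    then show ?thesis using v(3) by (intro bexI[of _ "s *s v"]) auto
  qed
  then obtain c where c: "\<And>f. f \<in> Z - B \<Longrightarrow> c f \<in> V" "\<And>f. f \<in> Z - B \<Longrightarrow> c f $ f = 1"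
    "\<And>f j. f \<in> Z - B \<Longrightarrow> j \<in> Z - B \<Longrightarrow> j \<noteq> f \<Longrightarrow> c f $ j = 0"
    by (metis DiffI singletonD)
  \<comment> \<open>the fundamental cocircuit of \<open>e\<close>, with entries forced by orthogonality to the \<open>c f\<close>\<close>
  define w :: "symtrop ^ 'n" where "w = (\<chi> j. if j = e then 1 else if j \<in> Z - B then - c j $ e else 0)"
  have w: "w $ e = 1" "\<And>f. f \<in> Z - B \<Longrightarrow> w $ f = - c f $ e" "\<And>f. f \<noteq> e \<Longrightarrow> f \<notin> Z - B \<Longrightarrow> w $ f = 0"
    using assms by (auto simp: w_def)
  have wH: "w \<in> vecs H" using c(1) V_coord by (auto simp: vecs_def w_def)
  have "orth w v" if "v \<in> V" for v
    using that
  proof (induction "card {f \<in> Z - B. v $ f \<noteq> 0}" arbitrary: v rule: less_induct)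
    case less
    show ?case
    proof (cases "\<exists>f\<in>Z - B. v $ f \<noteq> 0")
      case False
      then have "v $ e = 0" using B0[OF less.prems] eB by auto
      then have "w $ j * v $ j = 0" for j using w(3)[of j] False by (cases "j = e") auto
      then have "(\<Sum>j\<in>UNIV. w $ j * v $ j) = 0" by (intro sum.neutral) blast
      then show ?thesis by (simp add: orth_def tbal_def)
    next
      case True
      then obtain f where f: "f \<in> Z - B" "v $ f \<noteq> 0" by blast
      define x where "x = (- v $ f) *s c f"
      have x: "x \<in> V" unfolding x_def using c(1) f V_coord[OF less.prems] by (intro V_scale) auto
      have "v $ f = - x $ f" using c(2)[OF f(1)] by (simp add: x_def)
      then obtain z where z: "z \<in> V" "z $ f = 0" "\<And>k. z $ k \<in> unbalance (v $ k + x $ k)"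
        using V_elim[OF less.prems x] f(2) by blast
      have zv: "z $ k = v $ k" if "k \<in> Z - B" "k \<noteq> f" for k
      proof -
        have "x $ k = 0" using c(3)[OF f(1) that] by (simp add: x_def)
        then show ?thesis using z(3)[of k]
            unbalance_plus_iff[OF V_coord(2)[OF less.prems, of k] mem_simps(2), of "z $ k"]
          by (auto split: if_splits)
      qed
      have "{k \<in> Z - B. z $ k \<noteq> 0} \<subset> {k \<in> Z - B. v $ k \<noteq> 0}"
        using f z(2) zv by (intro psubsetI) (auto, metis DiffI)
      then have "card {k \<in> Z - B. z $ k \<noteq> 0} < card {k \<in> Z - B. v $ k \<noteq> 0}"
        by (intro psubset_card_mono) auto
      from less.hyps[OF this z(1)] have oz: "orth w z" .
      have fe: "f \<noteq> e" using f eB by auto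
      let ?R = "\<Sum>j\<in>UNIV - {e} - {f}. w $ j * v $ j"
      have split: "(\<Sum>j\<in>UNIV. w $ j * y $ j) = y $ e + (w $ f * y $ f + (\<Sum>j\<in>UNIV - {e} - {f}. w $ j * y $ j))" for y
        using fe w(1) sum.remove[of UNIV e "\<lambda>j. w $ j * y $ j"] sum.remove[of "UNIV - {e}" f "\<lambda>j. w $ j * y $ j"] by simp
      have "(\<Sum>j\<in>UNIV - {e} - {f}. w $ j * z $ j) = ?R"
        using zv w(3) by (intro sum.cong refl) (metis DiffE mult_zero_left singletonI)
      then have "z $ e + ?R \<in> tbal"
        using oz z(2) unfolding orth_def split by simp
      \<comment> \<open>The entry of \<open>x\<close> at \<open>e\<close> is exactly the
        \<open>f\<close> term of the pairing of \<open>w\<close> with \<open>v\<close>, so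
        \<open>z $ e\<close> resolves the sum of the terms at \<open>e\<close> and
        \<open>f\<close>.\<close>
      moreover have "x $ e = w $ f * v $ f"
        using w(2)[OF f(1)] by (simp add: x_def uminus_mult_left[symmetric] uminus_mult_right[symmetric] mult.commute)
      then have "z $ e \<in> unbalance (v $ e + w $ f * v $ f)" using z(3)[of e] by simp
      moreover have "w $ f * v $ f \<in> tpm"
        using tpm_mult wH H_tpm V_coord(2)[OF less.prems] by (simp add: vecs_def)
      ultimately have "v $ e + w $ f * v $ f + ?R \<in> tbal"
        using unbalance_plus_tbal V_coord(2)[OF less.prems] by blast
      then show ?thesis unfolding orth_def split by (simp add: add.assoc)
    qed
  qed
  then have "w \<in> dual_vectors" using wH by (simp add: dual_vectors_def)
  then show "\<exists>w\<in>dual_vectors. w $ e = 1 \<and> (\<forall>j. j \<noteq> e \<longrightarrow> j \<notin> Z \<longrightarrow> w $ j = 0)" using w by (intro bexI[of _ w]) auto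
qed

text \<open>Coordinates in \<open>Z\<close> are zero for the vector and free for the orthogonal
  vector, those outside \<open>P\<close>, \<open>Z\<close> and \<open>e\<close> the other way round.
  The induction moves \<open>f\<close> from \<open>P\<close> into either class.\<close>

lemma painting:
  fixes P Z :: "'n set"
  assumes "e \<notin> P" "e \<notin> Z" "P \<inter> Z = {}"
    and "\<And>f. f \<in> P \<Longrightarrow> painting_pair (A f) (B f)"
  shows "(\<exists>v\<in>V. v $ e = 1 \<and> (\<forall>f\<in>P. v $ f \<in> A f) \<and> (\<forall>j\<in>Z. v $ j = 0)) \<or>
    (\<exists>w\<in>dual_vectors. w $ e = 1 \<and> (\<forall>f\<in>P. w $ f \<in> B f) \<and> (\<forall>j. j \<noteq> e \<longrightarrow> j \<notin> P \<longrightarrow> j \<notin> Z \<longrightarrow> w $ j = 0))"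
  using finite[of P] assms
proof (induction P arbitrary: Z rule: finite_induct)
  case empty
  then show ?case using painting_base[of e Z] by simp
next
  case (insert f P)
  note f = insert.prems
  have pair: "painting_pair (A f) (B f)" using f(4) by simp
  have IH: "(\<exists>v\<in>V. v $ e = 1 \<and> (\<forall>f\<in>P. v $ f \<in> A f) \<and> (\<forall>j\<in>Z. v $ j = 0)) \<or>
    (\<exists>w\<in>dual_vectors. w $ e = 1 \<and> (\<forall>f\<in>P. w $ f \<in> B f) \<and> (\<forall>j. j \<noteq> e \<longrightarrow> j \<notin> P \<longrightarrow> j \<notin> Z \<longrightarrow> w $ j = 0))"
    if "e \<notin> Z" "P \<inter> Z = {}" for Z
    by (rule insert.IH) (use that f in auto)
  show ?case
  proof (rule ccontr)
    assume neg: "\<not> ?thesis"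
    \<comment> \<open>First move: \<open>f\<close> joins \<open>Z\<close>. A vector obtained this
      way would satisfy \<open>A f\<close>, which contains \<open>0\<close>; so an orthogonal vector
      results, unrestricted at \<open>f\<close>.\<close>
    have "\<not> (\<exists>v\<in>V. v $ e = 1 \<and> (\<forall>f\<in>P. v $ f \<in> A f) \<and> (\<forall>j\<in>insert f Z. v $ j = 0))"
    proof
      assume "\<exists>v\<in>V. v $ e = 1 \<and> (\<forall>f\<in>P. v $ f \<in> A f) \<and> (\<forall>j\<in>insert f Z. v $ j = 0)"
      then obtain v where "v \<in> V" "v $ e = 1" "\<forall>f\<in>P. v $ f \<in> A f" "\<forall>j\<in>insert f Z. v $ j = 0" by blast
      then have "v \<in> V" "v $ e = 1 \<and> (\<forall>f\<in>insert f P. v $ f \<in> A f) \<and> (\<forall>j\<in>Z. v $ j = 0)"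
        using pair by (auto simp: painting_pair_def)
      then show False using neg by blast
    qed
    then obtain w where w: "w \<in> dual_vectors" "w $ e = 1" "\<And>i. i \<in> P \<Longrightarrow> w $ i \<in> B i"
      "\<And>j. j \<noteq> e \<Longrightarrow> j \<notin> P \<Longrightarrow> j \<notin> insert f Z \<Longrightarrow> w $ j = 0"
      using IH[of "insert f Z"] f(1-3) insert.hyps(2) by auto
    \<comment> \<open>Second move: \<open>f\<close> joins the coordinates where the orthogonal
      vector is zero; so a vector results, unrestricted at \<open>f\<close>.\<close>
    have "\<not> (\<exists>w\<in>dual_vectors. w $ e = 1 \<and> (\<forall>f\<in>P. w $ f \<in> B f) \<and> (\<forall>j. j \<noteq> e \<longrightarrow> j \<notin> P \<longrightarrow> j \<notin> Z \<longrightarrow> w $ j = 0))"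
    proof
      assume "\<exists>w\<in>dual_vectors. w $ e = 1 \<and> (\<forall>f\<in>P. w $ f \<in> B f) \<and> (\<forall>j. j \<noteq> e \<longrightarrow> j \<notin> P \<longrightarrow> j \<notin> Z \<longrightarrow> w $ j = 0)"
      then obtain w where w: "w \<in> dual_vectors" "w $ e = 1" "\<forall>f\<in>P. w $ f \<in> B f" "\<forall>j. j \<noteq> e \<longrightarrow> j \<notin> P \<longrightarrow> j \<notin> Z \<longrightarrow> w $ j = 0" by blast
      have "w $ f = 0" using w(4) f(1,3) insert.hyps(2) by auto
      then have "w \<in> dual_vectors" "w $ e = 1 \<and> (\<forall>f\<in>insert f P. w $ f \<in> B f) \<and> (\<forall>j. j \<noteq> e \<longrightarrow> j \<notin> insert f P \<longrightarrow> j \<notin> Z \<longrightarrow> w $ j = 0)"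
        using pair w by (auto simp: painting_pair_def)
      then show False using neg by blast
    qed
    then obtain v where v: "v \<in> V" "v $ e = 1" "\<And>i. i \<in> P \<Longrightarrow> v $ i \<in> A i" "\<And>j. j \<in> Z \<Longrightarrow> v $ j = 0"
      using IH[of Z] f(1-3) by blast
    have "v $ f \<notin> A f"
    proof
      assume "v $ f \<in> A f"
      then have "v $ e = 1 \<and> (\<forall>f\<in>insert f P. v $ f \<in> A f) \<and> (\<forall>j\<in>Z. v $ j = 0)" using v by auto
      then show False using neg v(1) by blast
    qed
    moreover have "w $ f \<notin> B f"
    proof
      assume "w $ f \<in> B f"
      then have "w $ e = 1 \<and> (\<forall>f\<in>insert f P. w $ f \<in> B f) \<and> (\<forall>j. j \<noteq> e \<longrightarrow> j \<notin> insert f P \<longrightarrow> j \<notin> Z \<longrightarrow> w $ j = 0)" using w by auto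
      then show False using neg w(1) by blast
    qed
    ultimately have ff: "0 \<le> nrm (w $ f * v $ f)" "w $ f * v $ f \<noteq> - 1"
      using pair V_coord(2)[OF v(1)] dual_sub(3)[OF w(1)] by (auto simp: painting_pair_def)
    \<comment> \<open>At every coordinate other than \<open>f\<close> the product is
      \<open>1\<close>, \<open>0\<close> or a product of admissible entries.\<close>
    have "nrm (w $ i * v $ i) \<le> 0 \<and> w $ i * v $ i \<noteq> - 1" if ne: "i \<noteq> f" for i
    proof -
      have n1: "(1::symtrop) \<noteq> - 1" "(0::symtrop) \<noteq> - 1" by (auto simp: one_symtrop_def zero_symtrop_def)
      consider "i = e" | "i \<in> P" | "i \<in> Z" | "i \<noteq> e" "i \<notin> P" "i \<notin> insert f Z" using ne by blast
      then show ?thesis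
      proof cases
        case 2
        then show ?thesis using f(4)[of i] V_coord(2)[OF v(1)] dual_sub(3)[OF w(1)] v(3) w(3) by (simp add: painting_pair_def)
      qed (use v w n1 in auto)
    qed
    from orth_dominant[OF dual_sub(4)[OF w(1)] V_vecs_tpm[OF v(1)] dual_orth[OF w(1) v(1)] this ff] show False .
  qed
qed

end

section \<open>Constraint pairs for conformality and for norm bounds\<close>

lemma zero_tbal [simp]: "0 \<in> tbal"
  by (simp add: tbal_def)

lemma nrm_mult_less_iff: "a \<noteq> 0 \<Longrightarrow> nrm (a * x) < nrm (a * y) \<longleftrightarrow> nrm x < nrm y"
  by (cases a; cases x; cases y) (auto simp: zero_symtrop_def)

lemma nrm_mult_le_iff: "a \<noteq> 0 \<Longrightarrow> nrm (a * x) \<le> nrm (a * y) \<longleftrightarrow> nrm x \<le> nrm y"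
  using nrm_mult_less_iff[of a y x] by (simp add: not_less[symmetric])

lemma unbalance_iff: "z \<in> unbalance s \<longleftrightarrow> (if s \<in> tbal then z \<in> tpm \<and> nrm z \<le> nrm s else z = s)"
  by (cases s; cases z rule: uminus_symtrop.cases)
    (auto simp: unbalance_def less_eq_symtrop_def less_symtrop_def zero_symtrop_def)

lemma plus_unbalanced:
  assumes "x \<in> tpm" "y \<in> tpm" "x + y \<notin> tbal"
  shows "x = x + y \<or> nrm x < nrm (x + y)" "y = x + y \<or> nrm y < nrm (x + y)" "x = x + y \<or> y = x + y"
  using assms
  by (cases x rule: uminus_symtrop.cases; cases y rule: uminus_symtrop.cases; force split: if_splits)+

lemma plus_balanced:
  assumes "x \<in> tpm" "y \<in> tpm" "x + y \<in> tbal"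
  shows "nrm x = nrm (x + y)" "nrm y = nrm (x + y)"
  using assms
  by (cases x rule: uminus_symtrop.cases; cases y rule: uminus_symtrop.cases; force split: if_splits)+

text \<open>The first set describes entries conformal to \<open>q\<close>, the second those
  conformal to its inverse. Outside both, a tie in norm leaves only \<open>a = - q\<close> and
  \<open>b\<close> equal to minus the inverse, whose product is \<open>1\<close> and not
  \<open>- 1\<close>.\<close>

lemma painting_pair_conformal:
  assumes q: "q \<in> tpm" "q \<noteq> 0"
  shows "painting_pair {a. a = q \<or> nrm a < nrm q} {b. b * q = 1 \<or> nrm (b * q) < 0}"
proof -
  have 1: "nrm (b * a) \<le> 0 \<and> b * a \<noteq> - 1" if "a \<in> tpm" "b \<in> tpm" "a = q \<or> nrm a < nrm q" "b * q = 1 \<or> nrm (b * q) < 0" for a b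
    using that q
    by (cases a rule: uminus_symtrop.cases; cases b rule: uminus_symtrop.cases; cases q rule: uminus_symtrop.cases)
      (auto simp: one_symtrop_def zero_symtrop_def zero_ereal_def)
  have 2: "0 \<le> nrm (b * a) \<and> b * a \<noteq> - 1" if "a \<in> tpm" "b \<in> tpm" "\<not> (a = q \<or> nrm a < nrm q)" "\<not> (b * q = 1 \<or> nrm (b * q) < 0)" for a b
    using that q
    by (cases a rule: uminus_symtrop.cases; cases b rule: uminus_symtrop.cases; cases q rule: uminus_symtrop.cases)
      (auto simp: one_symtrop_def zero_symtrop_def zero_ereal_def)
  show ?thesis unfolding painting_pair_def using 1 2 q by auto
qed

text \<open>The sign-free pair for balanced coordinates: a weak bound on one side and a strict one
  on the other put the norm of the product strictly below or strictly above
  \<open>0\<close>.\<close>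

lemma painting_pair_bounded:
  assumes q: "q \<in> tpm" "q \<noteq> 0"
  shows "painting_pair {a. nrm a \<le> nrm q} {b. nrm (b * q) < 0}"
proof -
  have 1: "nrm (b * a) \<le> 0 \<and> b * a \<noteq> - 1" if "nrm a \<le> nrm q" "nrm (b * q) < 0" for a b
    using that q
    by (cases a; cases b; cases q)
      (auto simp: one_symtrop_def zero_symtrop_def zero_ereal_def)
  have 2: "0 \<le> nrm (b * a) \<and> b * a \<noteq> - 1" if "\<not> nrm a \<le> nrm q" "\<not> nrm (b * q) < 0" for a b
    using that q
    by (cases a; cases b; cases q)
      (auto simp: one_symtrop_def zero_symtrop_def zero_ereal_def)
  show ?thesis unfolding painting_pair_def using 1 2 q by auto
qed

lemma painting_pair_swap:
  assumes "painting_pair A B"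
  shows "painting_pair B A"
proof -
  have *: "(a \<in> B \<and> b \<in> A \<longrightarrow> nrm (b * a) \<le> 0 \<and> b * a \<noteq> - 1) \<and>
      (a \<notin> B \<and> b \<notin> A \<longrightarrow> 0 \<le> nrm (b * a) \<and> b * a \<noteq> - 1)" if "a \<in> tpm" "b \<in> tpm" for a b
    using assms that unfolding painting_pair_def mult.commute[of b a] by blast
  have "0 \<in> A" "0 \<in> B" using assms by (simp_all add: painting_pair_def)
  then show ?thesis unfolding painting_pair_def by (intro conjI[OF _ conjI] ballI *)
qed

lemma minus_one_neq [simp]: "(0::symtrop) \<noteq> - 1" "(1::symtrop) \<noteq> - 1" "- 1 \<noteq> (0::symtrop)" "- 1 \<noteq> (1::symtrop)"
  by (auto simp: one_symtrop_def zero_symtrop_def)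

section \<open>Biduality and elimination at one coordinate\<close>

context trop_matroid
begin

text \<open>For each \<open>e\<close> in the support apply the painting alternative to
  \<open>x\<close> normalised at \<open>e\<close>. An orthogonal vector from the second case would
  make the term \<open>1\<close> at \<open>e\<close> dominant in its pairing with \<open>x\<close>;
  so there is a conformal part agreeing at \<open>e\<close>, and these parts compose to
  \<open>x\<close>.\<close>

lemma bidual:
  assumes "x \<in> vecs H" "\<And>w. w \<in> dual_vectors \<Longrightarrow> orth w x"
  shows "x \<in> V"
proof (cases "x = 0")
  case False
  have xH: "x $ k \<in> H" "x $ k \<in> tpm" for k using assms(1) H_tpm by (auto simp: vecs_def)
  show ?thesis
  proof (rule conf_composition[OF V_left_sum False])
    fix e assume "e \<in> supp x"
    then have e: "x $ e \<noteq> 0" by (simp add: supp_def)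
    then obtain r where r: "r \<in> H" "x $ e * r = 1" "r \<noteq> 0" using H_inverse[OF xH(1) e] by metis
    define q where "q k = r * x $ k" for k
    have q: "q k \<in> tpm" "x $ k \<noteq> 0 \<Longrightarrow> q k \<noteq> 0" "q e = 1" "x $ e * q k = x $ k" for k
      using H_mult[OF r(1) xH(1)] H_tpm r by (auto simp: q_def mult.commute mult.assoc[symmetric])
    let ?A = "\<lambda>k. {a. a = q k \<or> nrm a < nrm (q k)}" and ?B = "\<lambda>k. {b. b * q k = 1 \<or> nrm (b * q k) < 0}"
    have pair: "painting_pair (?A k) (?B k)" if "k \<in> supp x - {e}" for k
      using painting_pair_conformal q that by (auto simp: supp_def)
    from painting[of e "supp x - {e}" "- supp x" ?A ?B, OF _ _ _ pair] e
    have "(\<exists>v\<in>V. v $ e = 1 \<and> (\<forall>k\<in>supp x - {e}. v $ k \<in> ?A k) \<and> (\<forall>j\<in>- supp x. v $ j = 0)) \<or>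
      (\<exists>w\<in>dual_vectors. w $ e = 1 \<and> (\<forall>k\<in>supp x - {e}. w $ k \<in> ?B k))" by (auto simp: supp_def)
    then show "\<exists>y\<in>V. conf y x \<and> y $ e = x $ e"
    proof (elim disjE bexE conjE)
      fix v assume v: "v \<in> V" "v $ e = 1" "\<forall>k\<in>supp x - {e}. v $ k \<in> ?A k" "\<forall>j\<in>- supp x. v $ j = 0"
      have "(x $ e *s v) $ k = x $ k \<or> nrm ((x $ e *s v) $ k) < nrm (x $ k)" for k
      proof -
        consider "k = e" | "x $ k = 0" | "k \<in> supp x - {e}" by (auto simp: supp_def)
        then show ?thesis
        proof cases
          case 3
          then have "v $ k = q k \<or> nrm (v $ k) < nrm (q k)" using v(3) by auto
          then show ?thesis using q(4)[of k] nrm_mult_less_iff[OF e, of "v $ k" "q k", unfolded q(4)] by auto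
        qed (use v in \<open>auto simp: supp_def\<close>)
      qed
      then have "conf (x $ e *s v) x" by (simp add: conf_def)
      then show ?thesis using v V_scale[OF xH(1) v(1)] by (intro bexI[of _ "x $ e *s v"]) auto
    next
      fix w assume w: "w \<in> dual_vectors" "w $ e = 1" "\<forall>k\<in>supp x - {e}. w $ k \<in> ?B k"
      have "r *s x \<in> vecs tpm" using q(1) by (simp add: vecs_def q_def)
      moreover have "orth w (r *s x)" using assms(2)[OF w(1)] by (rule orth_scale)
      moreover have "nrm (w $ k * (r *s x) $ k) \<le> 0 \<and> w $ k * (r *s x) $ k \<noteq> - 1" if "k \<noteq> e" for k
      proof (cases "x $ k = 0")
        case False
        then have "w $ k * q k = 1 \<or> nrm (w $ k * q k) < 0" using w(3) that by (auto simp: supp_def)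
        then show ?thesis by (auto simp: q_def)
      qed simp
      ultimately have False
        using orth_dominant[OF dual_sub(4)[OF w(1)], of "r *s x" e] w(2) q(3) by (simp add: q_def)
      then show ?thesis ..
    qed
  qed
qed (simp add: V_zero)

text \<open>Painting is asked for an orthogonal vector with the prescribed entry at
  \<open>e\<close>, conformal to the sum where that is unbalanced, bounded by it where balanced, and
  zero at \<open>i\<close>. The competing \<open>v\<close> in \<open>V\<close> cannot be orthogonal
  to both \<open>x\<close> and \<open>y\<close>, whose terms at \<open>i\<close> are
  opposite.\<close>

lemma dual_elim_coordinate:
  assumes x: "x \<in> dual_vectors" and y: "y \<in> dual_vectors" and i: "x $ i = - y $ i" "x $ i \<noteq> 0"
    and e: "x $ e + y $ e \<notin> tbal"
  shows "\<exists>z\<in>dual_vectors. z $ e = x $ e + y $ e \<and> z $ i = 0 \<and>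
    (\<forall>k. nrm (z $ k) \<le> nrm (x $ k + y $ k)) \<and>
    (\<forall>k. x $ k + y $ k \<notin> tbal \<longrightarrow> z $ k = x $ k + y $ k \<or> nrm (z $ k) < nrm (x $ k + y $ k))"
proof -
  define s where "s k = x $ k + y $ k" for k
  note tpm = dual_sub(3)[OF x] dual_sub(3)[OF y]
  have unb: "x $ k = s k \<or> nrm (x $ k) < nrm (s k)" "y $ k = s k \<or> nrm (y $ k) < nrm (s k)" "x $ k = s k \<or> y $ k = s k"
    if "s k \<notin> tbal" for k
    using plus_unbalanced[OF tpm] that unfolding s_def by blast+
  have bal: "nrm (x $ k) = nrm (s k)" "nrm (y $ k) = nrm (s k)" if "s k \<in> tbal" for k
    using plus_balanced[OF tpm] that unfolding s_def by blast+
  have si: "s i \<in> tbal" "i \<noteq> e"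
  proof -
    show "s i \<in> tbal" unfolding s_def using i(1) tpm(2)[of i] by (cases "y $ i" rule: uminus_symtrop.cases) auto
    then show "i \<noteq> e" using e by (auto simp: s_def)
  qed
  have se: "s e \<in> H" "s e \<noteq> 0" "s e \<notin> tbal"
    using unb(3)[of e] e dual_sub(2)[OF x, of e] dual_sub(2)[OF y, of e] by (auto simp: s_def)
  obtain r where r: "r \<in> H" "s e * r = 1" "r \<noteq> 0" using H_inverse[OF se(1,2)] by metis
  \<comment> \<open>A signed stand-in for \<open>s k\<close> with the same norm and lying in
    \<open>H\<close>; at balanced coordinates \<open>x\<close> supplies it.\<close>
  define g where "g k = (if s k \<in> tbal then x $ k else s k)" for k
  have g: "g k \<in> H" "nrm (g k) = nrm (s k)" for k
    using unb(3)[of k] bal[of k] dual_sub(2)[OF x, of k] dual_sub(2)[OF y, of k] by (auto simp: g_def)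
  define q where "q k = r * g k" for k
  have q: "q k \<in> tpm" "g k \<noteq> 0 \<Longrightarrow> q k \<noteq> 0" "q e = 1" "s e * q k = g k" for k
    using H_mult[OF r(1) g(1)] H_tpm r se by (auto simp: q_def g_def mult.commute mult.assoc[symmetric])
  have g0: "g k = 0 \<longleftrightarrow> s k = 0" for k using g(2)[of k] by (metis nrm_eq_MInf)
  let ?A = "\<lambda>k. if s k \<in> tbal then {a. nrm (a * q k) < 0} else {a. a * q k = 1 \<or> nrm (a * q k) < 0}"
  let ?B = "\<lambda>k. if s k \<in> tbal then {b. nrm b \<le> nrm (q k)} else {b. b = q k \<or> nrm b < nrm (q k)}"
  \<comment> \<open>The coordinate \<open>i\<close> is in neither \<open>?P\<close> nor the empty
    zero set, so the orthogonal vector vanishes there and \<open>v\<close> is free.\<close>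
  let ?P = "{k. s k \<noteq> 0} - {e, i}"
  have pair: "painting_pair (?A k) (?B k)" if "k \<in> ?P" for k
  proof -
    have "g k \<noteq> 0" using that g0 by simp
    then have qk: "q k \<in> tpm" "q k \<noteq> 0" using q(1,2) by auto
    show ?thesis
    proof (cases "s k \<in> tbal")
      case True
      show ?thesis unfolding if_P[OF True]
        by (rule painting_pair_swap[OF painting_pair_bounded[OF qk]])
    next
      case False
      show ?thesis unfolding if_not_P[OF False]
        by (rule painting_pair_swap[OF painting_pair_conformal[OF qk]])
    qed
  qed
  from painting[of e ?P "{}" ?A ?B, OF _ _ _ pair]
  have "(\<exists>v\<in>V. v $ e = 1 \<and> (\<forall>k\<in>?P. v $ k \<in> ?A k)) \<or>
      (\<exists>w\<in>dual_vectors. w $ e = 1 \<and> (\<forall>k\<in>?P. w $ k \<in> ?B k) \<and> (\<forall>j. j \<noteq> e \<longrightarrow> j \<notin> ?P \<longrightarrow> w $ j = 0))"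
    by auto
  then show ?thesis
  proof (elim disjE bexE conjE)
    fix w assume w: "w \<in> dual_vectors" "w $ e = 1" "\<forall>k\<in>?P. w $ k \<in> ?B k" "\<forall>j. j \<noteq> e \<longrightarrow> j \<notin> ?P \<longrightarrow> w $ j = 0"
    define z where "z = s e *s w"
    have "z \<in> dual_vectors"
    proof -
      have "orth z v" if "v \<in> V" for v
        using orth_scale[of v w "s e"] dual_orth[OF w(1) that] by (simp add: z_def orth_commute)
      then show ?thesis using H_mult[OF se(1) dual_sub(2)[OF w(1)]] by (simp add: dual_vectors_def z_def vecs_def)
    qed
    moreover have "z $ e = s e" "z $ i = 0" using w si by (auto simp: z_def)
    moreover have "nrm (z $ k) \<le> nrm (s k) \<and> (s k \<notin> tbal \<longrightarrow> z $ k = s k \<or> nrm (z $ k) < nrm (s k))" for k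
    proof -
      consider "k = e" | "k \<in> ?P" | "k \<noteq> e" "k = i" | "k \<noteq> e" "s k = 0" by blast
      then show ?thesis
      proof cases
        case 2
        have z: "nrm (z $ k) < nrm (s k) \<longleftrightarrow> nrm (w $ k) < nrm (q k)" "nrm (z $ k) \<le> nrm (s k) \<longleftrightarrow> nrm (w $ k) \<le> nrm (q k)"
          using nrm_mult_less_iff[OF se(2), of "w $ k" "q k"] nrm_mult_le_iff[OF se(2), of "w $ k" "q k"]
          unfolding q(4) g(2) by (auto simp: z_def)
        have "w $ k \<in> ?B k" using w(3) 2 by blast
        then show ?thesis
          using z q(4)[of k] by (auto simp: z_def g_def split: if_splits)
      next
        case 3
        then show ?thesis using si w(4) by (auto simp: z_def)
      next
        case 4
        then show ?thesis using w(4) by (auto simp: z_def)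
      qed (use \<open>z $ e = s e\<close> in simp)
    qed
    ultimately show ?thesis unfolding s_def by (intro bexI[of _ z]) auto
  next
    fix v assume v: "v \<in> V" "v $ e = 1" "\<forall>k\<in>?P. v $ k \<in> ?A k"
    \<comment> \<open>Stated for \<open>x'\<close> and \<open>y'\<close> to cover both roles, since
      the entry \<open>s e\<close> is attained by \<open>x\<close> or by \<open>y\<close>.\<close>
    have False if dual_vectors: "x' \<in> dual_vectors" "y' \<in> dual_vectors" and xe: "x' $ e = s e" and neg: "x' $ i = - y' $ i"
      and ub: "\<And>u k. u \<in> {x', y'} \<Longrightarrow> s k \<notin> tbal \<Longrightarrow> u $ k = s k \<or> nrm (u $ k) < nrm (s k)"
      and bd: "\<And>u k. u \<in> {x', y'} \<Longrightarrow> s k \<in> tbal \<Longrightarrow> nrm (u $ k) = nrm (s k)" for x' y'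
    proof -
      define t where "t u k = v $ k * (r *s u) $ k" for u :: "symtrop ^ 'n" and k
      have bound: "nrm (t u k) \<le> 0 \<and> t u k \<noteq> - 1" if u: "u \<in> {x', y'}" and "k \<noteq> i" for u k
      proof -
        have eq: "t u k = 1 \<or> nrm (t u k) < 0" if "u $ k = s k" "s k \<notin> tbal" "k \<in> insert e ?P"
        proof (cases "k = e")
          case True
          then show ?thesis using that v(2) r(2) by (simp add: t_def mult.commute)
        next
          case False
          then have "v $ k \<in> ?A k" using v(3) that by blast
          then show ?thesis using that by (auto simp: t_def q_def g_def)
        qed
        have lt: "nrm (t u k) < 0" if "nrm (u $ k) < nrm (s k)" "s k \<notin> tbal" "k \<in> insert e ?P"
        proof (cases "v $ k = 0")
          case False
          have "nrm (v $ k * q k) \<le> 0"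
          proof (cases "k = e")
            case True
            then show ?thesis using v(2) q(3) by simp
          next
            case False
            then have "v $ k \<in> ?A k" using v(3) that(3) by blast
            then show ?thesis using that(2) by (auto simp: less_imp_le)
          qed
          moreover have "nrm (v $ k * (r * u $ k)) < nrm (v $ k * (r * s k))"
            using False r(3) that(1) by (simp add: nrm_mult_less_iff)
          ultimately show ?thesis using that(2) by (simp add: t_def q_def g_def)
        qed (simp add: t_def)
        consider "s k = 0" | "s k \<notin> tbal" "k \<in> insert e ?P" | "s k \<in> tbal" "k \<in> ?P"
          using \<open>k \<noteq> i\<close> se by auto
        then show ?thesis
        proof cases
          case 1
          then have "s k \<in> tbal" by (simp add: zero_symtrop_def)
          then have "u $ k = 0" using bd[OF u] 1 by (metis nrm_eq_MInf)
          then show ?thesis by (simp add: t_def)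
        next
          case 2
          then show ?thesis using ub[OF u, of k] eq lt by (auto simp: less_imp_le)
        next
          case 3
          then have "nrm (v $ k * q k) < 0" using v(3)[rule_format, OF 3(2)] by simp
          moreover have "nrm (t u k) = nrm (v $ k * q k)"
            using bd[OF u 3(1)] g(2)[of k] by (simp add: t_def q_def nrm_mult)
          ultimately show ?thesis by (auto simp: less_imp_le)
        qed
      qed
      have orth: "orth v (r *s u)" "r *s u \<in> vecs tpm" if "u \<in> {x', y'}" for u
        using orth_scale[of v u r] dual_orth[of u v] v(1) that dual_vectors H_mult[OF r(1)] dual_sub(2) H_tpm
        by (auto simp: orth_commute vecs_def)
      have no: "\<not> (0 \<le> nrm (t u i) \<and> t u i \<noteq> - 1)" if "u \<in> {x', y'}" for u
        using orth_dominant[OF V_vecs_tpm[OF v(1)] orth(2,1)[OF that], of i] bound[OF that]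
        unfolding t_def by blast
      \<comment> \<open>Otherwise the term \<open>1\<close> at \<open>e\<close> would be dominant in
        the pairing of \<open>v\<close> with \<open>x'\<close>.\<close>
      have "0 \<le> nrm (t x' i)"
      proof (rule ccontr)
        assume "\<not> 0 \<le> nrm (t x' i)"
        then have "nrm (t x' k) \<le> 0 \<and> t x' k \<noteq> - 1" for k
          using bound[of x' k] by (cases "k = i") (auto simp: less_imp_le)
        moreover have "t x' e = 1" using v(2) xe r(2) by (simp add: t_def mult.commute)
        ultimately show False
          using orth_dominant[OF V_vecs_tpm[OF v(1)] orth(2,1)[of x'], of e] unfolding t_def by auto
      qed
      moreover have "t x' i = - t y' i"
        using neg by (simp add: t_def uminus_mult_right)
      \<comment> \<open>A term at \<open>i\<close> of norm at least \<open>0\<close> other than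
        \<open>- 1\<close> would dominate, so both are \<open>- 1\<close>, although they are
        negatives of each other.\<close>
      ultimately have "t x' i = - 1" "t y' i = - 1" using no[of x'] no[of y'] by auto
      then show False using \<open>t x' i = - t y' i\<close> by simp
    qed
    note contra = this
    have "y $ i = - x $ i" using i(1) by simp
    then have "x $ e \<noteq> s e" "y $ e \<noteq> s e"
      using contra[OF x y _ i(1)] contra[OF y x] unb bal by blast+
    then show ?thesis using unb(3)[OF se(3)] by simp
  qed
qed

end

lemma left_sum_eqI:
  "z = s \<or> nrm z < nrm s \<Longrightarrow> u = s \<or> nrm u < nrm s \<Longrightarrow> z = s \<or> u = s \<Longrightarrow> left_sum z u = s"
  by (auto simp: left_sum_eq)

section \<open>The dual matroid and the description of vectors by cocircuits\<close>

context trop_matroid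
begin

lemma dual_left_sum:
  assumes "x \<in> dual_vectors" "y \<in> dual_vectors"
  shows "left_sum_vec x y \<in> dual_vectors"
proof -
  have "orth (left_sum_vec x y) v" if "v \<in> V" for v
  proof -
    have "x \<in> perp {v}" "y \<in> perp {v}"
      using assms that dual_sub(4) dual_orth by (auto simp: perp_def orth_commute[of v])
    then have "left_sum_vec x y \<in> perp {v}"
      using tc_convex_left_sum[OF tc_convex_perp, of "{v}" x y] V_vecs_tpm[OF that] by simp
    then show ?thesis by (simp add: perp_def orth_commute)
  qed
  moreover have "left_sum_vec x y \<in> vecs H"
    using assms dual_sub(2) by (simp add: vecs_def left_sum_vec_def left_sum_eq)
  ultimately show ?thesis by (simp add: dual_vectors_def)
qed

lemma dual_zero: "0 \<in> dual_vectors"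
  by (simp add: dual_vectors_def vecs_def)

lemma dual_scale:
  assumes "s \<in> H" "w \<in> dual_vectors"
  shows "s *s w \<in> dual_vectors"
proof -
  have "orth (s *s w) v" if "v \<in> V" for v
    using orth_scale[of v w s] dual_orth[OF assms(2) that] by (simp add: orth_commute)
  then show ?thesis using H_mult[OF assms(1) dual_sub(2)[OF assms(2)]] by (simp add: dual_vectors_def vecs_def)
qed

text \<open>Left sums collect the results of \<open>dual_elim_coordinate\<close> at all unbalanced
  coordinates. Conformality there keeps entries already reached; at balanced coordinates the norm
  bound suffices, and the zero at \<open>i\<close> persists.\<close>

lemma dual_elim:
  assumes x: "x \<in> dual_vectors" and y: "y \<in> dual_vectors" and i: "x $ i = - y $ i" "x $ i \<noteq> 0"
  shows "\<exists>z\<in>dual_vectors. (\<forall>k. z $ k \<in> unbalance (x $ k + y $ k)) \<and> z $ i = 0"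
proof -
  let ?N = "{k. x $ k + y $ k \<notin> tbal}"
  let ?good = "\<lambda>z. z \<in> dual_vectors \<and> z $ i = 0 \<and> (\<forall>k. nrm (z $ k) \<le> nrm (x $ k + y $ k)) \<and>
    (\<forall>k\<in>?N. z $ k = x $ k + y $ k \<or> nrm (z $ k) < nrm (x $ k + y $ k))"
  have "\<exists>z. ?good z \<and> (\<forall>k\<in>I. z $ k = x $ k + y $ k)" if "I \<subseteq> ?N" for I
    using finite[of I] that
  proof (induction I rule: finite_induct)
    case empty
    \<comment> \<open>The zero vector starts the induction: unbalanced sums are nonzero and so have
      larger norm.\<close>
    have "x $ k + y $ k \<noteq> 0" if "k \<in> ?N" for k using that by auto
    then show ?case using dual_zero by (intro exI[of _ 0]) auto
  next
    case (insert e I)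
    then obtain z where z: "?good z" "\<forall>k\<in>I. z $ k = x $ k + y $ k" by auto
    obtain u where u: "?good u" "u $ e = x $ e + y $ e"
      using dual_elim_coordinate[OF x y i, of e] insert.prems by auto
    have "left_sum_vec z u $ k = x $ k + y $ k" if k: "k \<in> insert e I" for k
    proof -
      have "k \<in> ?N" using k insert.prems by blast
      then have "left_sum (z $ k) (u $ k) = x $ k + y $ k"
        using z u k by (intro left_sum_eqI) blast+
      then show ?thesis by (simp add: left_sum_vec_def)
    qed
    moreover have "?good (left_sum_vec z u)"
      using z(1) u(1) dual_left_sum[of z u] unfolding left_sum_vec_def by (auto simp: left_sum_eq)
    ultimately show ?case by blast
  qed
  from this[of ?N] obtain z where z: "?good z" "\<forall>k\<in>?N. z $ k = x $ k + y $ k" by auto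
  have "z $ k \<in> unbalance (x $ k + y $ k)" for k
    using z dual_sub(3)[of z k] by (auto simp: unbalance_iff)
  then show ?thesis using z by blast
qed

lemma dual_matroid: "trop_matroid H dual_vectors"
proof
  show "matroid_vectors H dual_vectors"
    unfolding matroid_vectors_def unbalance_vec_def
    using dual_zero dual_scale dual_left_sum dual_elim dual_sub(1) by auto
qed

text \<open>Circuits orthogonal to \<open>w\<close> lie in the TC-convex set
  \<open>perp {w}\<close>, which then contains every nonzero vector of \<open>V\<close>.\<close>

lemma covectors_eq: "covectors H V = dual_vectors"
proof
  show "dual_vectors \<subseteq> covectors H V"
    using circuits_sub by (auto simp: dual_vectors_def covectors_def)
  show "covectors H V \<subseteq> dual_vectors"
  proof
    fix w assume "w \<in> covectors H V"
    then have w: "w \<in> vecs H" "\<And>c. c \<in> circuits V \<Longrightarrow> orth w c" by (auto simp: covectors_def)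
    have "orth w v" if "v \<in> V" for v
    proof (cases "v = 0")
      case False
      have "circuits V \<subseteq> perp {w}"
        using w(2) circuits_sub V_vecs_tpm by (auto simp: perp_def)
      moreover have "tc_convex (perp {w})" using w(1) vecs_H_tpm by (intro tc_convex_perp) simp
      ultimately have "v \<in> perp {w}" using vector_in_closed[OF tc_convex_left_sum _ that False] by blast
      then show ?thesis by (simp add: perp_def)
    qed simp
    then show "w \<in> dual_vectors" using w(1) by (simp add: dual_vectors_def)
  qed
qed

lemma cocircuits_eq: "cocircuits H V = circuits dual_vectors"
  by (simp add: cocircuits_def covectors_eq circuits_def)

lemma cocircuits_sub: "cocircuits H V \<subseteq> dual_vectors" "cocircuits H V \<subseteq> vecs tpm"
  using trop_matroid.circuits_sub[OF dual_matroid] dual_sub(4) by (auto simp: cocircuits_eq)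

text \<open>The cocircuits are the circuits of the dual matroid, so \<open>perp {x}\<close> contains
  all its vectors once it contains them.\<close>

lemma perp_cocircuits_iff: "x \<in> perp (cocircuits H V) \<longleftrightarrow> x \<in> vecs tpm \<and> (\<forall>w\<in>dual_vectors. orth w x)"
proof
  assume x: "x \<in> perp (cocircuits H V)"
  then have xt: "x \<in> vecs tpm" by (simp add: perp_def)
  have "orth w x" if w: "w \<in> dual_vectors" for w
  proof (cases "w = 0")
    case False
    have "circuits dual_vectors \<subseteq> perp {x}"
      using x cocircuits_sub(2) by (auto simp: perp_def orth_commute cocircuits_eq)
    moreover have "tc_convex (perp {x})" using xt by (intro tc_convex_perp) simp
    ultimately have "w \<in> perp {x}"
      using trop_matroid.vector_in_closed[OF dual_matroid tc_convex_left_sum _ w False] by blast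
    then show ?thesis by (simp add: perp_def orth_commute)
  qed simp
  then show "x \<in> vecs tpm \<and> (\<forall>w\<in>dual_vectors. orth w x)" using xt by blast
qed (use cocircuits_sub in \<open>auto simp: perp_def\<close>)

theorem vectors_eq: "V = vecs H \<inter> perp (cocircuits H V)"
  using V_sub V_vecs_tpm dual_orth bidual by (auto simp: perp_cocircuits_iff)

lemma V_sub_perp: "V \<subseteq> perp (cocircuits H V)"
  using vectors_eq by blast

lemma tc_convex_perp_cocircuits: "tc_convex (perp (cocircuits H V))"
  by (rule tc_convex_perp[OF cocircuits_sub(2)])

text \<open>By biduality \<open>V\<close> is an orthogonal complement, hence TC-convex, so it
  contains the hull of its circuits; conversely nonzero vectors are left sums of circuits.\<close>

lemma tropical_description:
  assumes "H = tpm"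
  shows "V = conv_tc (circuits V) \<union> {0}" "V = perp (cocircuits H V)"
proof -
  show eq: "V = perp (cocircuits H V)"
    using vectors_eq assms by (auto simp: perp_def)
  have "conv_tc (circuits V) \<subseteq> V"
    using tc_convex_perp_cocircuits circuits_sub by (intro conv_tc_least) (simp_all add: eq[symmetric])
  moreover have "v \<in> conv_tc (circuits V)" if "v \<in> V" "v \<noteq> 0" for v
    using vector_in_closed[OF tc_convex_left_sum _ that] by (intro in_conv_tcI) blast
  ultimately show "V = conv_tc (circuits V) \<union> {0}" using V_zero by blast
qed

end

section \<open>Points orthogonal to sign vectors\<close>

text \<open>The sign pattern of the entries of norm at least \<open>r\<close>. For \<open>r\<close>
  above \<open>-\<infinity>\<close> zero entries are cut off, so on signed vectors the final
  \<open>- 1\<close> only meets negative ones.\<close>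

definition sgn_cut :: "ereal \<Rightarrow> symtrop ^ 'n \<Rightarrow> symtrop ^ 'n" where
  "sgn_cut r x = (\<chi> j. if nrm (x $ j) < r then 0 else if x $ j \<in> tpos then 1 else - 1)"

lemma sgn_cut_nth: "x \<in> tpm \<Longrightarrow> x \<noteq> 0 \<Longrightarrow> TNum SPos (real_of_ereal (nrm x)) * (if x \<in> tpos then 1 else - 1) = x"
  by (cases x rule: tpm_cases) (auto simp: one_symtrop_def zero_symtrop_def)

lemma cut_sign:
  assumes "d \<in> sign_hyperfield" "y \<in> tpm" "r \<noteq> -\<infinity>"
  defines "t \<equiv> if nrm y < r then 0 else if y \<in> tpos then 1 else - 1"
  shows "d * t \<in> tpos \<longleftrightarrow> d * y \<in> tpos \<and> r \<le> nrm (d * y)"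
    "d * t \<in> tneg \<longleftrightarrow> d * y \<in> tneg \<and> r \<le> nrm (d * y)"
    "d * t \<in> tpos \<union> tneg \<Longrightarrow> nrm (d * t) = 0"
proof -
  have n: "(0::symtrop) \<notin> tpos" "(0::symtrop) \<notin> tneg" "(1::symtrop) \<in> tpos" "(1::symtrop) \<notin> tneg"
    by (auto simp: zero_symtrop_def one_symtrop_def)
  have r: "\<not> r \<le> - \<infinity>" using assms(3) by simp
  have y: "y = 0 \<or> y \<noteq> 0 \<and> y \<in> tpos \<and> y \<notin> tneg \<or> y \<noteq> 0 \<and> y \<in> tneg \<and> y \<notin> tpos"
    using assms(2) by (cases y rule: uminus_symtrop.cases) (auto simp: zero_symtrop_def)
  have d: "d = 0 \<or> d = 1 \<or> d = - 1" using assms(1) by (auto simp: sign_hyperfield_def)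
  have tn: "t = 0 \<and> nrm y < r \<or> t = 1 \<and> y \<in> tpos \<and> r \<le> nrm y \<or> t = - 1 \<and> y \<notin> tpos \<and> r \<le> nrm y"
    by (auto simp: t_def)
  show "d * t \<in> tpos \<longleftrightarrow> d * y \<in> tpos \<and> r \<le> nrm (d * y)"
    using d tn y n r by (elim disjE conjE) (simp_all add: uminus_mult_left[symmetric])
  show "d * t \<in> tneg \<longleftrightarrow> d * y \<in> tneg \<and> r \<le> nrm (d * y)"
    using d tn y n r by (elim disjE conjE) (simp_all add: uminus_mult_left[symmetric])
  show "d * t \<in> tpos \<union> tneg \<Longrightarrow> nrm (d * t) = 0"
    using d tn n by (elim disjE conjE) (simp_all add: uminus_mult_left[symmetric])
qed

text \<open>Entries of \<open>d\<close> vanish or have norm \<open>0\<close>, so cutting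
  \<open>x\<close> keeps exactly the terms of norm at least \<open>r\<close>, with their signs. A
  dominating term of opposite sign is kept too, and all kept terms get norm
  \<open>0\<close>.\<close>

lemma orth_sgn_cut:
  assumes d: "d \<in> vecs sign_hyperfield" and x: "x \<in> vecs tpm" and o: "orth d x" and r: "r \<noteq> -\<infinity>"
  shows "orth d (sgn_cut r x)"
proof -
  have dt: "d \<in> vecs tpm"
    using d hyperfield.vecs_H_tpm[of sign_hyperfield] by (simp add: hyperfield_def)
  have st: "sgn_cut r x \<in> vecs tpm" by (auto simp: vecs_def sgn_cut_def)
  have sg: "d $ j * sgn_cut r x $ j \<in> tpos \<longleftrightarrow> d $ j * x $ j \<in> tpos \<and> r \<le> nrm (d $ j * x $ j)"
    "d $ j * sgn_cut r x $ j \<in> tneg \<longleftrightarrow> d $ j * x $ j \<in> tneg \<and> r \<le> nrm (d $ j * x $ j)" 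
    "d $ j * sgn_cut r x $ j \<in> tpos \<union> tneg \<Longrightarrow> nrm (d $ j * sgn_cut r x $ j) = 0" for j
    using cut_sign[of "d $ j" "x $ j" r] d x r by (auto simp: sgn_cut_def vecs_def sign_hyperfield_def)
  have "\<exists>i. d $ i * sgn_cut r x $ i \<in> tpos" if "d $ j * sgn_cut r x $ j \<in> tneg" for j
    using that o[unfolded orth_iff[OF dt x]] unfolding sg by (meson order_trans)
  moreover have "\<exists>i. d $ i * sgn_cut r x $ i \<in> tneg" if "d $ j * sgn_cut r x $ j \<in> tpos" for j
    using that o[unfolded orth_iff[OF dt x]] unfolding sg by (meson order_trans)
  ultimately show ?thesis
    unfolding orth_iff[OF dt st] using sg(3) by (metis UnI1 UnI2 order_refl)
qed

section \<open>Cones and hulls over the sign hyperfield\<close>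

context trop_matroid
begin

text \<open>The cut of \<open>x\<close> at level \<open>r\<close> is a vector by biduality. Scaled
  by \<open>r\<close> it equals \<open>x\<close> at entries of norm \<open>r\<close>, vanishes at
  smaller ones and is strictly below \<open>x\<close> at larger ones. Only multiples by norms of
  entries of \<open>x\<close> occur, which serves both cones and hulls inside the unit box.\<close>

lemma perp_in_closed:
  assumes sign: "H = sign_hyperfield" and x: "x \<in> perp (cocircuits H V)"
    and closed: "\<And>y z. y \<in> S \<Longrightarrow> z \<in> S \<Longrightarrow> left_sum_vec y z \<in> S" "0 \<in> S"
    and scale: "\<And>v r i. v \<in> V \<Longrightarrow> ereal r = nrm (x $ i) \<Longrightarrow> TNum SPos r *s v \<in> S"
  shows "x \<in> S"
proof (cases "x = 0")
  case False
  have xt: "x \<in> vecs tpm" "\<And>i. x $ i \<in> tpm" using x by (auto simp: perp_def vecs_def)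
  show ?thesis
  proof (rule conf_composition[OF closed(1) False])
    fix i assume "i \<in> supp x"
    then have i: "x $ i \<noteq> 0" by (simp add: supp_def)
    define r where "r = real_of_ereal (nrm (x $ i))"
    have r: "ereal r = nrm (x $ i)" using nrm_real[OF i] by (simp add: r_def)
    define v where "v = sgn_cut (ereal r) x"
    have "orth d v" if "d \<in> dual_vectors" for d
      using that x xt dual_sub(1) sign unfolding v_def perp_cocircuits_iff by (intro orth_sgn_cut) auto
    moreover have "v \<in> vecs H" using sign by (auto simp: v_def vecs_def sgn_cut_def sign_hyperfield_def)
    ultimately have "v \<in> V" by (rule bidual[rotated])
    have eq: "(TNum SPos r *s v) $ k = x $ k" if "nrm (x $ k) = ereal r" for k
    proof -
      have "x $ k \<noteq> 0" using that by auto
      then show ?thesis using sgn_cut_nth[OF xt(2)[of k]] that by (auto simp: v_def sgn_cut_def)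
    qed
    have "(TNum SPos r *s v) $ k = x $ k \<or> nrm ((TNum SPos r *s v) $ k) < nrm (x $ k)" for k
    proof -
      consider "nrm (x $ k) = ereal r" | "nrm (x $ k) < ereal r" | "nrm (x $ k) > ereal r" by (meson less_linear)
      then show ?thesis
      proof cases
        case 2
        then have "v $ k = 0" by (simp add: v_def sgn_cut_def)
        then show ?thesis by (cases "x $ k = 0") auto
      next
        case 3
        then have "nrm (v $ k) = 0" by (auto simp: v_def sgn_cut_def)
        then show ?thesis using 3 by (simp add: nrm_mult)
      qed (use eq in blast)
    qed
    then have "conf (TNum SPos r *s v) x" by (simp add: conf_def)
    then show "\<exists>y\<in>S. conf y x \<and> y $ i = x $ i"
      using scale[OF \<open>v \<in> V\<close> r] eq[of i] r by (intro bexI[of _ "TNum SPos r *s v"]) auto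
  qed
qed (simp add: closed(2))

lemma V_in_convex:
  assumes "tc_convex S" "circuits V \<union> {0} \<subseteq> S" "v \<in> V"
  shows "v \<in> S"
  using vector_in_closed[OF tc_convex_left_sum[OF assms(1)] _ assms(3)] assms(2) by (cases "v = 0") auto

lemma sign_vecs_unit_box: "H = sign_hyperfield \<Longrightarrow> V \<subseteq> unit_box"
proof
  fix v assume H: "H = sign_hyperfield" and v: "v \<in> V"
  have "nrm (v $ i) \<le> 0" for i
    using V_coord(1)[OF v, of i] unfolding H sign_hyperfield_def by auto
  then show "v \<in> unit_box" using V_vecs_tpm[OF v] by (simp only: unit_box_iff) simp
qed

text \<open>A TC-convex set containing \<open>0\<close> admits scaling by norms at most
  \<open>0\<close>, and points of the unit box have no larger entries. So
  \<open>perp_in_closed\<close> places the right-hand side inside every competing convex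
  set.\<close>

lemma sign_conv:
  assumes sign: "H = sign_hyperfield"
  shows "conv_tc (circuits V \<union> {0}) = perp (cocircuits H V) \<inter> unit_box"
    and "conv_tc V = perp (cocircuits H V) \<inter> unit_box"
proof -
  let ?K = "perp (cocircuits H V) \<inter> unit_box"
  have K: "tc_convex ?K" "V \<subseteq> ?K"
    using tc_convex_Int[OF tc_convex_perp_cocircuits tc_convex_unit_box] V_sub_perp sign_vecs_unit_box[OF sign] by auto
  have CV: "circuits V \<union> {0} \<subseteq> V" using circuits_sub V_zero by auto
  have main: "?K \<subseteq> S" if S: "tc_convex S" "circuits V \<union> {0} \<subseteq> S" for S
  proof
    fix x assume x: "x \<in> ?K"
    then have box: "nrm (x $ i) \<le> 0" for i by (auto simp: unit_box_iff)
    have "0 \<in> S" using S(2) by simp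
    show "x \<in> S"
    proof (rule perp_in_closed[OF sign _ tc_convex_left_sum[OF S(1)] \<open>0 \<in> S\<close>])
      fix v r i assume "v \<in> V" "ereal r = nrm (x $ i)"
      then show "TNum SPos r *s v \<in> S"
        using tc_convex_scale[OF S(1) \<open>0 \<in> S\<close> V_in_convex[OF S]] box[of i] by simp
    qed (use x in auto)
  qed
  show "conv_tc (circuits V \<union> {0}) = ?K"
    using main K CV by (intro equalityI conv_tc_least subsetI in_conv_tcI) blast+
  show "conv_tc V = ?K"
    using main K CV by (intro equalityI conv_tc_least subsetI in_conv_tcI) blast+
qed

text \<open>A cone admits all positive scalings, so the box disappears. The argument works for every
  generating set between the circuits and \<open>V\<close>, which covers both claims.\<close>

lemma sign_span:
  assumes sign: "H = sign_hyperfield"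
  shows "span_tc (circuits V) = perp (cocircuits H V)" and "span_tc V = perp (cocircuits H V)"
proof -
  let ?K = "perp (cocircuits H V)"
  have K: "tc_convex ?K" "trop_cone ?K" "V \<subseteq> ?K" "0 \<in> ?K"
    using tc_convex_perp_cocircuits trop_cone_perp V_sub_perp V_zero by auto
  have main: "?K \<subseteq> S" if S: "tc_convex S" "trop_cone S" "circuits V \<union> {0} \<subseteq> S" for S
  proof
    fix x assume x: "x \<in> ?K"
    show "x \<in> S"
    proof (rule perp_in_closed[OF sign x tc_convex_left_sum[OF S(1)]])
      fix v r i assume "v \<in> V" "ereal r = nrm (x $ i)"
      then show "TNum SPos r *s v \<in> S"
        using S(2) V_in_convex[OF S(1,3)] by (simp add: trop_cone_def)
    qed (use S(3) in auto)
  qed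
  have span: "span_tc M = ?K" if M: "circuits V \<subseteq> M" "M \<subseteq> V" for M
  proof
    have "M \<union> uminus ` M \<union> {0} \<subseteq> ?K" using M V_uminus K(3,4) by auto
    then show "span_tc M \<subseteq> ?K" unfolding span_tc_def cone_tc_def
      using K(1,2) by (intro hull_minimal) auto
    show "?K \<subseteq> span_tc M" unfolding span_tc_def cone_tc_def hull_def
      using main M by (intro Inter_greatest) auto
  qed
  show "span_tc (circuits V) = ?K" "span_tc V = ?K" using span circuits_sub by auto
qed

lemma sign_vectors:
  assumes sign: "H = sign_hyperfield"
  shows "V = vecs sign_hyperfield \<inter> conv_tc (circuits V \<union> {0})"
    and "V = vecs sign_hyperfield \<inter> perp (cocircuits H V)"
  using vectors_eq sign_vecs_unit_box[OF sign] sign_conv(1)[OF sign] sign by auto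

end

lemma hyperplanes_eq_perp: "vecs tpm \<inter> (\<Inter>d\<in>D. hyperplane 0 d) = perp D"
  by (auto simp: perp_def hyperplane_def orth_def affine_form_def)

section \<open>Realizable matroids\<close>

text \<open>On the subspace where coordinate \<open>j\<close> vanishes, the remaining coordinates
  suffice by induction. The defect \<open>g\<close> vanishes on that kernel, so it is a multiple of
  coordinate \<open>j\<close>.\<close>

lemma functional_combination:
  fixes L :: "('a::field ^ 'n) set"
  assumes "finite S" "vec.subspace L" "\<And>v. v \<in> L \<Longrightarrow> (\<And>i. i \<in> S \<Longrightarrow> v $ i = 0) \<Longrightarrow> v $ e = 0"
  shows "\<exists>c. \<forall>v\<in>L. v $ e = (\<Sum>i\<in>S. c i * v $ i)"
  using assms
proof (induction S arbitrary: L rule: finite_induct)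
  case (insert j S)
  note L = insert.prems(1)
  let ?K = "{v \<in> L. v $ j = 0}"
  have "vec.subspace ?K"
    using L by (auto simp: vec.subspace_def)
  moreover have "v $ e = 0" if "v \<in> ?K" "\<And>i. i \<in> S \<Longrightarrow> v $ i = 0" for v
    using insert.prems(2)[of v] that by auto
  ultimately obtain c where c: "\<And>v. v \<in> ?K \<Longrightarrow> v $ e = (\<Sum>i\<in>S. c i * v $ i)"
    using insert.IH[of ?K] by blast
  define g where "g v = v $ e - (\<Sum>i\<in>S. c i * v $ i)" for v :: "'a ^ 'n"
  have g: "g (v - a *s u) = g v - a * g u" for v u a
  proof -
    have "(\<Sum>i\<in>S. c i * (v - a *s u) $ i) = (\<Sum>i\<in>S. c i * v $ i) - a * (\<Sum>i\<in>S. c i * u $ i)"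
      by (simp add: right_diff_distrib sum_subtractf sum_distrib_left mult.left_commute)
    then show ?thesis by (simp add: g_def right_diff_distrib)
  qed
  have "\<exists>b. \<forall>v\<in>L. g v = b * v $ j"
  proof (cases "\<exists>u\<in>L. u $ j \<noteq> 0")
    case True
    then obtain u where u: "u \<in> L" "u $ j \<noteq> 0" by blast
    have "g v = g u / u $ j * v $ j" if "v \<in> L" for v
    proof -
      have "v - (v $ j / u $ j) *s u \<in> ?K"
        using L that u by (auto intro: vec.subspace_diff vec.subspace_scale)
      from c[OF this] have "g (v - (v $ j / u $ j) *s u) = 0"
        unfolding g_def by (rule eq_iff_diff_eq_0[THEN iffD1])
      then show ?thesis using g by (simp add: mult.commute)
    qed
    then show ?thesis by blast
  next
    case False
    then have "g v = 0 * v $ j" if "v \<in> L" for v using c[of v] that by (simp add: g_def)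
    then show ?thesis by blast
  qed
  then obtain b where b: "\<And>v. v \<in> L \<Longrightarrow> g v = b * v $ j" by blast
  have "v $ e = (\<Sum>i\<in>insert j S. (c(j := b)) i * v $ i)" if "v \<in> L" for v
  proof -
    have "(\<Sum>i\<in>S. (c(j := b)) i * v $ i) = (\<Sum>i\<in>S. c i * v $ i)"
      using insert.hyps(2) by (intro sum.cong) auto
    then show ?thesis using b[OF that] insert.hyps by (simp add: g_def algebra_simps)
  qed
  then show ?case by blast
qed simp

section \<open>Linear circuits and cocircuits of a realization\<close>

definition map_vec :: "('a \<Rightarrow> 'b) \<Rightarrow> 'a ^ 'n \<Rightarrow> 'b ^ 'n" where
  "map_vec f x = (\<chi> i. f (x $ i))"

lemma map_vec_nth [simp]: "map_vec f x $ i = f (x $ i)"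
  by (simp add: map_vec_def)

lemma image_vec_eq: "image_vec f L = map_vec f ` L"
  by (simp add: image_vec_def map_vec_def)

text \<open>Isolates what the sign map and the signed valuation share, so that linear and matroid
  circuits and cocircuits are compared once for both.\<close>

locale realized_matroid = trop_matroid H V
  for H and V :: "(symtrop ^ 'n) set" +
  fixes f :: "'a::field \<Rightarrow> symtrop" and L :: "('a ^ 'n) set"
  assumes f_zero_iff [simp]: "f x = 0 \<longleftrightarrow> x = 0"
    and f_H: "f x \<in> H"
    and f_orth: "\<And>w v :: 'a ^ 'n. (\<Sum>i\<in>UNIV. w $ i * v $ i) = 0 \<Longrightarrow> orth (map_vec f w) (map_vec f v)"
    and realizes: "realizes f L V"
begin

lemma L: "vec.subspace L" "V = map_vec f ` L"
  using realizes by (auto simp: realizes_def image_vec_eq)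

lemma supp_map_vec [simp]: "supp (map_vec f v) = supp v"
  by (simp add: supp_def)

lemma map_vec_zero_iff [simp]: "map_vec f v = 0 \<longleftrightarrow> v = 0"
  by (simp add: vec_eq_iff)

lemma image_circuits: "image_vec f (lin_circuits L) = circuits V"
proof -
  have "map_vec f v \<in> min_supp V \<longleftrightarrow> v \<in> min_supp L" if "v \<in> L" for v
    using that by (simp add: L(2) min_supp_def)
  moreover have "min_supp V \<subseteq> map_vec f ` L" "min_supp L \<subseteq> L"
    by (auto simp: L(2) min_supp_def)
  ultimately show ?thesis
    unfolding circuits_def lin_circuits_def image_vec_eq by blast
qed

lemma dual_space_image:
  assumes "w \<in> dual_space L"
  shows "map_vec f w \<in> dual_vectors"
proof -
  have "orth (map_vec f w) v" if "v \<in> V" for v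
    using that assms f_orth by (force simp: L(2) dual_space_def)
  then show ?thesis using f_H by (simp add: dual_vectors_def vecs_def)
qed

text \<open>For \<open>e\<close> in the support of \<open>d\<close>, a vector of \<open>L\<close>
  vanishing on the rest of the support vanishes at \<open>e\<close>: otherwise its pairing with
  \<open>d\<close> would be a single nonzero signed term. So on \<open>L\<close> coordinate
  \<open>e\<close> is a linear combination of the others, whose coefficients give
  \<open>w\<close>.\<close>

lemma dual_supported:
  assumes "d \<in> dual_vectors" "d \<noteq> 0"
  shows "\<exists>w\<in>dual_space L. w \<noteq> 0 \<and> supp w \<subseteq> supp d"
proof -
  obtain e where e: "d $ e \<noteq> 0" using assms(2) by (auto simp: vec_eq_iff)
  let ?S = "supp d - {e}"
  have "v $ e = 0" if v: "v \<in> L" "\<And>i. i \<in> ?S \<Longrightarrow> v $ i = 0" for v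
  proof (rule ccontr)
    assume ve: "v $ e \<noteq> 0"
    have z: "d $ i * map_vec f v $ i = 0" if "i \<noteq> e" for i
      using v(2)[of i] that by (auto simp: supp_def)
    have "(\<Sum>i\<in>UNIV. d $ i * map_vec f v $ i) = (\<Sum>i\<in>{e}. d $ i * map_vec f v $ i)"
      by (rule sum.mono_neutral_right) (use z in auto)
    moreover have "orth d (map_vec f v)" using dual_orth[OF assms(1)] v(1) L(2) by blast
    ultimately have "d $ e * f (v $ e) \<in> tbal" by (simp add: orth_def)
    moreover have "d $ e * f (v $ e) \<in> tpm" using dual_sub(3)[OF assms(1)] f_H H_tpm tpm_mult by blast
    ultimately have "d $ e * f (v $ e) = 0" by (rule tbal_tpm_zero)
    then show False using e ve by simp
  qed
  then obtain c where c: "\<And>v. v \<in> L \<Longrightarrow> v $ e = (\<Sum>i\<in>?S. c i * v $ i)"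
    using functional_combination[of ?S L e] L(1) by auto
  define w :: "'a ^ 'n" where "w = (\<chi> i. if i = e then 1 else if i \<in> ?S then - c i else 0)"
  have "(\<Sum>i\<in>UNIV. w $ i * v $ i) = 0" if "v \<in> L" for v
  proof -
    have "(\<Sum>i\<in>UNIV. w $ i * v $ i) = (\<Sum>i\<in>insert e ?S. w $ i * v $ i)"
      by (rule sum.mono_neutral_right) (auto simp: w_def)
    also have "\<dots> = v $ e + (\<Sum>i\<in>?S. - (c i * v $ i))"
      by (subst sum.insert) (auto simp: w_def intro!: sum.cong)
    also have "\<dots> = 0" using c[OF that] by (simp add: sum_negf)
    finally show ?thesis .
  qed
  then have "w \<in> dual_space L" by (simp add: dual_space_def)
  moreover have "w $ e \<noteq> 0" by (simp add: w_def)
  then have "w \<noteq> 0" by auto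
  moreover have "supp w \<subseteq> supp d" using e by (auto simp: w_def supp_def split: if_splits)
  ultimately show ?thesis by blast
qed

text \<open>Minimality forces the linear dual vector supported in \<open>d\<close> to have the same
  support, and circuits of the dual matroid with equal support are proportional.\<close>

lemma cocircuit_lift:
  assumes d: "d \<in> cocircuits H V"
  shows "\<exists>w\<in>lin_cocircuits L. \<exists>s\<in>H. d = s *s map_vec f w"
proof -
  have dW: "d \<in> dual_vectors" "d \<noteq> 0" and min: "\<And>y. y \<in> dual_vectors \<Longrightarrow> y \<noteq> 0 \<Longrightarrow> \<not> supp y \<subset> supp d"
    using d by (auto simp: cocircuits_eq circuits_def min_supp_def)
  obtain w where w: "w \<in> dual_space L" "w \<noteq> 0" "supp w \<subseteq> supp d"
    using dual_supported[OF dW] by blast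
  have eq: "supp w = supp d"
    using min[OF dual_space_image[OF w(1)]] w(2,3) by auto
  have "map_vec f w \<in> circuits dual_vectors"
    using dual_space_image[OF w(1)] w(2) min eq by (auto simp: circuits_def min_supp_def)
  then obtain s where "s \<in> H" "d = s *s map_vec f w"
    using trop_matroid.circuits_same_supp[OF dual_matroid, of "map_vec f w" d] d eq by (auto simp: cocircuits_eq)
  moreover have "w \<in> lin_cocircuits L"
    using w(1,2) min[OF dual_space_image] eq by (auto simp: lin_cocircuits_def min_supp_def)
  ultimately show ?thesis by blast
qed

lemma perp_image_cocircuits: "perp (image_vec f (lin_cocircuits L)) = perp (cocircuits H V)"
proof
  show "perp (cocircuits H V) \<subseteq> perp (image_vec f (lin_cocircuits L))"
  proof
    fix x assume x: "x \<in> perp (cocircuits H V)"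
    have "orth (map_vec f w) x" if "w \<in> lin_cocircuits L" for w
    proof -
      have "w \<in> dual_space L" using that by (simp add: lin_cocircuits_def min_supp_def)
      then show ?thesis using x dual_space_image by (simp add: perp_cocircuits_iff)
    qed
    then show "x \<in> perp (image_vec f (lin_cocircuits L))"
      using x by (auto simp: perp_def image_vec_eq)
  qed
  show "perp (image_vec f (lin_cocircuits L)) \<subseteq> perp (cocircuits H V)"
  proof
    fix x assume x: "x \<in> perp (image_vec f (lin_cocircuits L))"
    have "orth d x" if d: "d \<in> cocircuits H V" for d
    proof -
      obtain w s where "w \<in> lin_cocircuits L" "d = s *s map_vec f w" using cocircuit_lift[OF d] by blast
      moreover from this have "orth (map_vec f w) x" using x by (simp add: perp_def image_vec_eq)
      ultimately show ?thesis using orth_scale[of x "map_vec f w" s] by (metis orth_commute)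
    qed
    then show "x \<in> perp (cocircuits H V)" using x by (simp add: perp_def)
  qed
qed

lemma tropical_image: "H = tpm \<Longrightarrow> tropical_image_description f L"
  using tropical_description
  unfolding tropical_image_description_def image_circuits perp_image_cocircuits
  by (simp add: image_vec_eq L(2)[symmetric])

lemma sign_image: "H = sign_hyperfield \<Longrightarrow> sign_image_description f L"
  using sign_vectors sign_conv
  unfolding sign_image_description_def image_circuits perp_image_cocircuits
  by (simp add: image_vec_eq L(2)[symmetric])

end

section \<open>The sign map of an ordered field\<close>

lemma sign_map_mult: "sign_map (x * y) = sign_map x * sign_map (y::'a::linordered_field)"
  by (auto simp: sign_map_def mult_pos_pos mult_neg_pos mult_pos_neg zero_less_mult_iff
      uminus_mult_left[symmetric] uminus_mult_right[symmetric])

lemma sign_map_simps: "sign_map x \<in> tpos \<longleftrightarrow> x > 0" "sign_map x \<in> tneg \<longleftrightarrow> x < 0" "x \<noteq> 0 \<Longrightarrow> nrm (sign_map x) = 0"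
  "sign_map x = 0 \<longleftrightarrow> x = 0" "sign_map x \<in> sign_hyperfield" "sign_map x \<in> tpm"
  by (auto simp: sign_map_def one_symtrop_def zero_symtrop_def sign_hyperfield_def zero_ereal_def)

lemma sum_zero_sign:
  fixes t :: "'b \<Rightarrow> 'a::linordered_idom"
  assumes "finite A" "sum t A = 0" "j \<in> A" "t j < 0"
  shows "\<exists>i\<in>A. t i > 0"
proof (rule ccontr)
  assume "\<not> ?thesis"
  then have "\<forall>i\<in>A. 0 \<le> - t i" by (auto simp: not_less)
  moreover have "(\<Sum>i\<in>A. - t i) = 0" using assms(2) by (simp add: sum_negf)
  ultimately have "- t j = 0" using assms(1,3) by (simp add: sum_nonneg_eq_0_iff)
  then show False using assms(4) by simp
qed

text \<open>A vanishing sum with a term of one sign has one of the other sign; nonzero signs all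
  have norm \<open>0\<close>, so domination is automatic.\<close>

lemma sign_map_orth:
  fixes w v :: "'a::linordered_field ^ 'n"
  assumes "(\<Sum>i\<in>UNIV. w $ i * v $ i) = 0"
  shows "orth (map_vec sign_map w) (map_vec sign_map v)"
proof -
  have t: "map_vec sign_map u \<in> vecs tpm" for u :: "'a ^ 'n"
    by (simp add: vecs_def sign_map_simps)
  have "(\<Sum>i\<in>UNIV. - (w $ i * v $ i)) = 0" using assms by (simp add: sum_negf)
  then have "\<exists>i. w $ i * v $ i < 0" if "w $ j * v $ j > 0" for j
    using sum_zero_sign[of UNIV "\<lambda>i. - (w $ i * v $ i)" j] that by auto
  moreover have "\<exists>i. w $ i * v $ i > 0" if "w $ j * v $ j < 0" for j
    using sum_zero_sign[of UNIV "\<lambda>i. w $ i * v $ i" j] assms that by auto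
  ultimately show ?thesis
    unfolding orth_iff[OF t t] map_vec_nth sign_map_mult[symmetric] sign_map_simps(1,2)
    using sign_map_simps(3) by (metis less_irrefl order_refl)
qed

section \<open>The signed valuation\<close>

lemma puiseux_sign: "0 < x \<longleftrightarrow> pu_coeff x (lead_exp x) > 0" "x < 0 \<longleftrightarrow> pu_coeff x (lead_exp x) < 0" for x :: puiseux
  using puiseux_pos_uminus[of x] by (simp_all add: less_puiseux_def puiseux_pos_def)

lemma sval_eqI:
  assumes "supp_le x r" "pu_coeff x r \<noteq> 0"
  shows "sval x = TNum (if pu_coeff x r > 0 then SPos else SNeg) r"
proof -
  have "lead_exp x = r" by (rule lead_exp_eq) (use assms in auto)
  moreover have "x \<noteq> 0" using assms(2) by auto
  ultimately show ?thesis using assms(2) puiseux_sign[of x] by (auto simp: sval_def)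
qed

lemma sval_0 [simp]: "sval 0 = 0"
  by (simp add: sval_def)

lemma sval_cases:
  obtains "x = 0" "sval x = 0"
  | r where "x \<noteq> 0" "supp_le x r" "pu_coeff x r \<noteq> 0" "nrm (sval x) = ereal r"
     "sval x = TNum (if pu_coeff x r > 0 then SPos else SNeg) r"
  using sval_eqI[of x "lead_exp x"] lead_exp[of x] by (cases "x = 0") (auto simp: sval_def)

lemma sval_zero_iff [simp]: "sval x = 0 \<longleftrightarrow> x = 0"
  by (auto simp: sval_def zero_symtrop_def)

lemma sval_tpm [simp]: "sval x \<in> tpm"
  by (auto simp: sval_def)

lemma sval_sign: "sval x \<in> tpos \<longleftrightarrow> 0 < x" "sval x \<in> tneg \<longleftrightarrow> x < 0"
  by (auto simp: sval_def zero_symtrop_def)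

lemma nrm_sval: "x \<noteq> 0 \<Longrightarrow> nrm (sval x) = ereal (lead_exp x)"
  by (auto simp: sval_def)

lemma sval_mult: "sval (x * y) = sval x * sval y"
  by (cases "x = 0"; cases "y = 0")
    (auto simp: sval_def lead_coeff_times zero_less_mult_iff zero_symtrop_def dest: less_asym)

lemma sval_uminus: "sval (- x) = - sval x"
proof -
  have "sval (- 1) = - 1"
    using sval_eqI[of "- 1" 0] by (simp add: supp_le_def coeff_1 one_symtrop_def)
  then show ?thesis using sval_mult[of "- 1" x] by (simp add: uminus_mult_left[symmetric])
qed

lemma sval_monomial: "c \<noteq> 0 \<Longrightarrow> sval (monomial c a) = TNum (if c > 0 then SPos else SNeg) a"
  using sval_eqI[OF supp_le_monomial, of c a] by (simp add: coeff_monomial)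

lemma sval_real_eq: "sval_real = sign_map"
proof
  fix c :: real
  have "monomial 0 0 = 0" by (rule puiseux_eqI) (simp add: coeff_monomial)
  then show "sval_real c = sign_map c"
    unfolding sval_real_def sign_map_def using sval_monomial[of c 0]
    by (cases "c = 0") (auto simp: one_symtrop_def)
qed

lemma coeff_above: "supp_le x r \<Longrightarrow> r < s \<Longrightarrow> pu_coeff x s = 0"
  by (force simp: supp_le_def)

lemma supp_le_plus: "supp_le x r \<Longrightarrow> supp_le y r \<Longrightarrow> supp_le (x + y) r"
  by (force simp: supp_le_def)

lemma coeff_sum: "pu_coeff (\<Sum>i\<in>A. t i) r = (\<Sum>i\<in>A. pu_coeff (t i) r)"
  by (induction A rule: infinite_finite_induct) auto

text \<open>Let \<open>R\<close> be the largest leading exponent among the negative terms. If every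
  positive term had smaller norm than \<open>t j\<close>, no term would have a positive coefficient
  at \<open>R\<close> while one has a negative coefficient, so these coefficients could not add up
  to zero.\<close>

lemma sval_sum_zero:
  assumes "finite A" "sum t A = 0" "j \<in> A" "t j < 0"
  shows "\<exists>i\<in>A. t i > 0 \<and> nrm (sval (t j)) \<le> nrm (sval (t i))"
proof (rule ccontr)
  assume neg: "\<not> ?thesis"
  define N where "N = {i \<in> A. t i < 0}"
  define R where "R = Max ((\<lambda>i. lead_exp (t i)) ` N)"
  have N: "finite N" "j \<in> N" using assms by (auto simp: N_def)
  have R: "lead_exp (t i) \<le> R" if "i \<in> N" for i using N that by (simp add: R_def)
  have "R \<in> (\<lambda>i. lead_exp (t i)) ` N" unfolding R_def using N by (intro Max_in) auto
  then obtain k where k: "k \<in> N" "lead_exp (t k) = R" by auto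
  have c: "pu_coeff (t i) R \<le> 0" if "i \<in> A" for i
  proof -
    consider "t i = 0" | "t i > 0" | "t i < 0" by (metis less_linear)
    then show ?thesis
    proof cases
      case 2
      then have "lead_exp (t i) < lead_exp (t j)"
        using neg assms(4) that nrm_sval[of "t i"] nrm_sval[of "t j"] by force
      then have "lead_exp (t i) < R" using R[OF N(2)] by simp
      then show ?thesis using coeff_above[OF lead_exp(2)[of "t i"]] 2 by force
    next
      case 3
      then have "lead_exp (t i) < R \<or> lead_exp (t i) = R" using R[of i] that by (auto simp: N_def)
      then show ?thesis using coeff_above[OF lead_exp(2)[of "t i"], of R] 3 puiseux_sign(2)[of "t i"] by force
    qed simp
  qed
  have "pu_coeff (t k) R < 0" using k puiseux_sign(2)[of "t k"] by (auto simp: N_def)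
  moreover have "(\<Sum>i\<in>A. pu_coeff (t i) R) = 0" using assms(2) coeff_sum[of t A R] by simp
  moreover have "k \<in> A" using k by (simp add: N_def)
  ultimately obtain i where "i \<in> A" "pu_coeff (t i) R > 0"
    using sum_zero_sign[OF assms(1), of "\<lambda>i. pu_coeff (t i) R" k] by blast
  then show False using c by fastforce
qed

lemma sval_orth:
  fixes w v :: "puiseux ^ 'n"
  assumes "(\<Sum>i\<in>UNIV. w $ i * v $ i) = 0"
  shows "orth (map_vec sval w) (map_vec sval v)"
proof -
  have t: "map_vec sval u \<in> vecs tpm" for u :: "puiseux ^ 'n"
    by (simp add: vecs_def)
  have "(\<Sum>i\<in>UNIV. - (w $ i * v $ i)) = 0" using assms by (simp add: sum_negf)
  then have "\<exists>i. w $ i * v $ i < 0 \<and> nrm (sval (w $ j * v $ j)) \<le> nrm (sval (w $ i * v $ i))" if "w $ j * v $ j > 0" for j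
    using sval_sum_zero[of UNIV "\<lambda>i. - (w $ i * v $ i)" j] that by (auto simp: sval_uminus)
  moreover have "\<exists>i. w $ i * v $ i > 0 \<and> nrm (sval (w $ j * v $ j)) \<le> nrm (sval (w $ i * v $ i))" if "w $ j * v $ j < 0" for j
    using sval_sum_zero[of UNIV "\<lambda>i. w $ i * v $ i" j] assms that by auto
  ultimately show ?thesis
    unfolding orth_iff[OF t t] map_vec_nth sval_mult[symmetric] sval_sign by blast
qed

section \<open>Valuations of sums and the matroid of a linear space\<close>

lemma sval_plus_dominant:
  assumes "nrm (sval y) < nrm (sval x)"
  shows "sval (x + y) = sval x"
proof (cases x rule: sval_cases)
  case (2 r)
  then have y: "supp_le y r \<and> pu_coeff y r = 0"
  proof (cases y rule: sval_cases)
    case (2 s)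
    then have "s < r" using assms \<open>nrm (sval x) = ereal r\<close> by simp
    then show ?thesis using 2 coeff_above supp_le_mono by (metis less_imp_le)
  qed (simp add: supp_le_def)
  then show ?thesis using 2 sval_eqI[OF supp_le_plus[of x r y]] by simp
qed (use assms in auto)

lemma sval_plus_unbalance: "sval (x + y) \<in> unbalance (sval x + sval y)"
proof -
  have "nrm (sval (x + y)) \<le> nrm (sval x)" if "nrm (sval x) = nrm (sval y)"
  proof (cases x rule: sval_cases)
    case 1
    then have "nrm (sval y) = -\<infinity>" using that by simp
    then show ?thesis using 1 by simp
  next
    case (2 r)
    then have "supp_le y r" using that by (cases y rule: sval_cases) auto
    then have "supp_le (x + y) r" using 2 supp_le_plus by blast
    then have "nrm (sval (x + y)) \<le> ereal r"
      by (cases "x + y" rule: sval_cases) (auto simp: supp_le_def)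
    then show ?thesis using 2 by simp
  qed
  moreover have "sval (x + y) = sval x" if "sval x = sval y"
  proof (cases x rule: sval_cases)
    case 1
    then show ?thesis using that by auto
  next
    case (2 r)
    then have y: "supp_le y r" "pu_coeff y r \<noteq> 0" "pu_coeff y r > 0 \<longleftrightarrow> pu_coeff x r > 0"
      using that by (cases y rule: sval_cases; auto split: if_splits)+
    then have "pu_coeff (x + y) r \<noteq> 0" "pu_coeff (x + y) r > 0 \<longleftrightarrow> pu_coeff x r > 0" using 2 by auto
    then show ?thesis using 2 sval_eqI[OF supp_le_plus[of x r y]] y by simp
  qed
  ultimately show ?thesis
    unfolding unbalance_plus_iff[OF sval_tpm sval_tpm]
    using sval_plus_dominant[of y x] sval_plus_dominant[of x y] by (auto simp: add.commute not_less)
qed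

text \<open>A positive constant factor leaves the valuation of \<open>y\<close> alone; in a tie, a
  small one lets the leading coefficient of \<open>x\<close> decide the sign, as a left sum
  demands.\<close>

lemma sval_left_sum:
  "\<exists>\<delta>>0. \<forall>\<epsilon>. 0 < \<epsilon> \<and> \<epsilon> < \<delta> \<longrightarrow> sval (x + monomial \<epsilon> 0 * y) = left_sum (sval x) (sval y)"
proof -
  have e: "sval (monomial \<epsilon> 0 * y) = sval y" if "0 < \<epsilon>" for \<epsilon>
    using sval_monomial[of \<epsilon> 0] that by (simp add: sval_mult one_symtrop_def[symmetric])
  consider "nrm (sval y) < nrm (sval x)" | "nrm (sval x) < nrm (sval y)" | "nrm (sval x) = nrm (sval y)"
    by (meson less_linear)
  then show ?thesis
  proof cases
    case 1
    then show ?thesis using sval_plus_dominant e by (intro exI[of _ 1]) (auto simp: left_sum_eq)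
  next
    case 2
    then show ?thesis using sval_plus_dominant e
      by (intro exI[of _ 1]) (auto simp: left_sum_eq not_le add.commute[of x])
  next
    case 3
    show ?thesis
    proof (cases x rule: sval_cases)
      case 1
      then have "nrm (sval y) = -\<infinity>" using 3 by simp
      then show ?thesis using 1 by (intro exI[of _ 1]) (auto simp: left_sum_eq)
    next
      case (2 r)
      then have y: "supp_le y r" "pu_coeff y r \<noteq> 0" using 3 by (cases y rule: sval_cases; auto)+
      let ?d = "\<bar>pu_coeff x r\<bar> / \<bar>pu_coeff y r\<bar>"
      have "sval (x + monomial \<epsilon> 0 * y) = sval x" if \<epsilon>: "0 < \<epsilon>" "\<epsilon> < ?d" for \<epsilon>
      proof -
        have s: "supp_le (monomial \<epsilon> 0 * y) r"
          using supp_le_times[OF supp_le_monomial[of \<epsilon> 0] y(1)] by simp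
        have c: "pu_coeff (monomial \<epsilon> 0 * y) r = \<epsilon> * pu_coeff y r"
          using coeff_times_top[OF supp_le_monomial[of \<epsilon> 0] y(1)] by (simp add: coeff_monomial)
        have "\<bar>\<epsilon> * pu_coeff y r\<bar> < \<bar>pu_coeff x r\<bar>"
          using \<epsilon> y(2) by (simp add: abs_mult pos_less_divide_eq)
        then have "pu_coeff x r + \<epsilon> * pu_coeff y r \<noteq> 0" "pu_coeff x r + \<epsilon> * pu_coeff y r > 0 \<longleftrightarrow> pu_coeff x r > 0"
          by linarith+
        then show ?thesis using 2 s c sval_eqI[OF supp_le_plus[of x r "monomial \<epsilon> 0 * y"]] by simp
      qed
      moreover have "?d > 0" using 2 y(2) by simp
      moreover have "left_sum (sval x) (sval y) = sval x" using 3 by (simp add: left_sum_eq)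
      ultimately show ?thesis by metis
    qed
  qed
qed

text \<open>Scalars lift to monomials, left sums to adding a small constant multiple of
  \<open>b\<close> to \<open>a\<close>, and elimination to the linear combination cancelling
  coordinate \<open>i\<close>.\<close>

lemma sval_matroid:
  fixes L :: "(puiseux ^ 'n) set"
  assumes L: "vec.subspace L"
  shows "matroid_vectors tpm (image_vec sval L)"
  unfolding matroid_vectors_def image_vec_eq
proof (intro conjI ballI allI impI)
  show "map_vec sval ` L \<subseteq> vecs tpm" by (auto simp: vecs_def)
  have "map_vec sval 0 = (0 :: symtrop ^ 'n)" by (simp add: vec_eq_iff)
  then show zero: "0 \<in> map_vec sval ` L" using vec.subspace_0[OF L] by (metis image_eqI)
  fix x y assume "x \<in> map_vec sval ` L" "y \<in> map_vec sval ` L"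
  then obtain a b where ab: "a \<in> L" "b \<in> L" "x = map_vec sval a" "y = map_vec sval b" by blast
  show "s *s x \<in> map_vec sval ` L" if "s \<in> tpm" for s
  proof -
    have "\<exists>m. sval m = s"
      using that
    proof (cases rule: tpm_cases)
      case zero
      then show ?thesis by (metis sval_zero_iff zero_symtrop_def)
    next
      case (pos r)
      then show ?thesis using sval_monomial[of 1 r] by auto
    next
      case (neg r)
      then show ?thesis using sval_monomial[of "- 1" r] by auto
    qed
    then obtain m where "sval m = s" by blast
    then have "s *s x = map_vec sval (m *s a)" using ab by (simp add: vec_eq_iff sval_mult)
    then show ?thesis using vec.subspace_scale[OF L ab(1)] by blast
  qed
  show "left_sum_vec x y \<in> map_vec sval ` L"
  proof -
    obtain \<delta> where \<delta>: "\<And>i. \<delta> i > 0"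
      "\<And>i \<epsilon>. 0 < \<epsilon> \<Longrightarrow> \<epsilon> < \<delta> i \<Longrightarrow> sval (a $ i + monomial \<epsilon> 0 * b $ i) = left_sum (sval (a $ i)) (sval (b $ i))"
    proof -
      have "\<forall>i. \<exists>d>0. \<forall>\<epsilon>. 0 < \<epsilon> \<and> \<epsilon> < d \<longrightarrow>
          sval (a $ i + monomial \<epsilon> 0 * b $ i) = left_sum (sval (a $ i)) (sval (b $ i))"
        using sval_left_sum by blast
      then show ?thesis using that unfolding choice_iff by blast
    qed
    \<comment> \<open>Half the minimum lies strictly below the bounds of all finitely many
      coordinates.\<close>
    define \<epsilon> where "\<epsilon> = Min (range \<delta>) / 2"
    have "Min (range \<delta>) \<in> range \<delta>" by (intro Min_in) auto
    then have m: "Min (range \<delta>) > 0" using \<delta>(1) by auto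
    have le: "Min (range \<delta>) \<le> \<delta> i" for i by (intro Min_le) auto
    have "0 < \<epsilon>" "\<epsilon> < \<delta> i" for i
      using m le[of i] unfolding \<epsilon>_def by linarith+
    then have "left_sum_vec x y = map_vec sval (a + monomial \<epsilon> 0 *s b)"
      using \<delta>(2) ab by (simp add: vec_eq_iff left_sum_vec_def)
    then show ?thesis using vec.subspace_add[OF L ab(1) vec.subspace_scale[OF L ab(2)]] by blast
  qed
  fix i assume i: "x $ i = - y $ i \<and> x $ i \<noteq> 0"
  \<comment> \<open>The coefficient that cancels coordinate \<open>i\<close>. Opposite valuations of
    \<open>a $ i\<close> and \<open>b $ i\<close> make \<open>sval l\<close> equal to
    \<open>1\<close>, so \<open>l *s b\<close> still has image \<open>y\<close>.\<close>
  define l where "l = - (a $ i) / b $ i"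
  have b: "b $ i \<noteq> 0" using i ab by auto
  have "sval l * sval (b $ i) = sval (b $ i)"
  proof -
    have "l * b $ i = - a $ i" using b by (simp add: l_def)
    then have "sval l * sval (b $ i) = - sval (a $ i)" by (metis sval_mult sval_uminus)
    then show ?thesis using i ab by simp
  qed
  then have "sval l = 1"
    using b sval_tpm[of l] sval_tpm[of "b $ i"] by (cases "sval l" rule: uminus_symtrop.cases; cases "sval (b $ i)" rule: uminus_symtrop.cases)
      (auto simp: one_symtrop_def zero_symtrop_def[symmetric])
  then have "sval (l * b $ k) = y $ k" for k using ab by (simp add: sval_mult)
  then have "map_vec sval (a + l *s b) \<in> unbalance_vec (x + y)"
    using sval_plus_unbalance[of "a $ _" "l * b $ _"] ab by (simp add: unbalance_vec_def)
  moreover have "map_vec sval (a + l *s b) $ i = 0" using b by (simp add: l_def)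
  moreover have "map_vec sval (a + l *s b) \<in> vecs tpm" by (simp add: vecs_def)
  moreover have "a + l *s b \<in> L" using vec.subspace_add[OF L ab(1) vec.subspace_scale[OF L ab(2)]] .
  ultimately show "\<exists>z\<in>map_vec sval ` L. z \<in> unbalance_vec (x + y) \<inter> vecs tpm \<and> z $ i = 0" by blast
qed

text \<open>The valuation image is itself a matroid by \<open>sval_matroid\<close>, and
  \<open>L\<close> realizes it.\<close>

lemma tropical_image_sval:
  fixes L :: "(puiseux ^ 'n) set"
  assumes L: "vec.subspace L"
  shows "tropical_image_description sval L"
proof -
  interpret K: realized_matroid tpm "image_vec sval L" sval L
    by unfold_locales (use L sval_matroid[OF L] sval_orth in \<open>auto simp: realizes_def\<close>)
  show ?thesis by (rule K.tropical_image) simp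
qed

text \<open>\<open>H\<close> stays open because the signed valuation of real constants is the sign
  map, so the tropical case over the reals is an instance as well.\<close>

lemma sign_realized:
  fixes L :: "('a::linordered_field ^ 'n) set"
  assumes "H = tpm \<or> H = sign_hyperfield" "matroid_vectors H V" "realizes sign_map L V"
  shows "realized_matroid H V sign_map L"
  by unfold_locales (use assms sign_map_orth in \<open>auto simp: sign_map_simps\<close>)

theorem theorem7p8:
  fixes H :: "symtrop set" and C D V :: "(symtrop ^ 'n) set"
  assumes "H = tpm \<or> H = sign_hyperfield"
    and "matroid_vectors H V"
    and "C = circuits V"
    and "D = cocircuits H V"
  shows
    "(H = tpm \<longrightarrow>
        V = conv_tc C \<union> {0} \<and>
        V = vecs tpm \<inter> (\<Inter>d\<in>D. hyperplane 0 d) \<and>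
        V = perp D) \<and>
     (H = sign_hyperfield \<longrightarrow>
        span_tc V = span_tc C \<and>
        span_tc V = vecs tpm \<inter> (\<Inter>d\<in>D. hyperplane 0 d) \<and>
        conv_tc V = conv_tc (C \<union> {0}) \<and>
        conv_tc V = vecs tpm \<inter> (\<Inter>d\<in>D. hyperplane 0 d) \<inter> vecs {x \<in> tpm. - 1 \<le> x \<and> x \<le> 1} \<and>
        V = vecs {- 1, 0, 1} \<inter> conv_tc (C \<union> {0}) \<and>
        V = vecs {- 1, 0, 1} \<inter> (vecs tpm \<inter> (\<Inter>d\<in>D. hyperplane 0 d))) \<and>
     (\<forall>L :: (real ^ 'n) set.
        (H = tpm \<and> realizes sval_real L V \<longrightarrow> tropical_image_description sval_real L) \<and>
        (H = sign_hyperfield \<and> realizes sign_map L V \<longrightarrow> sign_image_description sign_map L)) \<and>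
     (\<forall>L :: (puiseux ^ 'n) set.
        (H = tpm \<and> realizes sval L V \<longrightarrow> tropical_image_description sval L) \<and>
        (H = sign_hyperfield \<and> realizes sign_map L V \<longrightarrow>
           sign_image_description sign_map L \<and> tropical_image_description sval L))"
proof -
  interpret trop_matroid H V by unfold_locales (rule assms)+
  show ?thesis
    unfolding hyperplanes_eq_perp assms(3,4) sign_hyperfield_def[symmetric]
  proof (intro conjI impI allI; (elim conjE)?)
    show "tropical_image_description sval_real L" if "H = tpm" "realizes sval_real L V" for L :: "(real ^ 'n) set"
      using realized_matroid.tropical_image[OF sign_realized[OF assms(1,2)]] that unfolding sval_real_eq by blast
    show "sign_image_description sign_map L" if "H = sign_hyperfield" "realizes sign_map L V" for L :: "(real ^ 'n) set"
      using realized_matroid.sign_image[OF sign_realized[OF assms(1,2)]] that by blast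
    show "sign_image_description sign_map L" if "H = sign_hyperfield" "realizes sign_map L V" for L :: "(puiseux ^ 'n) set"
      using realized_matroid.sign_image[OF sign_realized[OF assms(1,2)]] that by blast
    show "tropical_image_description sval L" if "realizes sval L V" for L :: "(puiseux ^ 'n) set"
      using that unfolding realizes_def by (intro tropical_image_sval) (rule conjunct1)
    \<comment> \<open>The valuation image is a tropical matroid in its own right and need not be
      \<open>V\<close>.\<close>
    show "tropical_image_description sval L" if "realizes sign_map L V" for L :: "(puiseux ^ 'n) set"
      using that unfolding realizes_def by (intro tropical_image_sval) (rule conjunct1)
  next
    assume H: "H = tpm"
    show "V = conv_tc (circuits V) \<union> {0}" "V = perp (cocircuits H V)" "V = perp (cocircuits H V)"
      by (rule tropical_description[OF H])+
  next
    assume H: "H = sign_hyperfield"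
    show "span_tc V = span_tc (circuits V)" "conv_tc V = conv_tc (circuits V \<union> {0})"
      by (simp_all only: sign_span[OF H] sign_conv[OF H])
    show "span_tc V = perp (cocircuits H V)"
      by (rule sign_span(2)[OF H])
    show "conv_tc V = perp (cocircuits H V) \<inter> unit_box"
      by (rule sign_conv(2)[OF H])
    show "V = vecs sign_hyperfield \<inter> conv_tc (circuits V \<union> {0})"
      "V = vecs sign_hyperfield \<inter> perp (cocircuits H V)"
      by (rule sign_vectors[OF H])+
  qed
qed

end
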